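(* Let $G$ be a 2-connected $\{K_{1,3},S\}$-$o$-heavy graph, where $S\in\{P_4,P_5,C_3,Z_1,Z_2,B,N,W\}$. Then $cl_c(G)$ is claw-free and $N$-$pq$-heavy.
   Context: All graphs are finite, simple and undirected; $n=|V(G)|$ and $d(v)$ denotes the degree of $v$ in $G$. A pair of nonadjacent vertices $\{u,v\}$ is an $o$-heavy pair if $d(u)+d(v)\ge n$; an adjacent pair $\{u,v\}$ with $d(u)+d(v)\ge n$ is an $a$-heavy pair; a vertex $u$ is heavy if $d(u)\ge n/2$. For a graph $H$, $G$ is $H$-$o$-heavy if every induced subgraph of $G$ isomorphic to $H$ contains an $o$-heavy pair of $G$; for a family $\mathcal H$, $G$ is $\mathcal H$-$o$-heavy if it is $H$-$o$-heavy for every $H\in\mathcal H$. $K_{1,3}$ is the claw; $P_k$ and $C_k$ are the path and cycle on $k$ vertices; $Z_k$ is obtained by identifying a vertex of a $C_3$ with an end-vertex of a $P_{k+1}$; $B$ (bull) is a triangle with a pendant edge attached at two of its vertices; $W$ (wounded) is a triangle with a pendant edge at one vertex and a pendant path of length two at another vertex; $N$ (net) is a triangle $a_1a_2a_3$ with pendant vertices $b_1,b_2,b_3$, where $b_i$ is adjacent only to $a_i$. An induced net of $G$ is $p$-heavy if its triangle contains an $a$-heavy pair of $G$; it is $q$-heavy if there is $i\in\{1,2,3\}$ such that $a_i,b_i$ are heavy in $G$, and for both $j\neq i$: $d(a_j)=3$, $d(b_j)=2$, and the neighbor of $b_j$ other than $a_j$ is heavy. $G$ is $N$-$pq$-heavy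 if every induced net of $G$ is $p$-heavy or $q$-heavy. $cl_c(G)$ is Čada's closure of a claw-$o$-heavy graph $G$: for $x\in V(G)$, let $G^{BC}_x$ be $G$ plus all edges $uv$ with $u,v\in N(x)$, $uv\notin E(G)$, $d(u)+d(v)\ge n$. A vertex $x$ is $c$-eligible if $N(x)$ is not a clique in $G^{BC}_x$ and either (i) $G^{BC}_x[N(x)]$ is connected, or (ii) $G^{BC}_x[N(x)]$ is the disjoint union of two cliques $C_1,C_2$ and $x$ lies in an $o$-heavy pair $\{x,z\}$ of $G$ with $zy_1,zy_2\in E(G)$ for some $y_1\in C_1$, $y_2\in C_2$. The local completion at a $c$-eligible $x$ adds all edges between vertices of $N(x)$; $cl_c(G)$ is obtained by repeating local completions at $c$-eligible vertices until none remain (it is uniquely determined, and equals the minimum $\{K_{1,3},\text{diamond}\}$-free spanning supergraph of $G$ with no $o$-heavy pair).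
   Formalization: A vertex x is taken to be c-eligible when N(x) is not a clique in G itself (not in G^BC_x, as the stated definition says); with the literal wording K_{3,3} would be its own closure and contain claws, so the claim would fail. *)

theory Defs
  imports "Graph_Theory.Graph_Theory"
begin

text \<open>
  A finite simple undirected graph is a \<^locale>\<open>pair_graph\<close>: a finite loopless digraph whose
  arc set is symmetric, so that the edge \<open>uv\<close> is the pair of arcs \<open>(u, v)\<close>, \<open>(v, u)\<close>.
\<close>

definition nbhd :: "'a pair_pre_digraph \<Rightarrow> 'a \<Rightarrow> 'a set" where
  "nbhd G v = {u. (v, u) \<in> parcs G}"

definition deg :: "'a pair_pre_digraph \<Rightarrow> 'a \<Rightarrow> nat" where
  "deg G v = card (nbhd G v)"

definition two_connected :: "'a pair_pre_digraph \<Rightarrow> bool" where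
  "two_connected G \<longleftrightarrow> card (pverts G) \<ge> 3 \<and> connected (with_proj G) \<and>
     (\<forall>v \<in> pverts G. connected (with_proj G \<restriction> (pverts G - {v})))"

definition clique :: "'a pair_pre_digraph \<Rightarrow> 'a set \<Rightarrow> bool" where
  "clique G C \<longleftrightarrow> C \<subseteq> pverts G \<and> (\<forall>u \<in> C. \<forall>v \<in> C. u \<noteq> v \<longrightarrow> (u, v) \<in> parcs G)"


section \<open>Heavy vertices and pairs\<close>

definition o_heavy_pair :: "'a pair_pre_digraph \<Rightarrow> 'a \<Rightarrow> 'a \<Rightarrow> bool" where
  "o_heavy_pair G u v \<longleftrightarrow> u \<in> pverts G \<and> v \<in> pverts G \<and> u \<noteq> v \<and> (u, v) \<notin> parcs G \<and>
     deg G u + deg G v \<ge> card (pverts G)"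

definition a_heavy_pair :: "'a pair_pre_digraph \<Rightarrow> 'a \<Rightarrow> 'a \<Rightarrow> bool" where
  "a_heavy_pair G u v \<longleftrightarrow> (u, v) \<in> parcs G \<and> deg G u + deg G v \<ge> card (pverts G)"

definition heavy :: "'a pair_pre_digraph \<Rightarrow> 'a \<Rightarrow> bool" where
  "heavy G u \<longleftrightarrow> u \<in> pverts G \<and> real (deg G u) \<ge> real (card (pverts G)) / 2"


section \<open>Induced copies of a graph\<close>

text \<open>
  The induced subgraphs of \<open>G\<close> isomorphic to \<open>H\<close> are those induced by the images of the
  embeddings below; see \<open>induced_copy_iff\<close> for the link with \<^const>\<open>digraph_iso\<close>.
\<close>

definition induced_embedding ::
  "'b pair_pre_digraph \<Rightarrow> 'a pair_pre_digraph \<Rightarrow> ('b \<Rightarrow> 'a) \<Rightarrow> bool" where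
  "induced_embedding H G f \<longleftrightarrow> inj_on f (pverts H) \<and> f ` pverts H \<subseteq> pverts G \<and>
     (\<forall>u \<in> pverts H. \<forall>v \<in> pverts H. (f u, f v) \<in> parcs G \<longleftrightarrow> (u, v) \<in> parcs H)"

definition induced_free :: "'b pair_pre_digraph \<Rightarrow> 'a pair_pre_digraph \<Rightarrow> bool" where
  "induced_free H G \<longleftrightarrow> \<not> (\<exists>f. induced_embedding H G f)"

definition o_heavy :: "'b pair_pre_digraph \<Rightarrow> 'a pair_pre_digraph \<Rightarrow> bool" where
  "o_heavy H G \<longleftrightarrow> (\<forall>f. induced_embedding H G f \<longrightarrow>
     (\<exists>u \<in> f ` pverts H. \<exists>v \<in> f ` pverts H. o_heavy_pair G u v))"

definition family_o_heavy :: "'b pair_pre_digraph set \<Rightarrow> 'a pair_pre_digraph \<Rightarrow> bool" where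
  "family_o_heavy \<H> G \<longleftrightarrow> (\<forall>H \<in> \<H>. o_heavy H G)"

lemma induced_copy_iff:
  assumes "pair_graph H" "pair_graph G" "A \<subseteq> pverts G"
  shows "digraph_iso (with_proj H) (with_proj G \<restriction> A) \<longleftrightarrow>
         (\<exists>f. induced_embedding H G f \<and> f ` pverts H = A)"
proof
  assume "digraph_iso (with_proj H) (with_proj G \<restriction> A)"
  then obtain h where h: "pre_digraph.digraph_isomorphism (with_proj H) h"
      and eq: "with_proj G \<restriction> A = app_iso h (with_proj H)"
    by (auto simp: digraph_iso_def)
  let ?f = "iso_verts h"
  have verts: "?f ` pverts H = A"
    using arg_cong[OF eq, of verts] by simp
  have tail: "iso_tail h = fst" and head: "iso_head h = snd"
    using arg_cong[OF eq, of tail] arg_cong[OF eq, of head] by simp_all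
  have arcs: "{e \<in> parcs G. fst e \<in> A \<and> snd e \<in> A} = iso_arcs h ` parcs H"
    using arg_cong[OF eq, of arcs] by (simp add: induce_subgraph_def)
  have on_arcs: "iso_arcs h (u, v) = (?f u, ?f v)" if "(u, v) \<in> parcs H" for u v
    using h that tail head
    by (auto simp: pre_digraph.digraph_isomorphism_def prod_eq_iff)
  have inj: "inj_on ?f (pverts H)"
    using h by (auto simp: pre_digraph.digraph_isomorphism_def)
  have "(?f u, ?f v) \<in> parcs G \<longleftrightarrow> (u, v) \<in> parcs H" if uv: "u \<in> pverts H" "v \<in> pverts H" for u v
  proof
    assume "(u, v) \<in> parcs H"
    then show "(?f u, ?f v) \<in> parcs G"
      using arcs on_arcs[of u v] by (metis (mono_tags, lifting) imageI mem_Collect_eq)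
  next
    assume "(?f u, ?f v) \<in> parcs G"
    then have "(?f u, ?f v) \<in> iso_arcs h ` parcs H"
      using arcs verts uv by auto
    then obtain u' v' where e: "(u', v') \<in> parcs H" "?f u = ?f u'" "?f v = ?f v'"
      using on_arcs by auto
    then have "u' \<in> pverts H" "v' \<in> pverts H"
      using assms(1) by (auto simp: pair_graph_def pair_digraph_def pair_fin_digraph_def
          dest: pair_wf_digraph.in_arcsD1 pair_wf_digraph.in_arcsD2)
    then show "(u, v) \<in> parcs H"
      using e uv inj by (metis inj_onD)
  qed
  then show "\<exists>f. induced_embedding H G f \<and> f ` pverts H = A"
    using inj verts assms(3) by (intro exI[of _ ?f]) (auto simp: induced_embedding_def)
next
  assume "\<exists>f. induced_embedding H G f \<and> f ` pverts H = A"
  then obtain f where f: "induced_embedding H G f" and A: "A = f ` pverts H"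
    by auto
  interpret H: pair_graph H by fact
  define h where "h = \<lparr> iso_verts = f, iso_arcs = map_prod f f, iso_head = snd, iso_tail = fst \<rparr>"
  have inj: "inj_on f (pverts H)"
    using f by (simp add: induced_embedding_def)
  have "inj_on (map_prod f f) (parcs H)"
    by (rule inj_on_subset[OF map_prod_inj_on[OF inj inj]]) (auto dest: H.in_arcsD1 H.in_arcsD2)
  then have "pre_digraph.digraph_isomorphism (with_proj H) h"
    using inj H.wf_digraph by (auto simp: pre_digraph.digraph_isomorphism_def h_def)
  moreover have "map_prod f f ` parcs H = {e \<in> parcs G. fst e \<in> A \<and> snd e \<in> A}"
  proof (intro equalityI subsetI)
    fix e assume "e \<in> map_prod f f ` parcs H"
    then obtain u v where "(u, v) \<in> parcs H" "e = (f u, f v)" by auto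
    then show "e \<in> {e \<in> parcs G. fst e \<in> A \<and> snd e \<in> A}"
      using f A H.in_arcsD1 H.in_arcsD2 by (auto simp: induced_embedding_def)
  next
    fix e assume "e \<in> {e \<in> parcs G. fst e \<in> A \<and> snd e \<in> A}"
    then obtain u v where "u \<in> pverts H" "v \<in> pverts H" "e = (f u, f v)" "(f u, f v) \<in> parcs G"
      using A by (cases e) auto
    then show "e \<in> map_prod f f ` parcs H"
      using f by (auto simp: induced_embedding_def intro!: image_eqI[where x = "(u, v)"])
  qed
  then have "with_proj G \<restriction> A = app_iso h (with_proj H)"
    using A by (simp add: induce_subgraph_def app_iso_def h_def)
  ultimately show "digraph_iso (with_proj H) (with_proj G \<restriction> A)"
    unfolding digraph_iso_def by blast
qed


section \<open>The particular graphs\<close>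

definition graph_on :: "nat \<Rightarrow> (nat \<times> nat) set \<Rightarrow> nat pair_pre_digraph" where
  "graph_on k E = \<lparr> pverts = {..<k}, parcs = E \<union> E\<inverse> \<rparr>"

definition path_graph :: "nat \<Rightarrow> nat pair_pre_digraph" where
  "path_graph k = graph_on k {(i, Suc i) | i. Suc i < k}"

text \<open>Meaningful for \<open>k \<ge> 3\<close> only.\<close>
definition cycle_graph :: "nat \<Rightarrow> nat pair_pre_digraph" where
  "cycle_graph k = graph_on k (insert (k - 1, 0) {(i, Suc i) | i. Suc i < k})"

definition claw_graph :: "nat pair_pre_digraph" where
  "claw_graph = graph_on 4 {(0, 1), (0, 2), (0, 3)}"

text \<open>The triangle is \<open>0, 1, 2\<close> and the attached path is \<open>2, 3, \<dots>, k + 2\<close>.\<close>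
definition Z_graph :: "nat \<Rightarrow> nat pair_pre_digraph" where
  "Z_graph k = graph_on (k + 3)
     ({(0, 1), (1, 2), (0, 2)} \<union> {(i, Suc i) | i. 2 \<le> i \<and> i < k + 2})"

definition bull_graph :: "nat pair_pre_digraph" where
  "bull_graph = graph_on 5 {(0, 1), (1, 2), (0, 2), (0, 3), (1, 4)}"

definition wounded_graph :: "nat pair_pre_digraph" where
  "wounded_graph = graph_on 6 {(0, 1), (1, 2), (0, 2), (0, 3), (1, 4), (4, 5)}"

definition net_graph :: "nat pair_pre_digraph" where
  "net_graph = graph_on 6 {(0, 1), (1, 2), (0, 2), (0, 3), (1, 4), (2, 5)}"


section \<open>Heavy nets\<close>

text \<open>
  For an embedding \<open>f\<close> of the net, the triangle is \<open>f 0, f 1, f 2\<close> and the pendant vertex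
  attached to \<open>f i\<close> is \<open>f (i + 3)\<close>.
\<close>

definition p_heavy_net :: "'a pair_pre_digraph \<Rightarrow> (nat \<Rightarrow> 'a) \<Rightarrow> bool" where
  "p_heavy_net G f \<longleftrightarrow> (\<exists>i < 3. \<exists>j < 3. a_heavy_pair G (f i) (f j))"

definition q_heavy_net :: "'a pair_pre_digraph \<Rightarrow> (nat \<Rightarrow> 'a) \<Rightarrow> bool" where
  "q_heavy_net G f \<longleftrightarrow> (\<exists>i < 3. heavy G (f i) \<and> heavy G (f (i + 3)) \<and>
     (\<forall>j < 3. j \<noteq> i \<longrightarrow> deg G (f j) = 3 \<and> deg G (f (j + 3)) = 2 \<and>
        (\<forall>w \<in> nbhd G (f (j + 3)) - {f j}. heavy G w)))"

definition N_pq_heavy :: "'a pair_pre_digraph \<Rightarrow> bool" where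
  "N_pq_heavy G \<longleftrightarrow> (\<forall>f. induced_embedding net_graph G f \<longrightarrow> p_heavy_net G f \<or> q_heavy_net G f)"


section \<open>The closure\<close>

definition bc_graph :: "'a pair_pre_digraph \<Rightarrow> 'a \<Rightarrow> 'a pair_pre_digraph" where
  "bc_graph G x =
     G \<lparr> parcs := parcs G \<union> {(u, v). u \<in> nbhd G x \<and> v \<in> nbhd G x \<and> o_heavy_pair G u v} \<rparr>"

definition disjoint_union_of_cliques ::
  "'a pair_pre_digraph \<Rightarrow> 'a set \<Rightarrow> 'a set \<Rightarrow> 'a set \<Rightarrow> bool" where
  "disjoint_union_of_cliques G A C\<^sub>1 C\<^sub>2 \<longleftrightarrow> A = C\<^sub>1 \<union> C\<^sub>2 \<and> C\<^sub>1 \<inter> C\<^sub>2 = {} \<and>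
     clique G C\<^sub>1 \<and> clique G C\<^sub>2 \<and> (\<forall>u \<in> C\<^sub>1. \<forall>v \<in> C\<^sub>2. (u, v) \<notin> parcs G)"

text \<open>
  The neighbourhood of an eligible vertex is required not to be a clique of \<open>G\<close> itself. Demanding
  instead that it is not a clique of \<^term>\<open>bc_graph G x\<close> would leave o-heavy pairs and claws
  behind: in \<open>K\<^sub>3\<^sub>,\<^sub>3\<close> no vertex would be eligible.
\<close>

definition c_eligible :: "'a pair_pre_digraph \<Rightarrow> 'a \<Rightarrow> bool" where
  "c_eligible G x \<longleftrightarrow> x \<in> pverts G \<and> \<not> clique G (nbhd G x) \<and>
     (connected (with_proj (bc_graph G x) \<restriction> nbhd G x) \<or>
      (\<exists>C\<^sub>1 C\<^sub>2. disjoint_union_of_cliques (bc_graph G x) (nbhd G x) C\<^sub>1 C\<^sub>2 \<and>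
         (\<exists>z. o_heavy_pair G x z \<and>
            (\<exists>y\<^sub>1 \<in> C\<^sub>1. \<exists>y\<^sub>2 \<in> C\<^sub>2. (z, y\<^sub>1) \<in> parcs G \<and> (z, y\<^sub>2) \<in> parcs G))))"

definition local_completion :: "'a pair_pre_digraph \<Rightarrow> 'a \<Rightarrow> 'a pair_pre_digraph" where
  "local_completion G x =
     G \<lparr> parcs := parcs G \<union> {(u, v). u \<in> nbhd G x \<and> v \<in> nbhd G x \<and> u \<noteq> v} \<rparr>"

definition completion_step :: "'a pair_pre_digraph \<Rightarrow> 'a pair_pre_digraph \<Rightarrow> bool" where
  "completion_step G H \<longleftrightarrow> (\<exists>x. c_eligible G x \<and> H = local_completion G x)"

text \<open>
  \<open>is_c_closure G H\<close> holds iff \<open>H\<close> is the outcome of a maximal sequence of local completions.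
  That all such sequences from a claw-o-heavy graph end in the same graph is not built in.
\<close>

definition is_c_closure :: "'a pair_pre_digraph \<Rightarrow> 'a pair_pre_digraph \<Rightarrow> bool" where
  "is_c_closure G H \<longleftrightarrow> completion_step\<^sup>*\<^sup>* G H \<and> \<not> (\<exists>x. c_eligible H x)"

lemma pair_graph_local_completion:
  assumes "pair_graph G"
  shows "pair_graph (local_completion G x)"
proof -
  interpret pair_graph G by fact
  have sub: "nbhd G x \<subseteq> pverts G"
    by (auto simp: nbhd_def dest: in_arcsD2)
  have "{(u, v). u \<in> nbhd G x \<and> v \<in> nbhd G x \<and> u \<noteq> v} \<subseteq> pverts G \<times> pverts G"
    using sub by auto
  then have fin: "finite {(u, v). u \<in> nbhd G x \<and> v \<in> nbhd G x \<and> u \<noteq> v}"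
    using pair_finite_verts finite_subset by blast
  show ?thesis
    using sub fin pair_finite_verts pair_finite_arcs
    by unfold_locales
      (auto simp: local_completion_def symmetric_def sym_def
        dest: in_arcsD1 in_arcsD2 no_loops' arcs_symmetric)
qed

lemma is_c_closure_exists:
  assumes "pair_graph G"
  shows "\<exists>H. is_c_closure G H"
  using assms
proof (induction "card (pverts G \<times> pverts G - parcs G)" arbitrary: G rule: less_induct)
  case less
  interpret pair_graph G by fact
  show ?case
  proof (cases "\<exists>x. c_eligible G x")
    case False
    then show ?thesis
      by (intro exI[of _ G]) (simp add: is_c_closure_def)
  next
    case True
    then obtain x where x: "c_eligible G x" by blast
    let ?G' = "local_completion G x"
    have sub: "nbhd G x \<subseteq> pverts G"
      by (auto simp: nbhd_def dest: in_arcsD2)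
    then obtain u v where uv: "u \<in> nbhd G x" "v \<in> nbhd G x" "u \<noteq> v" "(u, v) \<notin> parcs G"
      using x by (auto simp: c_eligible_def clique_def)
    have "pverts ?G' \<times> pverts ?G' - parcs ?G' \<subset> pverts G \<times> pverts G - parcs G"
      using uv sub by (auto simp: local_completion_def)
    then have "card (pverts ?G' \<times> pverts ?G' - parcs ?G') < card (pverts G \<times> pverts G - parcs G)"
      using pair_finite_verts by (intro psubset_card_mono) auto
    then obtain H where H: "is_c_closure ?G' H"
      using less.hyps pair_graph_local_completion[OF less.prems] by blast
    have "completion_step G ?G'"
      using x by (auto simp: completion_step_def)
    then show ?thesis
      using H by (meson converse_rtranclp_into_rtranclp is_c_closure_def)
  qed
qed

end

theory Submission
  imports Defs
begin

text \<open>
  A local completion keeps the graph claw-o-heavy, and a claw-o-heavy graph without eligible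
    vertices
  has no o-heavy pair; hence the closure \<open>H\<close> is claw-free and each of its neighbourhoods is a clique
  or the disjoint union of two cliques. Moreover any two vertices of a maximal clique of \<open>H\<close> are
  joined by a path of \<open>G\<close> whose inner vertices are simplicial vertices of that clique.

  Each \<open>S\<close> is an induced subgraph of the net or of the wounded graph, so \<open>G\<close> is \<open>N\<close>-o-heavy or
  \<open>W\<close>-o-heavy. Take an induced net of \<open>H\<close> that is not p-heavy. Joining the vertices of its triangle
  by paths of \<open>G\<close> through simplicial vertices gives a triangle of \<open>G\<close> with three attached paths that
  contains no o-heavy pair, and therefore an induced net without o-heavy pair: a contradiction
    if \<open>G\<close>
  is \<open>N\<close>-o-heavy. If \<open>G\<close> is \<open>W\<close>-o-heavy, the three paths cannot be extended, so the triangle lies in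
  \<open>G\<close>. Each \<open>a\<^sub>i\<close> lies in a second maximal clique \<open>K\<^sub>i\<close>, and at most one \<open>K\<^sub>i\<close> contains a vertex whose
  degree sum with \<open>a\<^sub>i\<close> is at least \<open>n\<close>. By 2-connectedness every \<open>K\<^sub>i\<close> has a further vertex with
  neighbours outside \<open>K\<^sub>i\<close>; following such edges produces induced wounded graphs without o-heavy pair
  unless exactly one \<open>K\<^sub>i\<close> is heavy, the other two are single edges \<open>a\<^sub>j b\<^sub>j\<close>, and each \<open>b\<^sub>j\<close> has its
    only
  other neighbour in the heavy clique. Counting then shows that the heavy clique has more than
  \<open>n / 2\<close> vertices, which makes the net q-heavy.
\<close>

section \<open>Nets in claw-free relations\<close>

definition is_claw :: "'a rel \<Rightarrow> 'a \<Rightarrow> 'a \<Rightarrow> 'a \<Rightarrow> 'a \<Rightarrow> bool" where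
  "is_claw R x u v w \<longleftrightarrow>
     (x, u) \<in> R \<and> (x, v) \<in> R \<and> (x, w) \<in> R \<and> u \<noteq> v \<and> u \<noteq> w \<and> v \<noteq> w \<and>
     (u, v) \<notin> R \<and> (u, w) \<notin> R \<and> (v, w) \<notin> R"

definition claw_free :: "'a rel \<Rightarrow> bool" where
  "claw_free R \<longleftrightarrow> (\<forall>x u v w. \<not> is_claw R x u v w)"

definition is_net :: "'a rel \<Rightarrow> 'a \<Rightarrow> 'a \<Rightarrow> 'a \<Rightarrow> 'a \<Rightarrow> 'a \<Rightarrow> 'a \<Rightarrow> bool" where
  "is_net R a\<^sub>1 b\<^sub>1 a\<^sub>2 b\<^sub>2 a\<^sub>3 b\<^sub>3 \<longleftrightarrow>
     (a\<^sub>1, a\<^sub>2) \<in> R \<and> (a\<^sub>1, a\<^sub>3) \<in> R \<and> (a\<^sub>2, a\<^sub>3) \<in> R \<and> (a\<^sub>1, b\<^sub>1) \<in> R \<and> (a\<^sub>2, b\<^sub>2) \<in> R \<and> (a\<^sub>3, b\<^sub>3) \<in> R \<and>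
     (a\<^sub>1, b\<^sub>2) \<notin> R \<and> (a\<^sub>1, b\<^sub>3) \<notin> R \<and> (a\<^sub>2, b\<^sub>1) \<notin> R \<and> (a\<^sub>2, b\<^sub>3) \<notin> R \<and> (a\<^sub>3, b\<^sub>1) \<notin> R \<and> (a\<^sub>3, b\<^sub>2) \<notin> R \<and>
     (b\<^sub>1, b\<^sub>2) \<notin> R \<and> (b\<^sub>1, b\<^sub>3) \<notin> R \<and> (b\<^sub>2, b\<^sub>3) \<notin> R"

definition is_wounded :: "'a rel \<Rightarrow> 'a \<Rightarrow> 'a \<Rightarrow> 'a \<Rightarrow> 'a \<Rightarrow> 'a \<Rightarrow> 'a \<Rightarrow> bool" where
  "is_wounded R a b c p q r \<longleftrightarrow>
     (a, b) \<in> R \<and> (b, c) \<in> R \<and> (a, c) \<in> R \<and> (a, p) \<in> R \<and> (b, q) \<in> R \<and> (q, r) \<in> R \<and>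
     (a, q) \<notin> R \<and> (a, r) \<notin> R \<and> (b, p) \<notin> R \<and> (b, r) \<notin> R \<and> (c, p) \<notin> R \<and> (c, q) \<notin> R \<and> (c, r) \<notin> R \<and>
     (p, q) \<notin> R \<and> (p, r) \<notin> R"

definition induced_path :: "'a rel \<Rightarrow> (nat \<Rightarrow> 'a) \<Rightarrow> nat \<Rightarrow> bool" where
  "induced_path R p k \<longleftrightarrow>
     inj_on p {..k} \<and> (\<forall>i\<le>k. \<forall>j\<le>k. (p i, p j) \<in> R \<longleftrightarrow> j = Suc i \<or> i = Suc j)"

definition joined_at_start :: "'a rel \<Rightarrow> (nat \<Rightarrow> 'a) \<Rightarrow> nat \<Rightarrow> (nat \<Rightarrow> 'a) \<Rightarrow> nat \<Rightarrow> bool" where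
  "joined_at_start R x k y l \<longleftrightarrow> (\<forall>i\<le>k. \<forall>j\<le>l. (x i, y j) \<in> R \<longleftrightarrow> i = 0 \<and> j = 0)"

definition generalized_net ::
  "'a rel \<Rightarrow> (nat \<Rightarrow> 'a) \<Rightarrow> nat \<Rightarrow> (nat \<Rightarrow> 'a) \<Rightarrow> nat \<Rightarrow> (nat \<Rightarrow> 'a) \<Rightarrow> nat \<Rightarrow> bool" where
  "generalized_net R x k y l z m \<longleftrightarrow>
     induced_path R x k \<and> induced_path R y l \<and> induced_path R z m \<and>
     joined_at_start R x k y l \<and> joined_at_start R y l z m \<and> joined_at_start R x k z m"

lemma is_claw_perm:
  assumes "sym R" "is_claw R x u v w"
  shows "is_claw R x v u w" "is_claw R x w u v"
  using assms unfolding is_claw_def by (auto dest: symD)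

lemma is_net_Restr_iff:
  "is_net (Restr R Q) x x' y y' z z' \<longleftrightarrow> is_net R x x' y y' z z' \<and> {x, x', y, y', z, z'} \<subseteq> Q"
  unfolding is_net_def by auto

lemma is_wounded_Restr_iff:
  "is_wounded (Restr R Q) a b c p q r \<longleftrightarrow> is_wounded R a b c p q r \<and> {a, b, c, p, q, r} \<subseteq> Q"
  unfolding is_wounded_def by auto

lemma rtrancl_Restr_mono: "(u, v) \<in> (Restr R A)\<^sup>* \<Longrightarrow> A \<subseteq> B \<Longrightarrow> (u, v) \<in> (Restr R B)\<^sup>*"
  by (rule rtrancl_mono[THEN subsetD, rotated]) auto

lemma joined_at_start_sym: "sym R \<Longrightarrow> joined_at_start R x k y l \<Longrightarrow> joined_at_start R y l x k"
  unfolding joined_at_start_def by (metis symD)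

lemma generalized_net_rotate:
  "sym R \<Longrightarrow> generalized_net R x k y l z m \<Longrightarrow> generalized_net R y l z m x k"
  unfolding generalized_net_def using joined_at_start_sym by metis

lemma generalized_net_joined_rev:
  assumes "sym R" "generalized_net R x k y l z m"
  shows "joined_at_start R y l x k" "joined_at_start R z m x k" "joined_at_start R z m y l"
  using assms joined_at_start_sym unfolding generalized_net_def by blast+

lemma generalized_net_is_net:
  assumes "sym R" "generalized_net R x k y l z m" "1 \<le> k" "1 \<le> l" "1 \<le> m"
  shows "is_net R (x 0) (x 1) (y 0) (y 1) (z 0) (z 1)"
  using assms(2-5) generalized_net_joined_rev[OF assms(1,2)]
  unfolding generalized_net_def is_net_def induced_path_def joined_at_start_def by simp

lemma generalized_net_is_wounded:
  assumes "sym R" "generalized_net R x k y l z m" "2 \<le> k" "1 \<le> l"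
  shows "is_wounded R (y 0) (x 0) (z 0) (y 1) (x 1) (x 2)"
  using assms(2-4) generalized_net_joined_rev[OF assms(1,2)]
  unfolding generalized_net_def is_wounded_def induced_path_def joined_at_start_def by simp

lemma no_shortcut_induced_path:
  assumes "sym R" "irrefl R" and step: "\<And>i. i < k \<Longrightarrow> (p i, p (Suc i)) \<in> R"
    and no_shortcut: "\<And>i j l. (p i, p j) \<in> R ^^ l \<Longrightarrow> i \<le> k \<Longrightarrow> j \<le> k \<Longrightarrow> j \<le> i + l"
  shows "induced_path R p k"
proof -
  have "inj_on p {..k}"
  proof (rule inj_onI)
    fix i j
    assume "i \<in> {..k}" "j \<in> {..k}" "p i = p j"
    then show "i = j"
      using no_shortcut[of i j 0] no_shortcut[of j i 0] by auto
  qed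
  moreover have "(p i, p j) \<in> R \<longleftrightarrow> j = Suc i \<or> i = Suc j" if "i \<le> k" "j \<le> k" for i j
  proof
    assume "(p i, p j) \<in> R"
    then have "j \<le> Suc i" "i \<le> Suc j" "i \<noteq> j"
      using no_shortcut[of i j 1] no_shortcut[of j i 1] that assms(1,2)
      by (auto intro: symD simp: irrefl_def)
    then show "j = Suc i \<or> i = Suc j" by linarith
  qed (use that step in \<open>auto intro: symD[OF assms(1)]\<close>)
  ultimately show ?thesis
    unfolding induced_path_def by blast
qed

lemma shortest_path_to:
  assumes "sym R" "irrefl R" "(a, b) \<in> R\<^sup>*" "b \<in> T"
  obtains p k where "induced_path R p k" "p 0 = a" "p k \<in> T" "\<And>i. i < k \<Longrightarrow> p i \<notin> T"
proof -
  define reaches where "reaches k \<longleftrightarrow> (\<exists>c\<in>T. (a, c) \<in> R ^^ k)" for k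
  define k where "k = (LEAST k. reaches k)"
  have "\<exists>k. reaches k"
    using assms(3,4) rtrancl_imp_relpow unfolding reaches_def by metis
  then have "reaches k"
    unfolding k_def by (metis LeastI)
  then obtain p where start: "p 0 = a" and target: "p k \<in> T"
    and step: "\<And>i. i < k \<Longrightarrow> (p i, p (Suc i)) \<in> R"
    unfolding reaches_def relpow_fun_conv by blast
  have minimal: "k \<le> l" if "c \<in> T" "(a, c) \<in> R ^^ l" for l c
    unfolding k_def by (rule Least_le) (use that reaches_def in blast)
  have segment: "(p i, p j) \<in> R ^^ (j - i)" if "i \<le> j" "j \<le> k" for i j
    unfolding relpow_fun_conv by (rule exI[of _ "\<lambda>t. p (i + t)"]) (use that step in auto)
  have "j \<le> i + l" if "(p i, p j) \<in> R ^^ l" "i \<le> k" "j \<le> k" for i j l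
  proof -
    have "(a, p i) \<in> R ^^ i" "(p j, p k) \<in> R ^^ (k - j)"
      using segment[of 0 i] segment[of j k] start that by simp_all
    then have "(a, p k) \<in> R ^^ (i + l + (k - j))"
      using that(1) relpow_trans by metis
    then show ?thesis
      using minimal[OF target] that(3) by fastforce
  qed
  then have "induced_path R p k"
    using no_shortcut_induced_path[where p = p and k = k, OF assms(1,2) step] by blast
  moreover have "p i \<notin> T" if "i < k" for i
    using minimal[of "p i" i] segment[of 0 i] start that by auto
  ultimately show thesis
    using that start target by blast
qed

lemma induced_path_adjacent_iff:
  "induced_path R p k \<Longrightarrow> i \<le> k \<Longrightarrow> j \<le> k \<Longrightarrow> (p i, p j) \<in> R \<longleftrightarrow> j = Suc i \<or> i = Suc j"
  unfolding induced_path_def by blast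

lemma induced_path_eq_iff: "induced_path R p k \<Longrightarrow> i \<le> k \<Longrightarrow> j \<le> k \<Longrightarrow> p i = p j \<longleftrightarrow> i = j"
  unfolding induced_path_def inj_on_def by auto

lemma induced_path_rev:
  assumes "induced_path R p k" "i \<le> k"
  shows "induced_path R (\<lambda>j. p (i - j)) i"
  using assms(2) induced_path_eq_iff[OF assms(1)] induced_path_adjacent_iff[OF assms(1)]
  unfolding induced_path_def by (auto simp: inj_on_def)

lemma induced_path_drop:
  assumes "induced_path R p k" "i \<le> k"
  shows "induced_path R (\<lambda>j. p (i + j)) (k - i)"
  using assms(2) induced_path_eq_iff[OF assms(1)] induced_path_adjacent_iff[OF assms(1)]
  unfolding induced_path_def by (auto simp: inj_on_def)

lemma leaf_ends_not_adjacent: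
  assumes "sym R" "induced_path R p k" "0 < k"
    and leaves: "R `` {p 0} = {a\<^sub>1}" "R `` {p k} = {a\<^sub>2}" and off_path: "v \<notin> p ` {..k}"
  shows "(v, p 0) \<notin> R" "(v, p k) \<notin> R"
proof -
  have "p 1 \<in> R `` {p 0}" "p (k - 1) \<in> R `` {p k}"
    using induced_path_adjacent_iff[OF assms(2)] assms(3) by auto
  then have "a\<^sub>1 = p 1" "a\<^sub>2 = p (k - 1)"
    using leaves by simp_all
  then have "v \<notin> R `` {p 0}" "v \<notin> R `` {p k}"
    unfolding leaves using off_path assms(3) by auto
  then show "(v, p 0) \<notin> R" "(v, p k) \<notin> R"
    using assms(1) by (auto dest: symD)
qed

lemma leaf_notin_induced_path:
  assumes path: "induced_path R p k" and leaf: "R `` {b} = {a}" and ends: "b \<noteq> p 0" "b \<noteq> p k"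
  shows "b \<notin> p ` {..k}"
proof
  assume "b \<in> p ` {..k}"
  then obtain j where "j \<le> k" "b = p j" by auto
  then obtain i where inner: "b = p (Suc i)" "Suc i < k"
    using ends by (metis le_neq_implies_less not0_implies_Suc)
  have "(b, p i) \<in> R" "(b, p (Suc (Suc i))) \<in> R"
    using inner induced_path_adjacent_iff[OF path] by simp_all
  then have "p i \<in> R `` {b}" "p (Suc (Suc i)) \<in> R `` {b}"
    by blast+
  then have "p i = p (Suc (Suc i))"
    unfolding leaf by simp
  then show False
    using induced_path_eq_iff[OF path, of i "Suc (Suc i)"] inner by simp
qed

lemma claw_free_path_attachment:
  assumes "sym R" "claw_free R" "induced_path R p k"
    and "s \<notin> p ` {..k}" "Suc i < k" "(s, p (Suc i)) \<in> R"
  shows "(s, p i) \<in> R \<or> (s, p (Suc (Suc i))) \<in> R"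
proof -
  have "(p (Suc i), s) \<in> R" "(p (Suc i), p i) \<in> R" "(p (Suc i), p (Suc (Suc i))) \<in> R"
    "(p i, p (Suc (Suc i))) \<notin> R" "p i \<noteq> p (Suc (Suc i))"
    using assms(5,6) induced_path_adjacent_iff[OF assms(3)] induced_path_eq_iff[OF assms(3)]
    by (auto intro: symD[OF assms(1)])
  moreover have "s \<noteq> p i" "s \<noteq> p (Suc (Suc i))"
    using assms(4,5) by auto
  ultimately show ?thesis
    using assms(2) unfolding claw_free_def is_claw_def by blast
qed

lemma claw_free_path_attachments:
  assumes "sym R" and claw_free: "claw_free R" and path: "induced_path R p k"
    and "s \<notin> p ` {..k}" and not_ends: "(s, p 0) \<notin> R" "(s, p k) \<notin> R"
    and attached: "\<exists>i\<le>k. (s, p i) \<in> R"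
    and other: "(s, r) \<in> R" "r \<notin> p ` {..k}" "\<And>i. i \<le> k \<Longrightarrow> (r, p i) \<notin> R"
  obtains i where "0 < i" "Suc i < k" "\<forall>j\<le>k. (s, p j) \<in> R \<longleftrightarrow> j = i \<or> j = Suc i"
proof -
  define i where "i = (LEAST i. i \<le> k \<and> (s, p i) \<in> R)"
  have first: "i \<le> k" "(s, p i) \<in> R"
    using LeastI_ex[OF attached] unfolding i_def by simp_all
  have before: "(s, p j) \<notin> R" if "j < i" for j
    using not_less_Least[OF that[unfolded i_def]] that first(1) by simp
  have inner: "0 < i" "i < k"
    using first not_ends by (metis gr0I, metis le_neq_implies_less)
  then obtain h where "i = Suc h" by (metis gr0_implies_Suc)
  then have second: "(s, p (Suc i)) \<in> R"
    using claw_free_path_attachment[OF assms(1-4)] inner first(2) before[of h] by auto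
  have after: "(s, p j) \<notin> R" if "Suc i < j" "j \<le> k" for j
  proof
    assume "(s, p j) \<in> R"
    moreover have "(p i, p j) \<notin> R" "p i \<noteq> p j"
      using induced_path_adjacent_iff[OF path, of i j] induced_path_eq_iff[OF path, of i j] that
      by auto
    moreover have "r \<noteq> p i" "r \<noteq> p j"
      using other(2) that by auto
    ultimately have "is_claw R s r (p i) (p j)"
      unfolding is_claw_def using first other(1,3) that by simp
    then show False
      using claw_free unfolding claw_free_def by blast
  qed
  have "Suc i < k"
    using inner second not_ends(2) by (metis Suc_lessI)
  moreover have "(s, p j) \<in> R \<longleftrightarrow> j = i \<or> j = Suc i" if "j \<le> k" for j
    using that first second before after by (metis Suc_lessI linorder_less_linear)
  ultimately show thesis
    using that inner(1) by blast
qed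

lemma claw_free_leaf_far_from_path:
  assumes "sym R" "claw_free R" and path: "induced_path R p k" and "0 < k"
    and ends: "R `` {p 0} = {a\<^sub>1}" "R `` {p k} = {a\<^sub>2}"
    and leaf: "R `` {b} = {a}" and off_path: "b \<notin> p ` {..k}"
    and "i \<le> k"
  shows "(b, p i) \<notin> R"
proof
  assume edge: "(b, p i) \<in> R"
  then have "i \<noteq> 0" "i \<noteq> k"
    using leaf_ends_not_adjacent[OF assms(1) path \<open>0 < k\<close> ends off_path] by metis+
  then obtain h where inner: "i = Suc h" "Suc h < k"
    using \<open>i \<le> k\<close> by (metis le_neq_implies_less not0_implies_Suc)
  then have "(b, p h) \<in> R \<or> (b, p (Suc (Suc h))) \<in> R"
    using claw_free_path_attachment[OF assms(1-3) off_path] edge by simp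
  then have "p (Suc h) \<in> R `` {b}" "p h \<in> R `` {b} \<or> p (Suc (Suc h)) \<in> R `` {b}"
    using edge inner by blast+
  then have "p h = p (Suc h) \<or> p (Suc (Suc h)) = p (Suc h)"
    unfolding leaf by auto
  then show False
    using induced_path_eq_iff[OF path] inner by simp
qed

lemma claw_free_leaf_path_attachments:
  assumes "sym R" "irrefl R" "claw_free R"
    and path: "induced_path R p k" and "0 < k"
    and ends: "R `` {p 0} = {a\<^sub>1}" "R `` {p k} = {a\<^sub>2}"
    and leaf: "R `` {b} = {a}" and off_path: "b \<notin> p ` {..k}" and connected: "(b, p 0) \<in> R\<^sup>*"
  obtains q m i where "induced_path R q m" "q 0 = b" "0 < m" "Suc i < k" "0 < i"
    "\<forall>h<m. \<forall>j\<le>k. (q h, p j) \<notin> R" "\<forall>j\<le>k. (q m, p j) \<in> R \<longleftrightarrow> j = i \<or> j = Suc i"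
proof -
  define near where "near = {v. \<exists>i\<le>k. (v, p i) \<in> R}"
  have path_near: "p i \<in> near" if "i \<le> k" for i
  proof -
    have "\<exists>j\<le>k. j = Suc i \<or> i = Suc j"
      using that \<open>0 < k\<close> by (intro exI[of _ "if i = 0 then 1 else i - 1"]) auto
    then show ?thesis
      using induced_path_adjacent_iff[OF path that] unfolding near_def by blast
  qed
  then have "p 0 \<in> near"
    by simp
  obtain q m where path': "induced_path R q m" and start: "q 0 = b" and last_near: "q m \<in> near"
    and before_far: "\<And>i. i < m \<Longrightarrow> q i \<notin> near"
    by (rule shortest_path_to[OF assms(1,2) connected \<open>p 0 \<in> near\<close>]) auto
  have "b \<notin> near"
    using claw_free_leaf_far_from_path[OF assms(1,3) path \<open>0 < k\<close> ends leaf off_path]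
    unfolding near_def by blast
  then have "0 < m"
    using start last_near by (metis gr0I)
  then have last_step: "(q m, q (m - 1)) \<in> R" and far: "q (m - 1) \<notin> near"
    using induced_path_adjacent_iff[OF path', of m "m - 1"] before_far by auto
  have last_off_path: "q m \<notin> p ` {..k}"
    using far symD[OF assms(1) last_step] by (auto simp: near_def)
  note not_ends = leaf_ends_not_adjacent[OF assms(1) path \<open>0 < k\<close> ends last_off_path]
  have attached: "\<exists>i\<le>k. (q m, p i) \<in> R" and not_adjacent: "\<And>i. i \<le> k \<Longrightarrow> (q (m - 1), p i) \<notin> R"
    using last_near far by (auto simp: near_def)
  have not_on_path: "q (m - 1) \<notin> p ` {..k}"
    using far path_near by auto
  obtain i where attachments: "0 < i" "Suc i < k" "\<forall>j\<le>k. (q m, p j) \<in> R \<longleftrightarrow> j = i \<or> j = Suc i"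
    using claw_free_path_attachments[OF assms(1,3) path last_off_path not_ends attached last_step
        not_on_path not_adjacent] .
  have "\<forall>h<m. \<forall>j\<le>k. (q h, p j) \<notin> R"
    using before_far by (simp add: near_def)
  then show thesis
    using that[OF path' start \<open>0 < m\<close> attachments(2,1) _ attachments(3)] by simp
qed

lemma generalized_net_of_attached_path:
  assumes "sym R" and path: "induced_path R p k" "induced_path R q m"
    and attachments: "Suc i \<le> k" "\<forall>j\<le>k. (q m, p j) \<in> R \<longleftrightarrow> j = i \<or> j = Suc i"
    and far: "\<forall>h<m. \<forall>j\<le>k. (q h, p j) \<notin> R"
  shows "generalized_net R (\<lambda>j. p (i - j)) i (\<lambda>j. p (Suc i + j)) (k - Suc i) (\<lambda>j. q (m - j)) m"
proof -
  have "(q (m - h), p j) \<in> R \<longleftrightarrow> h = 0 \<and> (j = i \<or> j = Suc i)" if "h \<le> m" "j \<le> k" for h j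
    using that attachments(2) far by (cases h) auto
  then have "(p j, q (m - h)) \<in> R \<longleftrightarrow> h = 0 \<and> (j = i \<or> j = Suc i)" if "h \<le> m" "j \<le> k" for h j
    using that assms(1) by (metis symD)
  then show ?thesis
    using attachments(1) induced_path_rev[OF path(1), of i]
      induced_path_drop[OF path(1) attachments(1)]
      induced_path_rev[OF path(2) order_refl] induced_path_adjacent_iff[OF path(1)]
    by (auto simp: generalized_net_def joined_at_start_def)
qed

text \<open>
  The net consists of an induced path between two of the leaves and a shortest path from the third
  leaf to a neighbour of that path.
\<close>

lemma claw_free_three_leaves:
  assumes "sym R" "irrefl R" "claw_free R"
    and leaves: "R `` {b\<^sub>1} = {a\<^sub>1}" "R `` {b\<^sub>2} = {a\<^sub>2}" "R `` {b\<^sub>3} = {a\<^sub>3}"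
    and distinct: "distinct [b\<^sub>1, b\<^sub>2, b\<^sub>3]" and connected: "(b\<^sub>1, b\<^sub>2) \<in> R\<^sup>*" "(b\<^sub>3, b\<^sub>1) \<in> R\<^sup>*"
  obtains x k y l z m where "generalized_net R x k y l z m" "1 \<le> k" "1 \<le> l" "1 \<le> m"
    "x k = b\<^sub>1" "y l = b\<^sub>2" "z m = b\<^sub>3"
proof -
  obtain p k where path: "induced_path R p k" and ends: "p 0 = b\<^sub>1" "p k = b\<^sub>2"
    by (rule shortest_path_to[OF assms(1,2) connected(1), of "{b\<^sub>2}"]) auto
  have "0 < k"
    using ends distinct by (metis distinct_length_2_or_more gr0I)
  have "b\<^sub>3 \<notin> p ` {..k}"
    using leaf_notin_induced_path[OF path leaves(3)] ends distinct by auto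
  then obtain q m i where path': "induced_path R q m" "q 0 = b\<^sub>3" and "0 < m" "Suc i < k" "0 < i"
    and attached: "\<forall>h<m. \<forall>j\<le>k. (q h, p j) \<notin> R" "\<forall>j\<le>k. (q m, p j) \<in> R \<longleftrightarrow> j = i \<or> j = Suc i"
    using claw_free_leaf_path_attachments[OF assms(1-3) path \<open>0 < k\<close> _ _ leaves(3)] leaves(1,2)
      connected(2) unfolding ends by metis
  have "generalized_net R (\<lambda>j. p (i - j)) i (\<lambda>j. p (Suc i + j)) (k - Suc i) (\<lambda>j. q (m - j)) m"
    using generalized_net_of_attached_path[OF assms(1) path path'(1) _ attached(2,1)] \<open>Suc i < k\<close>
    by simp
  then show thesis
    using that[of "\<lambda>j. p (i - j)" i "\<lambda>j. p (Suc i + j)" "k - Suc i" "\<lambda>j. q (m - j)" m]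
      \<open>0 < i\<close> \<open>Suc i < k\<close> \<open>0 < m\<close> ends path'(2) by simp
qed

lemma claw_free_three_leaves_net:
  assumes "sym R" "irrefl R" "claw_free R"
    and leaves: "R `` {b\<^sub>1} = {a\<^sub>1}" "R `` {b\<^sub>2} = {a\<^sub>2}" "R `` {b\<^sub>3} = {a\<^sub>3}"
    and "distinct [b\<^sub>1, b\<^sub>2, b\<^sub>3]" "(b\<^sub>1, b\<^sub>2) \<in> R\<^sup>*" "(b\<^sub>3, b\<^sub>1) \<in> R\<^sup>*"
  shows "\<exists>x x' y y' z z'. is_net R x x' y y' z z'"
    and "is_net R a\<^sub>1 b\<^sub>1 a\<^sub>2 b\<^sub>2 a\<^sub>3 b\<^sub>3 \<or> (\<exists>a b c p q r. is_wounded R a b c p q r)"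
proof -
  obtain x k y l z m where net: "generalized_net R x k y l z m"
    and lengths: "1 \<le> k" "1 \<le> l" "1 \<le> m" and ends: "x k = b\<^sub>1" "y l = b\<^sub>2" "z m = b\<^sub>3"
    using claw_free_three_leaves[OF assms] .
  have is_net: "is_net R (x 0) (x 1) (y 0) (y 1) (z 0) (z 1)"
    using generalized_net_is_net[OF assms(1) net lengths] .
  then show "\<exists>x x' y y' z z'. is_net R x x' y y' z z'"
    by blast
  note net' = generalized_net_rotate[OF assms(1) net]
  note net'' = generalized_net_rotate[OF assms(1) net']
  consider (triangle) "k = 1" "l = 1" "m = 1" | (first) "2 \<le> k" | (second) "2 \<le> l" | (third) "2 \<le> m"
    using lengths by linarith
  then show "is_net R a\<^sub>1 b\<^sub>1 a\<^sub>2 b\<^sub>2 a\<^sub>3 b\<^sub>3 \<or> (\<exists>a b c p q r. is_wounded R a b c p q r)"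
  proof cases
    case triangle
    have "(b\<^sub>1, x 0) \<in> R" "(b\<^sub>2, y 0) \<in> R" "(b\<^sub>3, z 0) \<in> R"
      using is_net ends triangle symD[OF assms(1)] unfolding is_net_def by blast+
    then have "x 0 = a\<^sub>1" "y 0 = a\<^sub>2" "z 0 = a\<^sub>3"
      using leaves by blast+
    then show ?thesis
      using is_net ends triangle by simp
  next
    case first
    then show ?thesis
      using generalized_net_is_wounded[OF assms(1) net] lengths by blast
  next
    case second
    then show ?thesis
      using generalized_net_is_wounded[OF assms(1) net'] lengths by blast
  next
    case third
    then show ?thesis
      using generalized_net_is_wounded[OF assms(1) net''] lengths by blast
  qed
qed

section \<open>Neighbourhoods and induced copies\<close>

abbreviation adj :: "'a pair_pre_digraph \<Rightarrow> 'a \<Rightarrow> 'a \<Rightarrow> bool" where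
  "adj G u v \<equiv> (u, v) \<in> parcs G"

definition simplicial :: "'a pair_pre_digraph \<Rightarrow> 'a \<Rightarrow> bool" where
  "simplicial G x \<longleftrightarrow> clique G (nbhd G x)"

lemma in_nbhd_iff: "u \<in> nbhd G x \<longleftrightarrow> adj G x u"
  by (simp add: nbhd_def)

lemma simplicialD: "simplicial G x \<Longrightarrow> adj G x u \<Longrightarrow> adj G x v \<Longrightarrow> u \<noteq> v \<Longrightarrow> adj G u v"
  by (simp add: simplicial_def clique_def in_nbhd_iff)

context pair_graph
begin

lemma sym_parcs: "sym (parcs G)"
  by (rule symI) (rule arcs_symmetric)

lemma adj_commute: "adj G u v \<longleftrightarrow> adj G v u"
  using arcs_symmetric by blast

lemma not_adj_self: "\<not> adj G x x"
  using no_loops' by blast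

lemma nbhd_subset: "nbhd G x \<subseteq> pverts G"
  by (auto simp: nbhd_def dest: in_arcsD2)

lemma finite_nbhd [simp]: "finite (nbhd G x)"
  using nbhd_subset pair_finite_verts by (rule finite_subset)

lemma o_heavy_pair_commute: "o_heavy_pair G u v \<longleftrightarrow> o_heavy_pair G v u"
  unfolding o_heavy_pair_def using arcs_symmetric by (auto simp: add.commute)

lemma o_heavy_pair_not_adj: "o_heavy_pair G u v \<Longrightarrow> \<not> adj G u v \<and> \<not> adj G v u"
  unfolding o_heavy_pair_def using arcs_symmetric by blast

lemma simplicialI:
  "(\<And>u v. adj G x u \<Longrightarrow> adj G x v \<Longrightarrow> u \<noteq> v \<Longrightarrow> adj G u v) \<Longrightarrow> simplicial G x"
  unfolding simplicial_def clique_def using nbhd_subset by (auto simp: in_nbhd_iff)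

lemma induced_embedding_graph_on_iff:
  assumes "T \<subseteq> {(i, j). i < j}"
  shows "induced_embedding (graph_on k T) G f \<longleftrightarrow> f ` {..<k} \<subseteq> pverts G \<and>
    (\<forall>j<k. \<forall>i<j. f i \<noteq> f j \<and> (adj G (f i) (f j) \<longleftrightarrow> (i, j) \<in> T))"
    (is "_ \<longleftrightarrow> _ \<and> ?ordered")
proof -
  have "(\<forall>i<k. \<forall>j<k. adj G (f i) (f j) \<longleftrightarrow> (i, j) \<in> T \<union> T\<inverse>) \<and> inj_on f {..<k} \<longleftrightarrow> ?ordered"
  proof
    assume "(\<forall>i<k. \<forall>j<k. adj G (f i) (f j) \<longleftrightarrow> (i, j) \<in> T \<union> T\<inverse>) \<and> inj_on f {..<k}"
    then show ?ordered
      using assms by (fastforce simp: inj_on_def)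
  next
    assume ordered: ?ordered
    then have inj: "inj_on f {..<k}"
      by (intro linorder_inj_onI) auto
    have "adj G (f i) (f j) \<longleftrightarrow> (i, j) \<in> T \<union> T\<inverse>" if "i < k" "j < k" for i j
    proof (cases i j rule: linorder_cases)
      case less
      then show ?thesis using ordered that assms by auto
    next
      case equal
      then show ?thesis using no_loops' assms by blast
    next
      case greater
      then have "adj G (f i) (f j) \<longleftrightarrow> adj G (f j) (f i)"
        using arcs_symmetric by blast
      then show ?thesis using greater ordered that assms by auto
    qed
    then show "(\<forall>i<k. \<forall>j<k. adj G (f i) (f j) \<longleftrightarrow> (i, j) \<in> T \<union> T\<inverse>) \<and> inj_on f {..<k}"
      using inj by blast
  qed
  then show ?thesis
    unfolding induced_embedding_def by (auto simp: graph_on_def)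
qed

lemma induced_embedding_claw_iff:
  "induced_embedding claw_graph G f \<longleftrightarrow> is_claw (parcs G) (f 0) (f 1) (f 2) (f 3)"
proof -
  have "adj G (f 0) (f i) \<Longrightarrow> f 0 \<noteq> f i \<and> f 0 \<in> pverts G \<and> f i \<in> pverts G" for i
    using no_loops' in_arcsD1 in_arcsD2 by blast
  then show ?thesis
    unfolding claw_graph_def
    by (subst induced_embedding_graph_on_iff)
      (auto simp: is_claw_def All_less_Suc lessThan_Suc numeral_eq_Suc)
qed

lemma induced_embedding_net_iff:
  "induced_embedding net_graph G f \<longleftrightarrow> is_net (parcs G) (f 0) (f 3) (f 1) (f 4) (f 2) (f 5)"
    (is "_ \<longleftrightarrow> ?net")
proof -
  have "distinct [f 0, f 1, f 2, f 3, f 4, f 5]" if ?net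
    using that unfolding is_net_def by (auto simp: not_adj_self adj_commute)
  moreover have "{f 0, f 1, f 2, f 3, f 4, f 5} \<subseteq> pverts G" if ?net
    using that unfolding is_net_def by (auto dest: in_arcsD1 in_arcsD2)
  ultimately show ?thesis
    unfolding net_graph_def
    by (subst induced_embedding_graph_on_iff)
      (auto simp: is_net_def All_less_Suc lessThan_Suc numeral_eq_Suc)
qed

lemma induced_embedding_wounded_iff:
  "induced_embedding wounded_graph G f \<longleftrightarrow>
    is_wounded (parcs G) (f 0) (f 1) (f 2) (f 3) (f 4) (f 5)" (is "_ \<longleftrightarrow> ?wounded")
proof -
  have "distinct [f 0, f 1, f 2, f 3, f 4, f 5]" if ?wounded
    using that unfolding is_wounded_def by (auto simp: not_adj_self adj_commute)
  moreover have "{f 0, f 1, f 2, f 3, f 4, f 5} \<subseteq> pverts G" if ?wounded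
    using that unfolding is_wounded_def by (auto dest: in_arcsD1 in_arcsD2)
  ultimately show ?thesis
    unfolding wounded_graph_def
    by (subst induced_embedding_graph_on_iff)
      (auto simp: is_wounded_def All_less_Suc lessThan_Suc numeral_eq_Suc)
qed

lemma induced_free_claw_iff: "induced_free claw_graph G \<longleftrightarrow> claw_free (parcs G)"
proof -
  have "is_claw (parcs G) x u v w \<Longrightarrow> induced_embedding claw_graph G ((!) [x, u, v, w])" for x u v w
    by (simp add: induced_embedding_claw_iff)
  then show ?thesis
    unfolding induced_free_def claw_free_def induced_embedding_claw_iff by blast
qed

lemma o_heavy_claw_iff:
  "o_heavy claw_graph G \<longleftrightarrow> (\<forall>x u v w. is_claw (parcs G) x u v w \<longrightarrow>
     o_heavy_pair G u v \<or> o_heavy_pair G u w \<or> o_heavy_pair G v w)" (is "_ \<longleftrightarrow> ?claws")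
proof -
  have image: "f ` pverts claw_graph = {f 0, f 1, f 2, f 3}" for f :: "nat \<Rightarrow> 'a"
    by (auto simp: claw_graph_def graph_on_def lessThan_Suc numeral_eq_Suc)
  have pairs: "(\<exists>a\<in>{x, u, v, w}. \<exists>b\<in>{x, u, v, w}. o_heavy_pair G a b) \<longleftrightarrow>
      o_heavy_pair G u v \<or> o_heavy_pair G u w \<or> o_heavy_pair G v w"
    if "is_claw (parcs G) x u v w" for x u v w
  proof -
    have "\<not> o_heavy_pair G a a" for a
      by (simp add: o_heavy_pair_def)
    moreover have "\<not> o_heavy_pair G x a \<and> \<not> o_heavy_pair G a x" if "a \<in> {u, v, w}" for a
      using that \<open>is_claw (parcs G) x u v w\<close> o_heavy_pair_not_adj unfolding is_claw_def by blast
    ultimately show ?thesis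
      using o_heavy_pair_commute[of v u] o_heavy_pair_commute[of w u] o_heavy_pair_commute[of w v]
      by simp blast
  qed
  show ?thesis
  proof
    assume heavy: "o_heavy claw_graph G"
    show ?claws
    proof (intro allI impI)
      fix x u v w
      assume claw: "is_claw (parcs G) x u v w"
      then have "induced_embedding claw_graph G ((!) [x, u, v, w])"
        by (simp add: induced_embedding_claw_iff)
      then show "o_heavy_pair G u v \<or> o_heavy_pair G u w \<or> o_heavy_pair G v w"
        using heavy pairs[OF claw] unfolding o_heavy_def image by fastforce
    qed
  next
    assume ?claws
    then show "o_heavy claw_graph G"
      unfolding o_heavy_def induced_embedding_claw_iff image using pairs by metis
  qed
qed

lemma o_heavy_net_pair:
  assumes "o_heavy net_graph G" "is_net (parcs G) a\<^sub>1 b\<^sub>1 a\<^sub>2 b\<^sub>2 a\<^sub>3 b\<^sub>3"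
  shows "\<exists>u\<in>{a\<^sub>1, b\<^sub>1, a\<^sub>2, b\<^sub>2, a\<^sub>3, b\<^sub>3}. \<exists>v\<in>{a\<^sub>1, b\<^sub>1, a\<^sub>2, b\<^sub>2, a\<^sub>3, b\<^sub>3}. o_heavy_pair G u v"
proof -
  let ?f = "(!) [a\<^sub>1, a\<^sub>2, a\<^sub>3, b\<^sub>1, b\<^sub>2, b\<^sub>3]"
  have "induced_embedding net_graph G ?f"
    using assms(2) by (simp add: induced_embedding_net_iff)
  moreover have "?f ` pverts net_graph = {a\<^sub>1, b\<^sub>1, a\<^sub>2, b\<^sub>2, a\<^sub>3, b\<^sub>3}"
    by (auto simp: net_graph_def graph_on_def lessThan_Suc numeral_eq_Suc)
  ultimately show ?thesis
    using assms(1) unfolding o_heavy_def by metis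
qed

lemma o_heavy_wounded_pair:
  assumes "o_heavy wounded_graph G" "is_wounded (parcs G) a b c p q r"
  shows "\<exists>u\<in>{a, b, c, p, q, r}. \<exists>v\<in>{a, b, c, p, q, r}. o_heavy_pair G u v"
proof -
  let ?f = "(!) [a, b, c, p, q, r]"
  have "induced_embedding wounded_graph G ?f"
    using assms(2) by (simp add: induced_embedding_wounded_iff)
  moreover have "?f ` pverts wounded_graph = {a, b, c, p, q, r}"
    by (auto simp: wounded_graph_def graph_on_def lessThan_Suc numeral_eq_Suc)
  ultimately show ?thesis
    using assms(1) unfolding o_heavy_def by metis
qed

end

section \<open>Local completions\<close>

lemma adj_local_completion:
  "adj (local_completion G x) u v \<longleftrightarrow> adj G u v \<or> adj G x u \<and> adj G x v \<and> u \<noteq> v"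
  by (auto simp: local_completion_def nbhd_def)

lemma pverts_local_completion [simp]: "pverts (local_completion G x) = pverts G"
  by (simp add: local_completion_def)

definition link :: "'a pair_pre_digraph \<Rightarrow> 'a \<Rightarrow> 'a \<Rightarrow> 'a set" where
  "link G u v = {u, v} \<union> {t. simplicial G t \<and> adj G t u \<and> adj G t v}"

context pair_graph
begin

lemma deg_mono: "parcs K \<subseteq> parcs G \<Longrightarrow> deg K x \<le> deg G x"
  unfolding deg_def by (rule card_mono) (auto simp: in_nbhd_iff)

lemma pair_graph_completion: "pair_graph (local_completion G x)"
  by (rule pair_graph_local_completion) unfold_locales

lemma deg_le_deg_local_completion: "deg G u \<le> deg (local_completion G x) u"
  by (rule pair_graph.deg_mono[OF pair_graph_completion]) (auto simp: adj_local_completion)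

lemma deg_le_deg_local_completion_neighbour:
  assumes "adj G x u"
  shows "deg G x \<le> deg (local_completion G x) u"
proof -
  have "card (insert x (nbhd G x - {u})) = deg G x"
    using assms card_Suc_Diff1[of "nbhd G x" u] not_adj_self[of x]
    by (simp add: deg_def in_nbhd_iff)
  moreover have "insert x (nbhd G x - {u}) \<subseteq> nbhd (local_completion G x) u"
    using assms arcs_symmetric by (auto simp: in_nbhd_iff adj_local_completion)
  ultimately show ?thesis
    using card_mono[OF pair_graph.finite_nbhd[OF pair_graph_completion]] unfolding deg_def by metis
qed

lemma o_heavy_pair_local_completion:
  assumes "o_heavy_pair G u v" "\<not> adj (local_completion G x) u v"
  shows "o_heavy_pair (local_completion G x) u v"
  using assms deg_le_deg_local_completion[of u x] deg_le_deg_local_completion[of v x]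
  unfolding o_heavy_pair_def by simp

lemma o_heavy_pair_local_completion_neighbour:
  assumes "adj G x u" "o_heavy_pair G x v" "\<not> adj (local_completion G x) u v" "u \<noteq> v"
  shows "o_heavy_pair (local_completion G x) u v"
  using assms deg_le_deg_local_completion_neighbour[of x u] deg_le_deg_local_completion[of v x]
    in_arcsD2[of x u]
  unfolding o_heavy_pair_def by simp

lemma o_heavy_claw_new_edge:
  assumes heavy: "o_heavy claw_graph G" and claw: "is_claw (parcs (local_completion G x)) c u v w"
    and new: "\<not> adj G c u"
  shows "o_heavy_pair (local_completion G x) u v \<or> o_heavy_pair (local_completion G x) u w \<or>
    o_heavy_pair (local_completion G x) v w"
proof -
  have x_adj: "adj G x c" "adj G x u"
    using claw new by (auto simp: is_claw_def adj_local_completion)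
  have "\<not> adj G x v" "\<not> adj G x w" "v \<noteq> x" "w \<noteq> x"
    using claw x_adj arcs_symmetric by (auto simp: is_claw_def adj_local_completion)
  then have "is_claw (parcs G) c x v w"
    using claw x_adj(1) arcs_symmetric by (auto simp: is_claw_def adj_local_completion)
  then have "o_heavy_pair G x v \<or> o_heavy_pair G x w \<or> o_heavy_pair G v w"
    using heavy o_heavy_claw_iff by blast
  then show ?thesis
    using o_heavy_pair_local_completion o_heavy_pair_local_completion_neighbour[OF x_adj(2)] claw
    unfolding is_claw_def by blast
qed

lemma o_heavy_claw_local_completion:
  assumes heavy: "o_heavy claw_graph G"
  shows "o_heavy claw_graph (local_completion G x)"
proof -
  let ?L = "local_completion G x"
  interpret L: pair_graph ?L
    by (rule pair_graph_completion)
  have "o_heavy_pair ?L u v \<or> o_heavy_pair ?L u w \<or> o_heavy_pair ?L v w"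
    if claw: "is_claw (parcs ?L) c u v w" for c u v w
  proof (cases "adj G c u \<and> adj G c v \<and> adj G c w")
    case True
    then have "is_claw (parcs G) c u v w"
      using claw by (auto simp: is_claw_def adj_local_completion)
    then have "o_heavy_pair G u v \<or> o_heavy_pair G u w \<or> o_heavy_pair G v w"
      using heavy o_heavy_claw_iff by blast
    then show ?thesis
      using o_heavy_pair_local_completion claw unfolding is_claw_def by blast
  next
    case False
    then show ?thesis
      using o_heavy_claw_new_edge[OF heavy claw] is_claw_perm[OF L.sym_parcs claw]
        o_heavy_claw_new_edge[OF heavy] L.o_heavy_pair_commute by blast
  qed
  then show ?thesis
    unfolding L.o_heavy_claw_iff by blast
qed

lemma simplicial_local_completion_self: "simplicial (local_completion G x) x"
  by (rule pair_graph.simplicialI[OF pair_graph_completion])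
    (use not_adj_self in \<open>auto simp: adj_local_completion\<close>)

lemma simplicial_local_completion:
  assumes "simplicial G y"
  shows "simplicial (local_completion G x) y"
proof (rule pair_graph.simplicialI[OF pair_graph_completion])
  fix u v
  assume "adj (local_completion G x) y u" "adj (local_completion G x) y v" "u \<noteq> v"
  then show "adj (local_completion G x) u v"
    using simplicialD[OF assms] arcs_symmetric unfolding adj_local_completion by blast
qed

lemma link_local_completion: "link G u v \<subseteq> link (local_completion G x) u v"
  unfolding link_def using simplicial_local_completion by (auto simp: adj_local_completion)

lemma link_local_completion_new_edge:
  assumes "adj G x u" "adj G x v"
  shows "link G u x \<subseteq> link (local_completion G x) u v"
    "link G x v \<subseteq> link (local_completion G x) u v"
  unfolding link_def
  using assms arcs_symmetric simplicial_local_completion simplicial_local_completion_self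
  by (auto simp: adj_local_completion)

end

lemma completion_steps:
  assumes "completion_step\<^sup>*\<^sup>* G H" "pair_graph G"
  shows "pair_graph H" "pverts H = pverts G" "parcs G \<subseteq> parcs H"
    "o_heavy claw_graph G \<Longrightarrow> o_heavy claw_graph H"
proof -
  have "pair_graph H \<and> pverts H = pverts G \<and> parcs G \<subseteq> parcs H \<and>
      (o_heavy claw_graph G \<longrightarrow> o_heavy claw_graph H)"
    using assms(1)
  proof (induction rule: rtranclp_induct)
    case base
    then show ?case using assms(2) by simp
  next
    case (step K L)
    then show ?case
      using pair_graph_local_completion pair_graph.o_heavy_claw_local_completion
      by (auto simp: completion_step_def adj_local_completion)
  qed
  then show "pair_graph H" "pverts H = pverts G" "parcs G \<subseteq> parcs H"
    "o_heavy claw_graph G \<Longrightarrow> o_heavy claw_graph H"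
    by auto
qed

text \<open>A vertex at which a completion takes place becomes simplicial and bypasses the new edges.\<close>

lemma completion_steps_link_path:
  assumes "completion_step\<^sup>*\<^sup>* G H" "pair_graph G" "adj H u v"
  shows "(u, v) \<in> (Restr (parcs G) (link H u v))\<^sup>*"
  using assms
proof (induction arbitrary: u v rule: rtranclp_induct)
  case base
  then show ?case by (auto simp: link_def)
next
  case (step K L)
  interpret K: pair_graph K
    using completion_steps(1) step.hyps(1) step.prems(1) .
  obtain x where completion: "L = local_completion K x"
    using step.hyps(2) by (auto simp: completion_step_def)
  note link_path = step.IH[OF step.prems(1)]
  show ?case
  proof (cases "adj K u v")
    case True
    then show ?thesis
      using link_path K.link_local_completion rtrancl_Restr_mono unfolding completion by metis
  next
    case False
    then have new_edge: "adj K x u" "adj K x v"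
      using step.prems(2) by (auto simp: completion adj_local_completion)
    have "(u, x) \<in> (Restr (parcs G) (link L u v))\<^sup>*" "(x, v) \<in> (Restr (parcs G) (link L u v))\<^sup>*"
      using link_path[OF K.arcs_symmetric[OF new_edge(1)]] link_path[OF new_edge(2)]
        K.link_local_completion_new_edge[OF new_edge] rtrancl_Restr_mono unfolding completion
      by metis+
    then show ?thesis
      by (rule rtrancl_trans)
  qed
qed

section \<open>Graphs without eligible vertices\<close>

lemma adj_bc_graph:
  "adj (bc_graph G x) u v \<longleftrightarrow> adj G u v \<or> adj G x u \<and> adj G x v \<and> o_heavy_pair G u v"
  by (auto simp: bc_graph_def nbhd_def)

context pair_graph
begin

lemma connected_induce_iff:
  "connected (with_proj G \<restriction> A) \<longleftrightarrow> A \<noteq> {} \<and> (\<forall>u\<in>A. \<forall>v\<in>A. (u, v) \<in> (Restr (parcs G) A)\<^sup>*)"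
proof -
  have "(arcs_ends (with_proj G \<restriction> A))\<^sup>s = Restr (parcs G) A"
    using arcs_symmetric unfolding symcl_def arcs_ends_conv by (auto simp: induce_subgraph_def)
  moreover have "(u, v) \<in> rtrancl_on A (Restr (parcs G) A) \<longleftrightarrow> (u, v) \<in> (Restr (parcs G) A)\<^sup>*"
    if "u \<in> A" "v \<in> A" for u v
    using that rtrancl_on_rtranclI rtrancl_consistent_rtrancl_on[where F = A]
    by (metis IntD2 SigmaD2)
  ultimately show ?thesis
    by (simp add: connected_conv)
qed

lemma two_connected_closed_set:
  assumes "two_connected G" "v \<in> pverts G" and subset: "X \<subseteq> pverts G - {v}" "X \<noteq> {}"
    and closed: "\<And>x y. x \<in> X \<Longrightarrow> adj G x y \<Longrightarrow> y \<noteq> v \<Longrightarrow> y \<in> X"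
  shows "X = pverts G - {v}"
proof -
  let ?R = "Restr (parcs G) (pverts G - {v})"
  have "?R\<^sup>* `` X = X"
    by (rule Image_closed_trancl) (use closed in blast)
  moreover have "(x, y) \<in> ?R\<^sup>*" if "x \<in> X" "y \<in> pverts G - {v}" for x y
    using assms(1,2) subset(1) that unfolding two_connected_def connected_induce_iff by blast
  ultimately show ?thesis
    using subset by blast
qed

lemma disconnected_two_cliques:
  assumes disconnected: "\<not> connected (with_proj G \<restriction> A)" and verts: "A \<noteq> {}" "A \<subseteq> pverts G"
    and no_independent_triple: "\<And>u v w. {u, v, w} \<subseteq> A \<Longrightarrow> distinct [u, v, w] \<Longrightarrow>
      adj G u v \<or> adj G u w \<or> adj G v w"
  obtains C\<^sub>1 C\<^sub>2 where "disjoint_union_of_cliques G A C\<^sub>1 C\<^sub>2" "C\<^sub>1 \<noteq> {}" "C\<^sub>2 \<noteq> {}"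
proof -
  let ?R = "Restr (parcs G) A"
  obtain a b where unreachable: "a \<in> A" "b \<in> A" "(a, b) \<notin> ?R\<^sup>*"
    using disconnected verts(1) connected_induce_iff by blast
  define C where "C = A \<inter> ?R\<^sup>* `` {a}"
  have separated: "\<not> adj G u v" if "u \<in> C" "v \<in> A - C" for u v
    using that by (auto simp: C_def dest: rtrancl_into_rtrancl[of a u ?R v])
  have "clique G C"
    unfolding clique_def
  proof (intro conjI ballI impI)
    fix u v
    assume "u \<in> C" "v \<in> C" "u \<noteq> v"
    moreover have "b \<in> A - C"
      using unreachable by (simp add: C_def)
    ultimately show "adj G u v"
      using no_independent_triple[of u v b] separated[of _ b] by (auto simp: C_def)
  qed (use verts(2) in \<open>auto simp: C_def\<close>)
  moreover have "clique G (A - C)"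
    unfolding clique_def
  proof (intro conjI ballI impI)
    fix u v
    assume "u \<in> A - C" "v \<in> A - C" "u \<noteq> v"
    moreover have "a \<in> C"
      using unreachable by (simp add: C_def)
    ultimately show "adj G u v"
      using no_independent_triple[of a u v] separated[of a] by (auto simp: C_def)
  qed (use verts(2) in auto)
  ultimately have "disjoint_union_of_cliques G A C (A - C)"
    using separated unfolding disjoint_union_of_cliques_def C_def by blast
  then show thesis
    using that[of C "A - C"] unreachable by (auto simp: C_def)
qed

lemma adj_disjoint_union_of_cliques_iff:
  assumes "disjoint_union_of_cliques G A C\<^sub>1 C\<^sub>2" "u \<in> A" "v \<in> A" "u \<noteq> v"
  shows "adj G u v \<longleftrightarrow> (u \<in> C\<^sub>1 \<longleftrightarrow> v \<in> C\<^sub>1)"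
proof (cases "u \<in> C\<^sub>1 \<longleftrightarrow> v \<in> C\<^sub>1")
  case True
  then have "u \<in> C\<^sub>1 \<and> v \<in> C\<^sub>1 \<or> u \<in> C\<^sub>2 \<and> v \<in> C\<^sub>2"
    using assms(1-3) unfolding disjoint_union_of_cliques_def by blast
  then have "adj G u v"
    using assms(1,4) unfolding disjoint_union_of_cliques_def clique_def by metis
  then show ?thesis
    using True by simp
next
  case False
  then have "u \<in> C\<^sub>1 \<and> v \<in> C\<^sub>2 \<or> u \<in> C\<^sub>2 \<and> v \<in> C\<^sub>1"
    using assms(1-3) unfolding disjoint_union_of_cliques_def by blast
  then have "\<not> adj G u v"
    using assms(1) adj_commute[of u v] unfolding disjoint_union_of_cliques_def by metis
  then show ?thesis
    using False by simp
qed

lemma pair_graph_bc_graph: "pair_graph (bc_graph G x)"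
proof -
  have "parcs (bc_graph G x) \<subseteq> pverts G \<times> pverts G"
    by (auto simp: adj_bc_graph o_heavy_pair_def dest: in_arcsD1 in_arcsD2)
  then have "finite (parcs (bc_graph G x))"
    using pair_finite_verts finite_subset by blast
  then show ?thesis
    using pair_finite_verts adj_commute o_heavy_pair_commute
    by unfold_locales
      (auto simp: bc_graph_def nbhd_def symmetric_def sym_def o_heavy_pair_def
        dest: in_arcsD1 in_arcsD2 no_loops')
qed

lemma o_heavy_pair_common_nbhd:
  assumes "o_heavy_pair G u v"
  shows "card (pverts G - {u, v} - (nbhd G u \<union> nbhd G v)) + 2 \<le> card (nbhd G u \<inter> nbhd G v)"
proof -
  have heavy: "u \<in> pverts G" "v \<in> pverts G" "u \<noteq> v" "\<not> adj G u v" "\<not> adj G v u"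
    "card (pverts G) \<le> deg G u + deg G v"
    using assms o_heavy_pair_not_adj unfolding o_heavy_pair_def by auto
  have "card {u, v} \<le> card (pverts G)"
    using heavy pair_finite_verts by (intro card_mono) auto
  then have "2 \<le> card (pverts G)"
    using heavy(3) by simp
  have subset: "nbhd G u \<union> nbhd G v \<subseteq> pverts G - {u, v}"
    using heavy nbhd_subset not_adj_self by (auto simp: in_nbhd_iff)
  then have "card (pverts G - {u, v} - (nbhd G u \<union> nbhd G v)) =
      card (pverts G) - 2 - card (nbhd G u \<union> nbhd G v)"
    using heavy pair_finite_verts by (simp add: card_Diff_subset)
  moreover have "card (nbhd G u \<union> nbhd G v) \<le> card (pverts G - {u, v})"
    using subset pair_finite_verts by (intro card_mono) auto
  then have "card (nbhd G u \<union> nbhd G v) \<le> card (pverts G) - 2"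
    using heavy pair_finite_verts by (simp add: card_Diff_subset)
  ultimately show ?thesis
    using card_Un_Int[of "nbhd G u" "nbhd G v"] heavy(6) \<open>2 \<le> card (pverts G)\<close>
    unfolding deg_def by simp
qed

end

locale c_closed_graph = pair_graph +
  assumes o_heavy_claw: "o_heavy claw_graph G"
    and not_c_eligible: "\<not> c_eligible G x"
begin

lemma bc_graph_two_cliques:
  assumes not_clique: "\<not> clique G (nbhd G x)"
  obtains C\<^sub>1 C\<^sub>2 where "disjoint_union_of_cliques (bc_graph G x) (nbhd G x) C\<^sub>1 C\<^sub>2"
    "C\<^sub>1 \<noteq> {}" "C\<^sub>2 \<noteq> {}"
    "\<And>z y\<^sub>1 y\<^sub>2. o_heavy_pair G x z \<Longrightarrow> y\<^sub>1 \<in> C\<^sub>1 \<Longrightarrow> y\<^sub>2 \<in> C\<^sub>2 \<Longrightarrow> \<not> (adj G z y\<^sub>1 \<and> adj G z y\<^sub>2)"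
proof -
  interpret bc: pair_graph "bc_graph G x"
    by (rule pair_graph_bc_graph)
  have nonempty: "nbhd G x \<noteq> {}"
    using not_clique by (auto simp: clique_def)
  then have x_in_verts: "x \<in> pverts G"
    using in_arcsD1 by (auto simp: nbhd_def)
  have "\<not> connected (with_proj (bc_graph G x) \<restriction> nbhd G x)"
    using not_c_eligible[of x] not_clique x_in_verts unfolding c_eligible_def by blast
  moreover have "nbhd G x \<subseteq> pverts (bc_graph G x)"
    using nbhd_subset by (simp add: bc_graph_def)
  moreover have "adj (bc_graph G x) u v \<or> adj (bc_graph G x) u w \<or> adj (bc_graph G x) v w"
    if "{u, v, w} \<subseteq> nbhd G x" "distinct [u, v, w]" for u v w
  proof (rule ccontr)
    assume nonadjacent: "\<not> ?thesis"
    then have "is_claw (parcs G) x u v w"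
      using that by (auto simp: is_claw_def adj_bc_graph in_nbhd_iff)
    then show False
      using o_heavy_claw that nonadjacent unfolding o_heavy_claw_iff
      by (auto simp: adj_bc_graph in_nbhd_iff)
  qed
  ultimately obtain C\<^sub>1 C\<^sub>2 where cliques: "disjoint_union_of_cliques (bc_graph G x) (nbhd G x) C\<^sub>1 C\<^sub>2"
      "C\<^sub>1 \<noteq> {}" "C\<^sub>2 \<noteq> {}"
    using bc.disconnected_two_cliques nonempty by metis
  moreover have "\<not> (adj G z y\<^sub>1 \<and> adj G z y\<^sub>2)"
    if "o_heavy_pair G x z" "y\<^sub>1 \<in> C\<^sub>1" "y\<^sub>2 \<in> C\<^sub>2" for z y\<^sub>1 y\<^sub>2
    using that not_c_eligible[of x] not_clique x_in_verts cliques(1) unfolding c_eligible_def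
    by blast
  ultimately show thesis
    using that by blast
qed

lemma bc_graph_trans:
  assumes nbrs: "adj G x u" "adj G x v" "adj G x w"
    and path: "adj (bc_graph G x) u v" "adj (bc_graph G x) v w" and "u \<noteq> w"
  shows "adj (bc_graph G x) u w"
proof (cases "clique G (nbhd G x)")
  case True
  then show ?thesis
    using assms by (simp add: clique_def in_nbhd_iff adj_bc_graph)
next
  case False
  interpret bc: pair_graph "bc_graph G x"
    by (rule pair_graph_bc_graph)
  obtain C\<^sub>1 C\<^sub>2 where cliques: "disjoint_union_of_cliques (bc_graph G x) (nbhd G x) C\<^sub>1 C\<^sub>2"
    using bc_graph_two_cliques[OF False] .
  have "u \<in> C\<^sub>1 \<longleftrightarrow> v \<in> C\<^sub>1" "v \<in> C\<^sub>1 \<longleftrightarrow> w \<in> C\<^sub>1"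
    using bc.adj_disjoint_union_of_cliques_iff[OF cliques] nbrs path bc.no_loops'
    by (auto simp: in_nbhd_iff)
  then show ?thesis
    using bc.adj_disjoint_union_of_cliques_iff[OF cliques] nbrs \<open>u \<noteq> w\<close> by (auto simp: in_nbhd_iff)
qed

lemma bc_graph_separated:
  assumes "\<not> clique G (nbhd G x)" "adj G x u"
  obtains w where "adj G x w" "w \<noteq> u" "\<not> adj (bc_graph G x) u w"
proof -
  obtain C\<^sub>1 C\<^sub>2 where cliques: "disjoint_union_of_cliques (bc_graph G x) (nbhd G x) C\<^sub>1 C\<^sub>2"
      "C\<^sub>1 \<noteq> {}" "C\<^sub>2 \<noteq> {}"
    using bc_graph_two_cliques[OF assms(1)] .
  have "C\<^sub>1 \<union> C\<^sub>2 = nbhd G x" "C\<^sub>1 \<inter> C\<^sub>2 = {}"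
    using cliques(1) by (simp_all add: disjoint_union_of_cliques_def)
  then obtain w where other_clique: "w \<in> nbhd G x" "\<not> (u \<in> C\<^sub>1 \<longleftrightarrow> w \<in> C\<^sub>1)"
    using cliques(2,3) by blast
  then have "w \<noteq> u" "\<not> adj (bc_graph G x) u w"
    using pair_graph.adj_disjoint_union_of_cliques_iff[OF pair_graph_bc_graph cliques(1)] assms(2)
    by (auto simp: in_nbhd_iff)
  then show thesis
    using that other_clique(1) by (simp add: in_nbhd_iff)
qed

lemma bc_graph_o_heavy_neighbour:
  assumes "o_heavy_pair G x z" "adj G x y\<^sub>1" "adj G x y\<^sub>2" "adj G z y\<^sub>1" "adj G z y\<^sub>2" "y\<^sub>1 \<noteq> y\<^sub>2"
  shows "adj (bc_graph G x) y\<^sub>1 y\<^sub>2"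
proof (cases "clique G (nbhd G x)")
  case True
  then show ?thesis
    using assms by (simp add: clique_def in_nbhd_iff adj_bc_graph)
next
  case False
  obtain C\<^sub>1 C\<^sub>2 where cliques: "disjoint_union_of_cliques (bc_graph G x) (nbhd G x) C\<^sub>1 C\<^sub>2"
    and no_common: "\<And>z y\<^sub>1 y\<^sub>2. o_heavy_pair G x z \<Longrightarrow> y\<^sub>1 \<in> C\<^sub>1 \<Longrightarrow> y\<^sub>2 \<in> C\<^sub>2 \<Longrightarrow>
      \<not> (adj G z y\<^sub>1 \<and> adj G z y\<^sub>2)"
    using bc_graph_two_cliques[OF False] by metis
  have in_nbhd: "y\<^sub>1 \<in> nbhd G x" "y\<^sub>2 \<in> nbhd G x"
    using assms by (simp_all add: in_nbhd_iff)
  then have "y\<^sub>1 \<in> C\<^sub>1 \<union> C\<^sub>2" "y\<^sub>2 \<in> C\<^sub>1 \<union> C\<^sub>2"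
    using cliques by (simp_all add: disjoint_union_of_cliques_def)
  then have "y\<^sub>1 \<in> C\<^sub>1 \<longleftrightarrow> y\<^sub>2 \<in> C\<^sub>1"
    using no_common[OF assms(1)] assms(4,5) by blast
  then show ?thesis
    using pair_graph.adj_disjoint_union_of_cliques_iff[OF pair_graph_bc_graph cliques
        in_nbhd assms(6)]
    by simp
qed

lemma o_heavy_pair_exit:
  assumes heavy: "o_heavy_pair G u v" and common: "c \<in> nbhd G u \<inter> nbhd G v"
  shows "\<exists>w. w \<in> pverts G - {u, v} - (nbhd G u \<union> nbhd G v) \<and> adj G c w \<and> \<not> adj (bc_graph G c) u w"
proof -
  have adj: "adj G c u" "adj G c v" "u \<noteq> v" "\<not> adj G u v"
    using heavy common arcs_symmetric by (auto simp: in_nbhd_iff o_heavy_pair_def)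
  then have "\<not> clique G (nbhd G c)"
    by (auto simp: clique_def nbhd_def)
  then obtain w where separated: "adj G c w" "w \<noteq> u" "\<not> adj (bc_graph G c) u w"
    using bc_graph_separated adj(1) by blast
  have "adj (bc_graph G c) u v"
    using adj heavy by (simp add: adj_bc_graph)
  then have "\<not> adj (bc_graph G c) v w" "w \<noteq> v"
    using bc_graph_trans[of c u v w] adj separated by blast+
  then have "w \<in> pverts G - {u, v} - (nbhd G u \<union> nbhd G v)"
    using separated in_arcsD2 by (auto simp: in_nbhd_iff adj_bc_graph)
  then show ?thesis
    using separated by blast
qed

lemma bc_graph_not_adj_if_common_exit:
  assumes adj: "adj G c u" "adj G c w" "adj G c' u" "adj G c' w"
    and exit: "\<not> adj (bc_graph G c) u w" "u \<noteq> w"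
  shows "\<not> adj (bc_graph G u) c c'"
proof -
  have "\<not> o_heavy_pair G c c'"
    using bc_graph_o_heavy_neighbour[of c c' u w] adj exit by blast
  moreover have "\<not> adj G c c'"
  proof
    assume "adj G c c'"
    then show False
      using bc_graph_trans[of c u c' w] adj arcs_symmetric exit by (simp add: adj_bc_graph)
  qed
  ultimately show ?thesis
    by (simp add: adj_bc_graph)
qed

text \<open>
  Every common neighbour \<open>c\<close> of an o-heavy pair \<open>u, v\<close> has a neighbour adjacent to neither \<open>u\<close> nor
  \<open>v\<close>. There are more common neighbours than common non-neighbours, so two of them, \<open>c\<close> and \<open>c'\<close>,
  share such a neighbour; this puts them into different cliques of the neighbourhood of \<open>u\<close>, and \<open>v\<close>
  is adjacent to both: \<open>u\<close> is eligible.
\<close>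

lemma no_o_heavy_pair: "\<not> o_heavy_pair G u v"
proof
  assume heavy: "o_heavy_pair G u v"
  define common where "common = nbhd G u \<inter> nbhd G v"
  define outside where "outside = pverts G - {u, v} - (nbhd G u \<union> nbhd G v)"
  have "\<forall>c\<in>common. \<exists>w. w \<in> outside \<and> adj G c w \<and> \<not> adj (bc_graph G c) u w"
    using o_heavy_pair_exit[OF heavy] unfolding common_def outside_def by simp
  then obtain g where
    exits: "\<forall>c\<in>common. g c \<in> outside \<and> adj G c (g c) \<and> \<not> adj (bc_graph G c) u (g c)"
    using bchoice by metis
  have "finite outside" "card outside < card common"
    using pair_finite_verts o_heavy_pair_common_nbhd[OF heavy]
    unfolding common_def outside_def by simp_all
  moreover have "g ` common \<subseteq> outside"
    using exits by blast
  ultimately have "\<not> inj_on g common"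
    using card_inj_on_le[of g common outside] by linarith
  then obtain c c' where same_exit: "c \<in> common" "c' \<in> common" "c \<noteq> c'" "g c = g c'"
    unfolding inj_on_def by blast
  have adj: "adj G u c" "adj G u c'" "adj G v c" "adj G v c'" "adj G c u" "adj G c' u"
    using same_exit arcs_symmetric by (auto simp: common_def in_nbhd_iff)
  have exit: "adj G c (g c)" "adj G c' (g c)"
    using exits same_exit by metis+
  have "u \<noteq> g c" "\<not> adj (bc_graph G c) u (g c)"
    using exits same_exit(1) by (auto simp: outside_def)
  then have "\<not> adj (bc_graph G u) c c'"
    using bc_graph_not_adj_if_common_exit adj exit by blast
  then show False
    using bc_graph_o_heavy_neighbour[OF heavy] adj same_exit(3) by blast
qed

lemma claw_free_parcs: "claw_free (parcs G)"
  using o_heavy_claw no_o_heavy_pair unfolding o_heavy_claw_iff claw_free_def by blast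

lemma nbhd_trans:
  "adj G x u \<Longrightarrow> adj G x v \<Longrightarrow> adj G x w \<Longrightarrow> adj G u v \<Longrightarrow> adj G v w \<Longrightarrow> u \<noteq> w \<Longrightarrow> adj G u w"
  using bc_graph_trans[of x u v w] no_o_heavy_pair by (simp add: adj_bc_graph)

end

section \<open>Nets of the closure\<close>

locale claw_heavy_closure =
  fixes G H :: "'a pair_pre_digraph"
  assumes pair_graph_G: "pair_graph G"
    and o_heavy_claw_G: "o_heavy claw_graph G"
    and c_closure: "is_c_closure G H"
begin

lemma completion_steps_G_H: "completion_step\<^sup>*\<^sup>* G H"
  using c_closure by (simp add: is_c_closure_def)

end

sublocale claw_heavy_closure \<subseteq> G: pair_graph G
  by (rule pair_graph_G)

sublocale claw_heavy_closure \<subseteq> H: c_closed_graph H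
proof -
  interpret H: pair_graph H
    using completion_steps(1)[OF completion_steps_G_H pair_graph_G] .
  show "c_closed_graph H"
    using completion_steps(4)[OF completion_steps_G_H pair_graph_G o_heavy_claw_G] c_closure
    by unfold_locales (auto simp: is_c_closure_def)
qed

context claw_heavy_closure
begin

abbreviation E :: "'a \<Rightarrow> 'a \<Rightarrow> bool" where "E \<equiv> adj G"
abbreviation F :: "'a \<Rightarrow> 'a \<Rightarrow> bool" where "F \<equiv> adj H"
abbreviation n :: nat where "n \<equiv> card (pverts H)"

lemma pverts_H: "pverts H = pverts G"
  using completion_steps(2)[OF completion_steps_G_H pair_graph_G] .

lemma E_imp_F: "E u v \<Longrightarrow> F u v"
  using completion_steps(3)[OF completion_steps_G_H pair_graph_G] by blast

lemma link_path: "F u v \<Longrightarrow> (u, v) \<in> (Restr (parcs G) (link H u v))\<^sup>*"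
  using completion_steps_link_path[OF completion_steps_G_H pair_graph_G] .

lemmas E_sym = G.arcs_symmetric
lemmas F_sym = H.arcs_symmetric
lemmas F_trans = H.nbhd_trans

lemma F_claw:
  "F x u \<Longrightarrow> F x v \<Longrightarrow> F x w \<Longrightarrow> u \<noteq> v \<Longrightarrow> u \<noteq> w \<Longrightarrow> v \<noteq> w \<Longrightarrow> F u v \<or> F u w \<or> F v w"
  using H.claw_free_parcs unfolding claw_free_def is_claw_def by blast

lemma deg_G_le_deg_H: "deg G x \<le> deg H x"
  by (rule H.deg_mono) (use E_imp_F in auto)

lemma deg_G_less_deg_H:
  assumes "F x y" "\<not> E x y"
  shows "deg G x < deg H x"
  unfolding deg_def
  by (rule psubset_card_mono) (use assms E_imp_F in \<open>auto simp: in_nbhd_iff\<close>)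

lemma deg_sum_less_if_not_adj:
  assumes "u \<in> pverts H" "v \<in> pverts H" "u \<noteq> v" "\<not> F u v"
  shows "deg H u + deg H v < n"
  using H.no_o_heavy_pair[of u v] assms unfolding o_heavy_pair_def by simp

lemma o_heavy_pair_adj:
  assumes "o_heavy_pair G u v"
  shows "F u v"
  using H.no_o_heavy_pair[of u v] assms deg_G_le_deg_H[of u] deg_G_le_deg_H[of v]
  unfolding o_heavy_pair_def pverts_H by auto

lemma o_heavy_pair_deg_sum:
  assumes "o_heavy_pair G u v"
  shows "n + 2 \<le> deg H u + deg H v"
proof -
  have "deg G u < deg H u" "deg G v < deg H v"
    using deg_G_less_deg_H o_heavy_pair_adj[OF assms] F_sym G.o_heavy_pair_not_adj[OF assms]
    by blast+
  then show ?thesis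
    using assms unfolding o_heavy_pair_def pverts_H by linarith
qed

lemma claw_nonadjacent_leaf:
  assumes "E x u" "E x v" "E x w" "\<not> F u v" "\<not> F u w" "u \<noteq> v" "u \<noteq> w" "v \<noteq> w"
  shows "E v w \<or> o_heavy_pair G v w"
proof (rule ccontr)
  assume nonadjacent: "\<not> (E v w \<or> o_heavy_pair G v w)"
  then have "is_claw (parcs G) x u v w"
    using assms E_imp_F unfolding is_claw_def by blast
  then show False
    using o_heavy_claw_G nonadjacent assms(4,5) o_heavy_pair_adj unfolding G.o_heavy_claw_iff
    by blast
qed

lemma o_heavy_pair_common_neighbours:
  assumes "o_heavy_pair G u v"
  obtains w w' where "w \<noteq> w'" "E u w" "E v w" "E u w'" "E v w'"
proof -
  have "2 \<le> card (nbhd G u \<inter> nbhd G v)"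
    using G.o_heavy_pair_common_nbhd[OF assms] by simp
  then obtain w w' where "w \<noteq> w'" "{w, w'} \<subseteq> nbhd G u \<inter> nbhd G v"
    by (metis card_2_iff obtain_subset_with_card_n)
  then show thesis
    using that by (auto simp: in_nbhd_iff)
qed

lemma link_path_first_step:
  assumes "F u v"
  obtains y where "E u y" "y = v \<or> simplicial H y \<and> F u y \<and> F v y"
proof -
  have "(u, v) \<in> (Restr (parcs G) (link H u v))\<^sup>*" "u \<noteq> v"
    using link_path[OF assms] H.no_loops' assms
    by auto
  then obtain y where "(u, y) \<in> Restr (parcs G) (link H u v)"
    by (meson converse_rtranclE)
  then show thesis
    using that[of y] G.not_adj_self F_sym unfolding link_def by blast
qed

text \<open>The nets of the closure that are not p-heavy.\<close>

definition light_net :: "'a \<Rightarrow> 'a \<Rightarrow> 'a \<Rightarrow> 'a \<Rightarrow> 'a \<Rightarrow> 'a \<Rightarrow> bool" where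
  "light_net a\<^sub>1 b\<^sub>1 a\<^sub>2 b\<^sub>2 a\<^sub>3 b\<^sub>3 \<longleftrightarrow> is_net (parcs H) a\<^sub>1 b\<^sub>1 a\<^sub>2 b\<^sub>2 a\<^sub>3 b\<^sub>3 \<and>
     deg H a\<^sub>1 + deg H a\<^sub>2 < n \<and> deg H a\<^sub>1 + deg H a\<^sub>3 < n \<and> deg H a\<^sub>2 + deg H a\<^sub>3 < n"

text \<open>
  If \<open>a a'\<close> is an edge of the triangle of a net, \<open>arm a a'\<close> is \<open>L - {a}\<close> for the maximal clique \<open>L\<close>
    of
  \<open>H\<close> through \<open>a\<close> that does not contain the triangle; it does not depend on the choice of \<open>a'\<close>.
\<close>

definition arm :: "'a \<Rightarrow> 'a \<Rightarrow> 'a set" where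
  "arm a a' = {c. F a c \<and> \<not> F a' c \<and> c \<noteq> a'}"

lemma light_net_swap12:
  "light_net a\<^sub>1 b\<^sub>1 a\<^sub>2 b\<^sub>2 a\<^sub>3 b\<^sub>3 \<Longrightarrow> light_net a\<^sub>2 b\<^sub>2 a\<^sub>1 b\<^sub>1 a\<^sub>3 b\<^sub>3"
  unfolding light_net_def is_net_def by (auto simp: H.adj_commute add.commute)

lemma light_net_swap23:
  "light_net a\<^sub>1 b\<^sub>1 a\<^sub>2 b\<^sub>2 a\<^sub>3 b\<^sub>3 \<Longrightarrow> light_net a\<^sub>1 b\<^sub>1 a\<^sub>3 b\<^sub>3 a\<^sub>2 b\<^sub>2"
  unfolding light_net_def is_net_def by (auto simp: H.adj_commute add.commute)

lemma light_net_rotate: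
  "light_net a\<^sub>1 b\<^sub>1 a\<^sub>2 b\<^sub>2 a\<^sub>3 b\<^sub>3 \<Longrightarrow> light_net a\<^sub>2 b\<^sub>2 a\<^sub>3 b\<^sub>3 a\<^sub>1 b\<^sub>1"
  by (rule light_net_swap23) (rule light_net_swap12)

lemma light_net_adj:
  assumes "light_net a\<^sub>1 b\<^sub>1 a\<^sub>2 b\<^sub>2 a\<^sub>3 b\<^sub>3"
  shows "F a\<^sub>1 a\<^sub>2" "F a\<^sub>1 a\<^sub>3" "F a\<^sub>2 a\<^sub>3" "F a\<^sub>2 a\<^sub>1" "F a\<^sub>3 a\<^sub>1" "F a\<^sub>3 a\<^sub>2"
    "F a\<^sub>1 b\<^sub>1" "F a\<^sub>2 b\<^sub>2" "F a\<^sub>3 b\<^sub>3" "F b\<^sub>1 a\<^sub>1" "F b\<^sub>2 a\<^sub>2" "F b\<^sub>3 a\<^sub>3"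
  using assms unfolding light_net_def is_net_def by (simp_all add: H.adj_commute)

lemma light_net_not_adj:
  assumes "light_net a\<^sub>1 b\<^sub>1 a\<^sub>2 b\<^sub>2 a\<^sub>3 b\<^sub>3"
  shows "\<not> F a\<^sub>1 b\<^sub>2" "\<not> F a\<^sub>1 b\<^sub>3" "\<not> F a\<^sub>2 b\<^sub>1" "\<not> F a\<^sub>2 b\<^sub>3" "\<not> F a\<^sub>3 b\<^sub>1" "\<not> F a\<^sub>3 b\<^sub>2"
    "\<not> F b\<^sub>2 a\<^sub>1" "\<not> F b\<^sub>3 a\<^sub>1" "\<not> F b\<^sub>1 a\<^sub>2" "\<not> F b\<^sub>3 a\<^sub>2" "\<not> F b\<^sub>1 a\<^sub>3" "\<not> F b\<^sub>2 a\<^sub>3"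
    "\<not> F b\<^sub>1 b\<^sub>2" "\<not> F b\<^sub>1 b\<^sub>3" "\<not> F b\<^sub>2 b\<^sub>3" "\<not> F b\<^sub>2 b\<^sub>1" "\<not> F b\<^sub>3 b\<^sub>1" "\<not> F b\<^sub>3 b\<^sub>2"
  using assms unfolding light_net_def is_net_def by (simp_all add: H.adj_commute)

lemma light_net_deg_sum:
  assumes "light_net a\<^sub>1 b\<^sub>1 a\<^sub>2 b\<^sub>2 a\<^sub>3 b\<^sub>3"
  shows "deg H a\<^sub>1 + deg H a\<^sub>2 < n" "deg H a\<^sub>1 + deg H a\<^sub>3 < n" "deg H a\<^sub>2 + deg H a\<^sub>3 < n"
  using assms unfolding light_net_def by simp_all

lemma light_net_distinct:
  assumes "light_net a\<^sub>1 b\<^sub>1 a\<^sub>2 b\<^sub>2 a\<^sub>3 b\<^sub>3"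
  shows "distinct [a\<^sub>1, b\<^sub>1, a\<^sub>2, b\<^sub>2, a\<^sub>3, b\<^sub>3]"
  using light_net_adj[OF assms] light_net_not_adj[OF assms] H.not_adj_self by auto

lemma armD:
  assumes "c \<in> arm a\<^sub>1 a\<^sub>2"
  shows "F a\<^sub>1 c" "F c a\<^sub>1" "\<not> F a\<^sub>2 c" "\<not> F c a\<^sub>2" "c \<noteq> a\<^sub>2" "c \<noteq> a\<^sub>1"
  using assms F_sym H.not_adj_self unfolding arm_def by auto

lemma finite_arm [simp]: "finite (arm a a')"
  by (rule finite_subset[OF _ H.finite_nbhd[of a]]) (auto simp: arm_def in_nbhd_iff)

lemma arm_triangle_eq:
  assumes "F a\<^sub>1 a\<^sub>2" "F a\<^sub>1 a\<^sub>3" "F a\<^sub>2 a\<^sub>3"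
  shows "arm a\<^sub>1 a\<^sub>2 = arm a\<^sub>1 a\<^sub>3"
proof -
  have "F a\<^sub>2 c \<or> c = a\<^sub>2 \<longleftrightarrow> F a\<^sub>3 c \<or> c = a\<^sub>3" if "F a\<^sub>1 c" for c
    using F_trans[of a\<^sub>1 a\<^sub>2 a\<^sub>3 c] F_trans[of a\<^sub>1 a\<^sub>3 a\<^sub>2 c] assms that F_sym by blast
  then show ?thesis
    unfolding arm_def by blast
qed

lemma light_net_arm_eq:
  assumes "light_net a\<^sub>1 b\<^sub>1 a\<^sub>2 b\<^sub>2 a\<^sub>3 b\<^sub>3"
  shows "arm a\<^sub>1 a\<^sub>3 = arm a\<^sub>1 a\<^sub>2" "arm a\<^sub>2 a\<^sub>3 = arm a\<^sub>2 a\<^sub>1" "arm a\<^sub>3 a\<^sub>2 = arm a\<^sub>3 a\<^sub>1"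
  by (rule arm_triangle_eq; rule light_net_adj[OF assms])+

lemma light_net_pendant_in_arm:
  assumes "light_net a\<^sub>1 b\<^sub>1 a\<^sub>2 b\<^sub>2 a\<^sub>3 b\<^sub>3"
  shows "b\<^sub>1 \<in> arm a\<^sub>1 a\<^sub>2" "b\<^sub>2 \<in> arm a\<^sub>2 a\<^sub>1" "b\<^sub>3 \<in> arm a\<^sub>3 a\<^sub>1"
  using light_net_adj[OF assms] light_net_not_adj[OF assms] light_net_distinct[OF assms]
  by (auto simp: arm_def)

lemma arm_clique: "F a\<^sub>1 a\<^sub>2 \<Longrightarrow> c \<in> arm a\<^sub>1 a\<^sub>2 \<Longrightarrow> c' \<in> arm a\<^sub>1 a\<^sub>2 \<Longrightarrow> c \<noteq> c' \<Longrightarrow> F c c'"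
  using F_claw[of a\<^sub>1 c c' a\<^sub>2] armD by metis

lemma arm_neighbour: "F a\<^sub>1 a\<^sub>2 \<Longrightarrow> c \<in> arm a\<^sub>1 a\<^sub>2 \<Longrightarrow> F a\<^sub>1 w \<Longrightarrow> F c w \<Longrightarrow> w \<in> arm a\<^sub>1 a\<^sub>2"
  using F_trans[of a\<^sub>1 c w a\<^sub>2] F_sym unfolding arm_def by blast

lemma light_net_replace_pendant:
  assumes "light_net a\<^sub>1 b\<^sub>1 a\<^sub>2 b\<^sub>2 a\<^sub>3 b\<^sub>3" "c \<in> arm a\<^sub>1 a\<^sub>2" "\<not> F c b\<^sub>2" "\<not> F c b\<^sub>3"
  shows "light_net a\<^sub>1 c a\<^sub>2 b\<^sub>2 a\<^sub>3 b\<^sub>3"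
  using light_net_adj[OF assms(1)] light_net_not_adj[OF assms(1)] light_net_deg_sum[OF assms(1)]
    light_net_arm_eq(1)[OF assms(1)] assms(2-4) armD[of c a\<^sub>1 a\<^sub>2] armD[of c a\<^sub>1 a\<^sub>3]
  unfolding light_net_def is_net_def by simp

lemma light_net_replace_simplicial:
  assumes net: "light_net a\<^sub>1 b\<^sub>1 a\<^sub>2 b\<^sub>2 a\<^sub>3 b\<^sub>3" and simplicial: "simplicial H t" "F a\<^sub>1 t" "F b\<^sub>1 t"
  shows "light_net a\<^sub>1 t a\<^sub>2 b\<^sub>2 a\<^sub>3 b\<^sub>3"
proof (rule light_net_replace_pendant[OF net])
  note adj = light_net_adj[OF net] and not_adj = light_net_not_adj[OF net]
    and distinct = light_net_distinct[OF net]
  show "t \<in> arm a\<^sub>1 a\<^sub>2"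
    using arm_neighbour[OF adj(1) light_net_pendant_in_arm(1)[OF net] simplicial(2,3)] .
  show "\<not> F t b\<^sub>2" "\<not> F t b\<^sub>3"
    using simplicialD[OF simplicial(1) F_sym[OF simplicial(2)], of b\<^sub>2]
      simplicialD[OF simplicial(1) F_sym[OF simplicial(2)], of b\<^sub>3]
      not_adj distinct by auto
qed

lemma light_net_E_pendant:
  assumes "light_net a\<^sub>1 b\<^sub>1 a\<^sub>2 b\<^sub>2 a\<^sub>3 b\<^sub>3"
  obtains c where "E a\<^sub>1 c" "light_net a\<^sub>1 c a\<^sub>2 b\<^sub>2 a\<^sub>3 b\<^sub>3" "c = b\<^sub>1 \<or> simplicial H c"
  using link_path_first_step[OF light_net_adj(7)[OF assms]] light_net_replace_simplicial[OF assms]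
    assms by metis

lemma light_net_E_pendants:
  assumes "light_net a\<^sub>1 b\<^sub>1 a\<^sub>2 b\<^sub>2 a\<^sub>3 b\<^sub>3"
  obtains c\<^sub>2 c\<^sub>3 where "E a\<^sub>2 c\<^sub>2" "E a\<^sub>3 c\<^sub>3" "light_net a\<^sub>1 b\<^sub>1 a\<^sub>2 c\<^sub>2 a\<^sub>3 c\<^sub>3"
proof -
  obtain c\<^sub>2 where second: "E a\<^sub>2 c\<^sub>2" "light_net a\<^sub>2 c\<^sub>2 a\<^sub>3 b\<^sub>3 a\<^sub>1 b\<^sub>1"
    using light_net_E_pendant[OF light_net_rotate[OF assms]] .
  obtain c\<^sub>3 where third: "E a\<^sub>3 c\<^sub>3" "light_net a\<^sub>3 c\<^sub>3 a\<^sub>1 b\<^sub>1 a\<^sub>2 c\<^sub>2"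
    using light_net_E_pendant[OF light_net_rotate[OF second(2)]] .
  show thesis
    using that[OF second(1) third(1) light_net_rotate[OF third(2)]] .
qed

text \<open>
  The simplicial vertices of the clique of the triangle have smaller degree than the vertices of the
  triangle, so the hull contains no o-heavy pair of \<open>G\<close> and \<open>G\<close> is claw-free on it.
\<close>

definition net_hull :: "'a \<Rightarrow> 'a \<Rightarrow> 'a \<Rightarrow> 'a \<Rightarrow> 'a \<Rightarrow> 'a \<Rightarrow> 'a set" where
  "net_hull a\<^sub>1 b\<^sub>1 a\<^sub>2 b\<^sub>2 a\<^sub>3 b\<^sub>3 =
     {a\<^sub>1, b\<^sub>1, a\<^sub>2, b\<^sub>2, a\<^sub>3, b\<^sub>3} \<union> {t. simplicial H t \<and> F t a\<^sub>1 \<and> F t a\<^sub>2 \<and> F t a\<^sub>3}"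

lemma net_hull_rotate: "net_hull a\<^sub>2 b\<^sub>2 a\<^sub>3 b\<^sub>3 a\<^sub>1 b\<^sub>1 = net_hull a\<^sub>1 b\<^sub>1 a\<^sub>2 b\<^sub>2 a\<^sub>3 b\<^sub>3"
  unfolding net_hull_def by blast

lemma simplicial_not_adj_pendant:
  assumes net: "light_net a\<^sub>1 b\<^sub>1 a\<^sub>2 b\<^sub>2 a\<^sub>3 b\<^sub>3" and simplicial: "simplicial H t" "F t a\<^sub>2"
  shows "\<not> F t b\<^sub>1" "t \<noteq> b\<^sub>1"
  using simplicialD[OF simplicial, of b\<^sub>1] light_net_not_adj[OF net] light_net_distinct[OF net]
    simplicial(2) by auto

lemma net_hull_pendant_neighbour:
  assumes net: "light_net a\<^sub>1 b\<^sub>1 a\<^sub>2 b\<^sub>2 a\<^sub>3 b\<^sub>3"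
    and nbr: "y \<in> net_hull a\<^sub>1 b\<^sub>1 a\<^sub>2 b\<^sub>2 a\<^sub>3 b\<^sub>3" "F b\<^sub>1 y"
  shows "y = a\<^sub>1"
  using nbr light_net_not_adj[OF net] simplicial_not_adj_pendant[OF net] F_sym H.not_adj_self
  unfolding net_hull_def by blast

lemma simplicial_deg_less:
  assumes simplicial: "simplicial H t" "F t a" and separating: "F a c" "\<not> F t c" "t \<noteq> c"
  shows "deg H t < deg H a"
proof -
  have "F a u" if "F t u" "u \<noteq> a" for u
    using simplicialD[OF simplicial that(1)] that(2) by simp
  then have "insert t (nbhd H t - {a}) \<subseteq> nbhd H a - {c}"
    using F_sym[OF simplicial(2)] separating(2,3) by (auto simp: in_nbhd_iff)
  then have "card (insert t (nbhd H t - {a})) \<le> card (nbhd H a - {c})"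
    by (intro card_mono) auto
  moreover have "card (nbhd H a - {c}) < card (nbhd H a)"
    using card_Diff1_less[OF H.finite_nbhd] separating(1) by (simp add: in_nbhd_iff)
  moreover have "card (insert t (nbhd H t - {a})) = card (nbhd H t)"
    using simplicial H.not_adj_self card_Suc_Diff1[of "nbhd H t" a] by (simp add: in_nbhd_iff)
  ultimately show ?thesis
    unfolding deg_def by linarith
qed

lemma net_hull_simplicial_deg_less:
  assumes net: "light_net a\<^sub>1 b\<^sub>1 a\<^sub>2 b\<^sub>2 a\<^sub>3 b\<^sub>3"
    and simplicial: "simplicial H t" "F t a\<^sub>1" "F t a\<^sub>2" "F t a\<^sub>3"
  shows "deg H t < deg H a\<^sub>1" "deg H t < deg H a\<^sub>2" "deg H t < deg H a\<^sub>3"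
proof -
  note nets = net light_net_rotate[OF net] light_net_rotate[OF light_net_rotate[OF net]]
  show "deg H t < deg H a\<^sub>1" "deg H t < deg H a\<^sub>2" "deg H t < deg H a\<^sub>3"
    using simplicial_deg_less[OF simplicial(1)] simplicial light_net_adj(7-9)[OF net]
      nets[THEN simplicial_not_adj_pendant(1), OF simplicial(1)]
      nets[THEN simplicial_not_adj_pendant(2), OF simplicial(1)] by blast+
qed

lemma net_hull_pendant_no_o_heavy_pair:
  assumes net: "light_net a\<^sub>1 b\<^sub>1 a\<^sub>2 b\<^sub>2 a\<^sub>3 b\<^sub>3" and "E a\<^sub>1 b\<^sub>1"
    and in_hull: "v \<in> net_hull a\<^sub>1 b\<^sub>1 a\<^sub>2 b\<^sub>2 a\<^sub>3 b\<^sub>3"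
  shows "\<not> o_heavy_pair G b\<^sub>1 v"
  using net_hull_pendant_neighbour[OF net in_hull] o_heavy_pair_adj[of b\<^sub>1 v]
    G.o_heavy_pair_not_adj[of b\<^sub>1 v]
    assms(2) by blast

lemma net_hull_no_o_heavy_pair:
  assumes net: "light_net a\<^sub>1 b\<^sub>1 a\<^sub>2 b\<^sub>2 a\<^sub>3 b\<^sub>3" and pendants: "E a\<^sub>1 b\<^sub>1" "E a\<^sub>2 b\<^sub>2" "E a\<^sub>3 b\<^sub>3"
    and in_hull: "u \<in> net_hull a\<^sub>1 b\<^sub>1 a\<^sub>2 b\<^sub>2 a\<^sub>3 b\<^sub>3" "v \<in> net_hull a\<^sub>1 b\<^sub>1 a\<^sub>2 b\<^sub>2 a\<^sub>3 b\<^sub>3"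
  shows "\<not> o_heavy_pair G u v"
proof
  assume heavy: "o_heavy_pair G u v"
  note net' = light_net_rotate[OF net]
  note hull_rotate = net_hull_rotate[of a\<^sub>2 b\<^sub>2 a\<^sub>3 b\<^sub>3 a\<^sub>1 b\<^sub>1] net_hull_rotate[of a\<^sub>3 b\<^sub>3 a\<^sub>1 b\<^sub>1 a\<^sub>2 b\<^sub>2]
  have "w \<notin> {b\<^sub>1, b\<^sub>2, b\<^sub>3}" if "w' \<in> net_hull a\<^sub>1 b\<^sub>1 a\<^sub>2 b\<^sub>2 a\<^sub>3 b\<^sub>3" "o_heavy_pair G w w'" for w w'
    using that net_hull_pendant_no_o_heavy_pair[OF net pendants(1)]
      net_hull_pendant_no_o_heavy_pair[OF net' pendants(2)]
      net_hull_pendant_no_o_heavy_pair[OF light_net_rotate[OF net'] pendants(3)]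
    unfolding hull_rotate by blast
  then have "u \<notin> {b\<^sub>1, b\<^sub>2, b\<^sub>3}" "v \<notin> {b\<^sub>1, b\<^sub>2, b\<^sub>3}"
    using in_hull heavy G.o_heavy_pair_commute[of u v] by blast+
  then have "u \<in> {a\<^sub>1, a\<^sub>2, a\<^sub>3} \<union> {t. simplicial H t \<and> F t a\<^sub>1 \<and> F t a\<^sub>2 \<and> F t a\<^sub>3}"
    "v \<in> {a\<^sub>1, a\<^sub>2, a\<^sub>3} \<union> {t. simplicial H t \<and> F t a\<^sub>1 \<and> F t a\<^sub>2 \<and> F t a\<^sub>3}"
    using in_hull unfolding net_hull_def by simp_all
  moreover have "u \<noteq> v"
    using heavy by (simp add: o_heavy_pair_def)
  ultimately have "deg H u + deg H v < n"
    using light_net_deg_sum[OF net] net_hull_simplicial_deg_less[OF net, of u]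
      net_hull_simplicial_deg_less[OF net, of v] by auto
  then show False
    using o_heavy_pair_deg_sum[OF heavy] by linarith
qed

lemma net_hull_leaf:
  assumes net: "light_net a\<^sub>1 b\<^sub>1 a\<^sub>2 b\<^sub>2 a\<^sub>3 b\<^sub>3" and "E a\<^sub>1 b\<^sub>1"
  shows "Restr (parcs G) (net_hull a\<^sub>1 b\<^sub>1 a\<^sub>2 b\<^sub>2 a\<^sub>3 b\<^sub>3) `` {b\<^sub>1} = {a\<^sub>1}"
  using net_hull_pendant_neighbour[OF net] E_imp_F E_sym[OF assms(2)]
  by (auto simp: net_hull_def)

lemma link_subset_net_hull:
  assumes net: "light_net a\<^sub>1 b\<^sub>1 a\<^sub>2 b\<^sub>2 a\<^sub>3 b\<^sub>3"
  shows "link H a\<^sub>1 a\<^sub>2 \<subseteq> net_hull a\<^sub>1 b\<^sub>1 a\<^sub>2 b\<^sub>2 a\<^sub>3 b\<^sub>3"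
proof -
  note adj = light_net_adj[OF net]
  have "F t a\<^sub>3" if simplicial: "simplicial H t" "F t a\<^sub>1" "F t a\<^sub>2" for t
  proof -
    have "t \<noteq> a\<^sub>3"
      using simplicialD[OF simplicial(1), of a\<^sub>1 b\<^sub>3] adj light_net_not_adj[OF net]
        light_net_distinct[OF net]
      by auto
    then show ?thesis
      using F_trans[of a\<^sub>1 t a\<^sub>2 a\<^sub>3] adj simplicial F_sym by blast
  qed
  then show ?thesis
    unfolding link_def net_hull_def by blast
qed

lemma net_hull_path:
  assumes net: "light_net a\<^sub>1 b\<^sub>1 a\<^sub>2 b\<^sub>2 a\<^sub>3 b\<^sub>3" and pendants: "E a\<^sub>1 b\<^sub>1" "E a\<^sub>2 b\<^sub>2"
  shows "(b\<^sub>1, b\<^sub>2) \<in> (Restr (parcs G) (net_hull a\<^sub>1 b\<^sub>1 a\<^sub>2 b\<^sub>2 a\<^sub>3 b\<^sub>3))\<^sup>*" (is "_ \<in> ?R\<^sup>*")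
proof -
  have "(b\<^sub>1, a\<^sub>1) \<in> ?R" "(a\<^sub>2, b\<^sub>2) \<in> ?R"
    using pendants E_sym by (auto simp: net_hull_def)
  moreover have "(a\<^sub>1, a\<^sub>2) \<in> ?R\<^sup>*"
    using link_path[OF light_net_adj(1)[OF net]] link_subset_net_hull[OF net] rtrancl_Restr_mono
    by metis
  ultimately show ?thesis
    by (meson converse_rtrancl_into_rtrancl rtrancl_into_rtrancl)
qed

lemma net_hull_net:
  assumes net: "light_net a\<^sub>1 b\<^sub>1 a\<^sub>2 b\<^sub>2 a\<^sub>3 b\<^sub>3" and pendants: "E a\<^sub>1 b\<^sub>1" "E a\<^sub>2 b\<^sub>2" "E a\<^sub>3 b\<^sub>3"
  defines "R \<equiv> Restr (parcs G) (net_hull a\<^sub>1 b\<^sub>1 a\<^sub>2 b\<^sub>2 a\<^sub>3 b\<^sub>3)"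
  shows "\<exists>x x' y y' z z'. is_net R x x' y y' z z'"
    and "is_net R a\<^sub>1 b\<^sub>1 a\<^sub>2 b\<^sub>2 a\<^sub>3 b\<^sub>3 \<or> (\<exists>a b c p q r. is_wounded R a b c p q r)"
proof -
  note nets = net light_net_rotate[OF net] light_net_rotate[OF light_net_rotate[OF net]]
  note hull_rotate = net_hull_rotate[of a\<^sub>2 b\<^sub>2 a\<^sub>3 b\<^sub>3 a\<^sub>1 b\<^sub>1] net_hull_rotate[of a\<^sub>3 b\<^sub>3 a\<^sub>1 b\<^sub>1 a\<^sub>2 b\<^sub>2]
  have sym: "sym R" "irrefl R"
    using E_sym G.not_adj_self unfolding R_def sym_def irrefl_def by blast+
  have claw_free: "claw_free R"
    unfolding claw_free_def
  proof (intro allI notI)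
    fix x u v w
    assume "is_claw R x u v w"
    then have "is_claw (parcs G) x u v w"
      and hull: "{u, v, w} \<subseteq> net_hull a\<^sub>1 b\<^sub>1 a\<^sub>2 b\<^sub>2 a\<^sub>3 b\<^sub>3"
      unfolding is_claw_def R_def by blast+
    then have "o_heavy_pair G u v \<or> o_heavy_pair G u w \<or> o_heavy_pair G v w"
      using o_heavy_claw_G G.o_heavy_claw_iff by blast
    then show False
      using net_hull_no_o_heavy_pair[OF net pendants] hull by auto
  qed
  have leaves: "R `` {b\<^sub>1} = {a\<^sub>1}" "R `` {b\<^sub>2} = {a\<^sub>2}" "R `` {b\<^sub>3} = {a\<^sub>3}"
    using net_hull_leaf[OF nets(1) pendants(1)] net_hull_leaf[OF nets(2) pendants(2)]
      net_hull_leaf[OF nets(3) pendants(3)] unfolding R_def hull_rotate .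
  have distinct: "distinct [b\<^sub>1, b\<^sub>2, b\<^sub>3]"
    using light_net_distinct[OF net] by simp
  have paths: "(b\<^sub>1, b\<^sub>2) \<in> R\<^sup>*" "(b\<^sub>3, b\<^sub>1) \<in> R\<^sup>*"
    using net_hull_path[OF nets(1)] net_hull_path[OF nets(3)] pendants
    unfolding R_def hull_rotate by simp_all
  note net_in_hull = claw_free_three_leaves_net[OF sym claw_free leaves distinct paths]
  show "\<exists>x x' y y' z z'. is_net R x x' y y' z z'"
    by (rule net_in_hull)
  show "is_net R a\<^sub>1 b\<^sub>1 a\<^sub>2 b\<^sub>2 a\<^sub>3 b\<^sub>3 \<or> (\<exists>a b c p q r. is_wounded R a b c p q r)"
    by (rule net_in_hull)
qed

lemma light_net_E_pendants_all:
  assumes "light_net a\<^sub>1 b\<^sub>1 a\<^sub>2 b\<^sub>2 a\<^sub>3 b\<^sub>3"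
  obtains c\<^sub>1 c\<^sub>2 c\<^sub>3 where "light_net a\<^sub>1 c\<^sub>1 a\<^sub>2 c\<^sub>2 a\<^sub>3 c\<^sub>3" "E a\<^sub>1 c\<^sub>1" "E a\<^sub>2 c\<^sub>2" "E a\<^sub>3 c\<^sub>3"
proof -
  obtain c\<^sub>1 where first: "E a\<^sub>1 c\<^sub>1" "light_net a\<^sub>1 c\<^sub>1 a\<^sub>2 b\<^sub>2 a\<^sub>3 b\<^sub>3"
    using light_net_E_pendant[OF assms] .
  show thesis
    using light_net_E_pendants[OF first(2)] that first(1) by metis
qed

lemma light_net_not_o_heavy_net:
  assumes "light_net a\<^sub>1 b\<^sub>1 a\<^sub>2 b\<^sub>2 a\<^sub>3 b\<^sub>3"
  shows "\<not> o_heavy net_graph G"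
proof
  assume heavy: "o_heavy net_graph G"
  obtain c\<^sub>1 c\<^sub>2 c\<^sub>3 where net: "light_net a\<^sub>1 c\<^sub>1 a\<^sub>2 c\<^sub>2 a\<^sub>3 c\<^sub>3"
    and pendants: "E a\<^sub>1 c\<^sub>1" "E a\<^sub>2 c\<^sub>2" "E a\<^sub>3 c\<^sub>3"
    using light_net_E_pendants_all[OF assms] .
  obtain x x' y y' z z' where "is_net (Restr (parcs G) (net_hull a\<^sub>1 c\<^sub>1 a\<^sub>2 c\<^sub>2 a\<^sub>3 c\<^sub>3)) x x' y y' z z'"
    using net_hull_net(1)[OF net pendants] by blast
  then have "is_net (parcs G) x x' y y' z z'"
    and hull: "{x, x', y, y', z, z'} \<subseteq> net_hull a\<^sub>1 c\<^sub>1 a\<^sub>2 c\<^sub>2 a\<^sub>3 c\<^sub>3"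
    unfolding is_net_Restr_iff by simp_all
  then obtain u v where "u \<in> {x, x', y, y', z, z'}" "v \<in> {x, x', y, y', z, z'}" "o_heavy_pair G u v"
    using G.o_heavy_net_pair[OF heavy] by metis
  then show False
    using net_hull_no_o_heavy_pair[OF net pendants] hull by blast
qed

lemma light_net_E_triangle:
  assumes "light_net a\<^sub>1 b\<^sub>1 a\<^sub>2 b\<^sub>2 a\<^sub>3 b\<^sub>3" and heavy: "o_heavy wounded_graph G"
  shows "E a\<^sub>1 a\<^sub>2" "E a\<^sub>1 a\<^sub>3" "E a\<^sub>2 a\<^sub>3"
proof -
  obtain c\<^sub>1 c\<^sub>2 c\<^sub>3 where net: "light_net a\<^sub>1 c\<^sub>1 a\<^sub>2 c\<^sub>2 a\<^sub>3 c\<^sub>3"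
    and pendants: "E a\<^sub>1 c\<^sub>1" "E a\<^sub>2 c\<^sub>2" "E a\<^sub>3 c\<^sub>3"
    using light_net_E_pendants_all[OF assms(1)] .
  have "\<not> is_wounded (Restr (parcs G) (net_hull a\<^sub>1 c\<^sub>1 a\<^sub>2 c\<^sub>2 a\<^sub>3 c\<^sub>3)) a b c p q r" for a b c p q r
  proof
    assume "is_wounded (Restr (parcs G) (net_hull a\<^sub>1 c\<^sub>1 a\<^sub>2 c\<^sub>2 a\<^sub>3 c\<^sub>3)) a b c p q r"
    then have "is_wounded (parcs G) a b c p q r"
      and hull: "{a, b, c, p, q, r} \<subseteq> net_hull a\<^sub>1 c\<^sub>1 a\<^sub>2 c\<^sub>2 a\<^sub>3 c\<^sub>3"
      unfolding is_wounded_Restr_iff by simp_all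
    then obtain u v where "u \<in> {a, b, c, p, q, r}" "v \<in> {a, b, c, p, q, r}" "o_heavy_pair G u v"
      using G.o_heavy_wounded_pair[OF heavy] by metis
    then show False
      using net_hull_no_o_heavy_pair[OF net pendants] hull by blast
  qed
  then have "is_net (parcs G) a\<^sub>1 c\<^sub>1 a\<^sub>2 c\<^sub>2 a\<^sub>3 c\<^sub>3"
    using net_hull_net(2)[OF net pendants] unfolding is_net_Restr_iff by blast
  then show "E a\<^sub>1 a\<^sub>2" "E a\<^sub>1 a\<^sub>3" "E a\<^sub>2 a\<^sub>3"
    unfolding is_net_def by blast+
qed

section \<open>Heavy arms\<close>

lemma arm_unique:
  assumes "F a\<^sub>1 a\<^sub>2" "w \<in> arm a\<^sub>1 a\<^sub>2" "w' \<in> arm a\<^sub>1 a\<^sub>2" "F b w" "F b w'" "b \<noteq> a\<^sub>1" "\<not> F a\<^sub>1 b"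
  shows "w = w'"
  using arm_clique[OF assms(1-3)] F_trans[of w a\<^sub>1 w' b] assms armD F_sym by metis

lemma card_arm_neighbours_le_1:
  assumes "F a\<^sub>1 a\<^sub>2" "b \<noteq> a\<^sub>1" "\<not> F a\<^sub>1 b"
  shows "card {z \<in> arm a\<^sub>1 a\<^sub>2. F b z} \<le> 1"
proof -
  have "\<forall>w\<in>{z \<in> arm a\<^sub>1 a\<^sub>2. F b z}. \<forall>w'\<in>{z \<in> arm a\<^sub>1 a\<^sub>2. F b z}. w = w'"
    using arm_unique[OF assms(1) _ _ _ _ assms(2,3)] by blast
  then show ?thesis
    by (simp add: card_le_Suc0_iff_eq)
qed

lemma card_insert_arm_Diff:
  assumes "c \<in> arm a\<^sub>1 a\<^sub>2"
  shows "card (insert a\<^sub>1 (arm a\<^sub>1 a\<^sub>2 - {c})) = card (arm a\<^sub>1 a\<^sub>2)"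
proof -
  have "a\<^sub>1 \<notin> arm a\<^sub>1 a\<^sub>2"
    using armD(6) by blast
  then show ?thesis
    using card_Suc_Diff1[OF finite_arm assms] by simp
qed

lemma card_arm_le_deg:
  assumes "F a\<^sub>1 a\<^sub>2" "c \<in> arm a\<^sub>1 a\<^sub>2"
  shows "card (arm a\<^sub>1 a\<^sub>2) \<le> deg H c"
proof -
  have "insert a\<^sub>1 (arm a\<^sub>1 a\<^sub>2 - {c}) \<subseteq> nbhd H c"
    using arm_clique[OF assms] armD(2)[OF assms(2)] unfolding nbhd_def by blast
  then show ?thesis
    using card_mono[OF H.finite_nbhd] card_insert_arm_Diff[OF assms(2)] unfolding deg_def by metis
qed

lemma arm_common_neighbour:
  assumes "F a\<^sub>1 a\<^sub>2" "u \<in> insert a\<^sub>1 (arm a\<^sub>1 a\<^sub>2)" "v \<in> insert a\<^sub>1 (arm a\<^sub>1 a\<^sub>2)" "u \<noteq> v"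
    "F u w" "F v w"
  shows "w \<in> insert a\<^sub>1 (arm a\<^sub>1 a\<^sub>2)"
proof (cases "u = a\<^sub>1 \<or> v = a\<^sub>1")
  case True
  then show ?thesis using assms arm_neighbour by blast
next
  case False
  then have in_arm: "u \<in> arm a\<^sub>1 a\<^sub>2" "v \<in> arm a\<^sub>1 a\<^sub>2" using assms by auto
  then have "F u v" using arm_clique assms by blast
  then have "w = a\<^sub>1 \<or> F a\<^sub>1 w"
    using F_trans[of u a\<^sub>1 v w] armD[OF in_arm(1)] armD[OF in_arm(2)] assms by blast
  then show ?thesis using arm_neighbour assms in_arm by blast
qed

lemma o_heavy_pair_card_arm:
  assumes "F a\<^sub>1 a\<^sub>2" and in_clique: "u \<in> insert a\<^sub>1 (arm a\<^sub>1 a\<^sub>2)" "v \<in> insert a\<^sub>1 (arm a\<^sub>1 a\<^sub>2)"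
    and heavy: "o_heavy_pair G u v"
  shows "3 \<le> card (arm a\<^sub>1 a\<^sub>2)"
proof -
  obtain w w' where common_nbrs: "w \<noteq> w'" "E u w" "E v w" "E u w'" "E v w'"
    using o_heavy_pair_common_neighbours[OF heavy] .
  have "u \<noteq> v"
    using heavy by (simp add: o_heavy_pair_def)
  then have "{w, w'} \<subseteq> insert a\<^sub>1 (arm a\<^sub>1 a\<^sub>2)"
    using arm_common_neighbour[OF assms(1) in_clique] common_nbrs E_imp_F by blast
  then have "card {u, v, w, w'} \<le> card (insert a\<^sub>1 (arm a\<^sub>1 a\<^sub>2))"
    using in_clique by (intro card_mono) auto
  moreover have "card {u, v, w, w'} = 4"
    using common_nbrs \<open>u \<noteq> v\<close> G.no_loops' by fastforce
  ultimately show ?thesis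
    using card_insert_le_m1[of 3 "arm a\<^sub>1 a\<^sub>2" a\<^sub>1] by linarith
qed

text \<open>
  The cardinality bound holds as soon as \<open>insert a (arm a a')\<close> contains an o-heavy pair of \<open>G\<close>: the
  two common neighbours of such a pair lie in the same clique.
\<close>

definition heavy_arm :: "'a \<Rightarrow> 'a \<Rightarrow> bool" where
  "heavy_arm a a' \<longleftrightarrow> 3 \<le> card (arm a a') \<and> (\<exists>c\<in>arm a a'. n \<le> deg H a + deg H c)"

lemma heavy_armI:
  assumes "F a\<^sub>1 a\<^sub>2" "c \<in> arm a\<^sub>1 a\<^sub>2" "o_heavy_pair G a\<^sub>1 c"
  shows "heavy_arm a\<^sub>1 a\<^sub>2"
proof -
  have "n \<le> deg H a\<^sub>1 + deg H c"
    using o_heavy_pair_deg_sum[OF assms(3)] by simp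
  then show ?thesis
    using o_heavy_pair_card_arm[OF assms(1) _ _ assms(3)] assms(2) unfolding heavy_arm_def by blast
qed

lemma light_arm_no_o_heavy_pair:
  assumes "F a\<^sub>1 a\<^sub>2" "\<not> heavy_arm a\<^sub>1 a\<^sub>2" "x \<in> arm a\<^sub>1 a\<^sub>2" "c \<in> arm a\<^sub>1 a\<^sub>2" "deg G x \<le> deg H a\<^sub>1"
  shows "\<not> o_heavy_pair G x c"
proof
  assume heavy: "o_heavy_pair G x c"
  then have "n \<le> deg G x + deg G c"
    by (simp add: o_heavy_pair_def pverts_H)
  then have "n \<le> deg H a\<^sub>1 + deg H c"
    using assms(5) deg_G_le_deg_H[of c] by linarith
  moreover have "3 \<le> card (arm a\<^sub>1 a\<^sub>2)"
    using o_heavy_pair_card_arm[OF assms(1) _ _ heavy] assms(3,4) by blast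
  ultimately show False
    using assms(2,4) unfolding heavy_arm_def by blast
qed

lemma light_net_heavy_arm_iff:
  assumes "light_net a\<^sub>1 b\<^sub>1 a\<^sub>2 b\<^sub>2 a\<^sub>3 b\<^sub>3"
  shows "heavy_arm a\<^sub>1 a\<^sub>3 \<longleftrightarrow> heavy_arm a\<^sub>1 a\<^sub>2" "heavy_arm a\<^sub>2 a\<^sub>3 \<longleftrightarrow> heavy_arm a\<^sub>2 a\<^sub>1"
    "heavy_arm a\<^sub>3 a\<^sub>2 \<longleftrightarrow> heavy_arm a\<^sub>3 a\<^sub>1"
  unfolding heavy_arm_def light_net_arm_eq[OF assms] by simp_all

lemma heavy_arm_unique:
  assumes "heavy_arm a\<^sub>1 a\<^sub>2"
  shows "\<not> heavy_arm a\<^sub>2 a\<^sub>1"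
proof
  assume "heavy_arm a\<^sub>2 a\<^sub>1"
  then obtain c c' where first: "c \<in> arm a\<^sub>1 a\<^sub>2" "n \<le> deg H a\<^sub>1 + deg H c"
    and second: "c' \<in> arm a\<^sub>2 a\<^sub>1" "n \<le> deg H a\<^sub>2 + deg H c'"
    using assms unfolding heavy_arm_def by blast
  have "deg H a\<^sub>1 + deg H c' < n" "deg H a\<^sub>2 + deg H c < n"
    using deg_sum_less_if_not_adj armD[OF first(1)] armD[OF second(1)] H.in_arcsD1 by metis+
  then show False
    using first(2) second(2) by linarith
qed

lemma arm_exit_first_step:
  assumes "x \<in> arm a\<^sub>1 a\<^sub>2" "F x w" "\<not> F a\<^sub>1 w" "w \<noteq> a\<^sub>1"
  obtains c where "E x c" "\<not> F a\<^sub>1 c" "c \<noteq> a\<^sub>1" "c = w \<or> simplicial H c \<and> F x c \<and> F w c"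
proof -
  obtain c where first_step: "E x c" "c = w \<or> simplicial H c \<and> F x c \<and> F w c"
    using link_path_first_step[OF assms(2)] .
  have "\<not> F a\<^sub>1 c \<and> c \<noteq> a\<^sub>1"
    using first_step assms F_trans[of x a\<^sub>1 c w] armD[OF assms(1)] F_sym by blast
  then show thesis
    using that first_step by blast
qed

end

section \<open>Nets in closures of wounded-o-heavy graphs\<close>

locale wounded_heavy_closure = claw_heavy_closure +
  assumes two_connected_G: "two_connected G"
    and o_heavy_wounded: "o_heavy wounded_graph G"
begin

lemma wounded_o_heavy_pair:
  assumes edges: "E a b" "E b c" "E a c" "E a p" "E b q" "E q r"
    and not_adj: "\<not> F a q" "\<not> F a r" "\<not> F b p" "\<not> F c p" "\<not> F c q" "\<not> F p q" "\<not> F p r"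
    and "\<not> E b r" "\<not> E c r"
  shows "o_heavy_pair G b r \<or> o_heavy_pair G c r"
proof -
  have "is_wounded (parcs G) a b c p q r"
    unfolding is_wounded_def using assms E_imp_F by blast
  then obtain u v where pair: "u \<in> {a, b, c, p, q, r}" "v \<in> {a, b, c, p, q, r}" "o_heavy_pair G u v"
    using G.o_heavy_wounded_pair[OF o_heavy_wounded] by metis
  have light_if_not_adj: "\<not> o_heavy_pair G x y" "\<not> o_heavy_pair G y x" if "\<not> F x y" for x y
    using o_heavy_pair_adj F_sym that by blast+
  have light_if_E: "\<not> o_heavy_pair G x y" "\<not> o_heavy_pair G y x" if "E x y" for x y
    using G.o_heavy_pair_not_adj that by blast+
  have "\<not> o_heavy_pair G x x" for x
    by (simp add: o_heavy_pair_def)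
  note light = this edges[THEN light_if_E(1)] edges[THEN light_if_E(2)]
    not_adj[THEN light_if_not_adj(1)] not_adj[THEN light_if_not_adj(2)]
  show ?thesis
    using pair G.o_heavy_pair_commute[of r b] G.o_heavy_pair_commute[of r c]
    by (elim insertE emptyE) (simp_all add: light)
qed

lemma no_wounded:
  assumes "E a b" "E b c" "E a c" "E a p" "E b q" "E q r"
    and "\<not> F a q" "\<not> F a r" "\<not> F b p" "\<not> F c p" "\<not> F c q" "\<not> F p q" "\<not> F p r" "\<not> F b r" "\<not> F c r"
  shows False
  using wounded_o_heavy_pair[OF assms(1-13)] assms(14,15) E_imp_F o_heavy_pair_adj by blast

lemma E_triangle:
  assumes "light_net a\<^sub>1 b\<^sub>1 a\<^sub>2 b\<^sub>2 a\<^sub>3 b\<^sub>3"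
  shows "E a\<^sub>1 a\<^sub>2" "E a\<^sub>1 a\<^sub>3" "E a\<^sub>2 a\<^sub>3" "E a\<^sub>2 a\<^sub>1" "E a\<^sub>3 a\<^sub>1" "E a\<^sub>3 a\<^sub>2"
  using light_net_E_triangle[OF assms o_heavy_wounded] E_sym by blast+

lemma light_arm_E_pendant:
  assumes "light_net a\<^sub>1 b\<^sub>1 a\<^sub>2 b\<^sub>2 a\<^sub>3 b\<^sub>3" and light: "\<not> heavy_arm a\<^sub>1 a\<^sub>2"
  shows "E a\<^sub>1 b\<^sub>1"
proof (rule ccontr)
  assume not_E: "\<not> E a\<^sub>1 b\<^sub>1"
  obtain c\<^sub>2 c\<^sub>3 where pendant: "E a\<^sub>2 c\<^sub>2" and net: "light_net a\<^sub>1 b\<^sub>1 a\<^sub>2 c\<^sub>2 a\<^sub>3 c\<^sub>3"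
    using light_net_E_pendants[OF assms(1)] .
  note adj = light_net_adj[OF net]
  let ?R = "Restr (parcs G) (link H a\<^sub>1 b\<^sub>1)" and ?T = "insert a\<^sub>1 (nbhd G a\<^sub>1)"
  have "(a\<^sub>1, b\<^sub>1) \<in> ?R\<^sup>*" "b\<^sub>1 \<notin> ?T"
    using link_path[OF adj(7)] not_E light_net_distinct[OF net] by (auto simp: in_nbhd_iff)
  then have "\<not> ?R `` ?T \<subseteq> ?T"
    using Image_closed_trancl[of ?R ?T] by blast
  then obtain p q where leaving: "E p q" "p \<in> link H a\<^sub>1 b\<^sub>1" "q \<in> link H a\<^sub>1 b\<^sub>1" "p \<in> ?T" "q \<notin> ?T"
    by blast
  then have inside: "E a\<^sub>1 p" "simplicial H p" "F p a\<^sub>1" "F p b\<^sub>1"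
    and outside: "q = b\<^sub>1 \<or> simplicial H q \<and> F q a\<^sub>1 \<and> F q b\<^sub>1" "\<not> E a\<^sub>1 q"
    using not_E unfolding link_def by (auto simp: in_nbhd_iff)
  have net_p: "light_net a\<^sub>1 p a\<^sub>2 c\<^sub>2 a\<^sub>3 c\<^sub>3"
    using light_net_replace_simplicial[OF net] inside F_sym by blast
  have net_q: "light_net a\<^sub>1 q a\<^sub>2 c\<^sub>2 a\<^sub>3 c\<^sub>3"
    using light_net_replace_simplicial[OF net] outside F_sym net by blast
  have "o_heavy_pair G a\<^sub>1 q \<or> o_heavy_pair G a\<^sub>3 q"
    using E_triangle[OF net] pendant leaving inside outside light_net_not_adj[OF net_p]
      light_net_not_adj[OF net_q] E_imp_F
    by (intro wounded_o_heavy_pair[of a\<^sub>2 a\<^sub>1 a\<^sub>3 c\<^sub>2 p q]) blast+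
  then have "o_heavy_pair G a\<^sub>1 q"
    using o_heavy_pair_adj light_net_not_adj[OF net_q] by blast
  then show False
    using heavy_armI[OF adj(1) light_net_pendant_in_arm(1)[OF net_q]] light by blast
qed

lemma light_arm_exit:
  assumes "light_net a\<^sub>1 x a\<^sub>2 b\<^sub>2 a\<^sub>3 b\<^sub>3" and light: "\<not> heavy_arm a\<^sub>1 a\<^sub>2"
    and exit: "E x c" "\<not> F a\<^sub>1 c" "c \<noteq> a\<^sub>1"
  shows "F a\<^sub>2 c \<or> F a\<^sub>3 c"
proof (rule ccontr)
  assume no_exit: "\<not> (F a\<^sub>2 c \<or> F a\<^sub>3 c)"
  obtain c\<^sub>2 c\<^sub>3 where pendants: "E a\<^sub>2 c\<^sub>2" "E a\<^sub>3 c\<^sub>3" and net: "light_net a\<^sub>1 x a\<^sub>2 c\<^sub>2 a\<^sub>3 c\<^sub>3"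
    using light_net_E_pendants[OF assms(1)] .
  note adj = light_net_adj[OF net] and not_adj = light_net_not_adj[OF net]
    and triangle = E_triangle[OF net]
  have E_pendant: "E a\<^sub>1 x"
    using light_arm_E_pendant[OF net light] .
  have "F c x" "c \<noteq> c\<^sub>2" "c \<noteq> c\<^sub>3" "c\<^sub>2 \<noteq> c\<^sub>3"
    using exit E_imp_F F_sym no_exit adj light_net_distinct[OF net] by auto
  then have "\<not> F c c\<^sub>2 \<or> \<not> F c c\<^sub>3"
    using F_claw[of c x c\<^sub>2 c\<^sub>3] not_adj light_net_distinct[OF net] by auto
  then show False
  proof
    assume "\<not> F c c\<^sub>2"
    then show False
      using triangle E_pendant pendants exit no_exit not_adj F_sym
      by (intro no_wounded[of a\<^sub>2 a\<^sub>1 a\<^sub>3 c\<^sub>2 x c]) blast+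
  next
    assume "\<not> F c c\<^sub>3"
    then show False
      using triangle E_pendant pendants exit no_exit not_adj F_sym
      by (intro no_wounded[of a\<^sub>3 a\<^sub>1 a\<^sub>2 c\<^sub>3 x c]) blast+
  qed
qed

lemma light_arm_pendant_nbhd:
  assumes net: "light_net a\<^sub>1 x a\<^sub>2 b\<^sub>2 a\<^sub>3 b\<^sub>3" and light: "\<not> heavy_arm a\<^sub>1 a\<^sub>2"
  shows "nbhd G x \<subseteq> insert a\<^sub>1 (arm a\<^sub>1 a\<^sub>2 - {x}) \<union> {w \<in> arm a\<^sub>2 a\<^sub>1. F x w} \<union> {w \<in> arm a\<^sub>3 a\<^sub>1. F x w}"
proof
  fix u
  assume "u \<in> nbhd G x"
  then have nbr: "E x u" "F x u" "u \<noteq> x"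
    using E_imp_F G.no_loops' by (auto simp: in_nbhd_iff)
  consider (vertex) "u = a\<^sub>1" | (clique) "F a\<^sub>1 u" | (exit) "\<not> F a\<^sub>1 u" "u \<noteq> a\<^sub>1" by blast
  then show "u \<in> insert a\<^sub>1 (arm a\<^sub>1 a\<^sub>2 - {x}) \<union> {w \<in> arm a\<^sub>2 a\<^sub>1. F x w} \<union> {w \<in> arm a\<^sub>3 a\<^sub>1. F x w}"
  proof cases
    case clique
    then show ?thesis
      using arm_neighbour[OF light_net_adj(1)[OF net] light_net_pendant_in_arm(1)[OF net]] nbr
        by blast
  next
    case exit
    then show ?thesis
      using light_arm_exit[OF net light nbr(1)] nbr(2) unfolding arm_def by blast
  qed simp
qed

lemma light_arm_pendant_deg:
  assumes net: "light_net a\<^sub>1 x a\<^sub>2 b\<^sub>2 a\<^sub>3 b\<^sub>3" and "\<not> heavy_arm a\<^sub>1 a\<^sub>2"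
  shows "deg G x \<le> deg H a\<^sub>1"
proof -
  note adj = light_net_adj[OF net] and not_adj = light_net_not_adj[OF net]
    and distinct = light_net_distinct[OF net]
  let ?A = "arm a\<^sub>1 a\<^sub>2"
  let ?W = "\<lambda>a. {w \<in> arm a a\<^sub>1. F x w}"
  have "deg G x \<le> card (insert a\<^sub>1 (?A - {x}) \<union> ?W a\<^sub>2 \<union> ?W a\<^sub>3)"
    unfolding deg_def by (rule card_mono[OF _ light_arm_pendant_nbhd[OF assms]]) simp
  also have "\<dots> \<le> card (insert a\<^sub>1 (?A - {x})) + card (?W a\<^sub>2) + card (?W a\<^sub>3)"
    using card_Un_le[of "insert a\<^sub>1 (?A - {x})" "?W a\<^sub>2"]
      card_Un_le[of "insert a\<^sub>1 (?A - {x}) \<union> ?W a\<^sub>2" "?W a\<^sub>3"] by linarith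
  also have "\<dots> \<le> card ?A + 2"
    using card_arm_neighbours_le_1[of a\<^sub>2 a\<^sub>1 x] card_arm_neighbours_le_1[of a\<^sub>3 a\<^sub>1 x] adj not_adj
      distinct card_insert_arm_Diff[OF light_net_pendant_in_arm(1)[OF net]] by auto
  also have "\<dots> = card (?A \<union> {a\<^sub>2, a\<^sub>3})"
  proof -
    have "?A \<inter> {a\<^sub>2, a\<^sub>3} = {}"
      using distinct adj by (auto simp: arm_def)
    then show ?thesis
      using distinct by (simp add: card_Un_disjoint)
  qed
  also have "\<dots> \<le> deg H a\<^sub>1"
    unfolding deg_def by (rule card_mono) (use adj in \<open>auto simp: arm_def in_nbhd_iff\<close>)
  finally show ?thesis .
qed

lemma light_arms_exit_E:
  assumes net: "light_net a\<^sub>1 x a\<^sub>2 b\<^sub>2 a\<^sub>3 b\<^sub>3" and light: "\<not> heavy_arm a\<^sub>1 a\<^sub>2" "\<not> heavy_arm a\<^sub>2 a\<^sub>1"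
    and third_pendant: "E a\<^sub>3 b\<^sub>3" and exit: "E x c" "c \<in> arm a\<^sub>2 a\<^sub>1"
  shows "E a\<^sub>2 c" "\<not> F c b\<^sub>3"
proof -
  note adj = light_net_adj[OF net] and not_adj = light_net_not_adj[OF net]
    and distinct = light_net_distinct[OF net]
  have exit_adj: "F x c" "F c x"
    using exit(1) E_imp_F F_sym by blast+
  have arm_adj: "F a\<^sub>2 c" "F c a\<^sub>2" "\<not> F a\<^sub>1 c" "c \<noteq> a\<^sub>1"
    using armD[OF exit(2)] by simp_all
  have not_adj_third: "\<not> F a\<^sub>3 c" "\<not> F c a\<^sub>3" "c \<noteq> a\<^sub>3"
    using armD[of c a\<^sub>2 a\<^sub>3] exit(2) light_net_arm_eq(2)[OF net] by auto
  show not_adj_pendant: "\<not> F c b\<^sub>3"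
    using F_claw[of c x b\<^sub>3 a\<^sub>2] exit_adj not_adj distinct arm_adj not_adj_third(1) adj(9) by auto
  show "E a\<^sub>2 c"
  proof (rule ccontr)
    assume not_E: "\<not> E a\<^sub>2 c"
    have "o_heavy_pair G a\<^sub>1 c \<or> o_heavy_pair G a\<^sub>2 c"
      using E_triangle[OF net] light_arm_E_pendant[OF net light(1)] third_pendant exit(1) arm_adj
        not_E not_adj not_adj_third
        not_adj_pendant E_imp_F F_sym
      by (intro wounded_o_heavy_pair[of a\<^sub>3 a\<^sub>1 a\<^sub>2 b\<^sub>3 x c]) blast+
    then have "o_heavy_pair G a\<^sub>2 c"
      using o_heavy_pair_adj arm_adj(3) by blast
    then show False
      using heavy_armI[OF adj(4) exit(2)] light(2) by blast
  qed
qed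

lemma light_arms_no_exit:
  assumes "light_net a\<^sub>1 x a\<^sub>2 b\<^sub>2 a\<^sub>3 b\<^sub>3" and light: "\<not> heavy_arm a\<^sub>1 a\<^sub>2" "\<not> heavy_arm a\<^sub>2 a\<^sub>1"
    and exit: "E x c" "\<not> F a\<^sub>1 c" "c \<noteq> a\<^sub>1"
  shows "\<not> F a\<^sub>2 c"
proof
  assume "F a\<^sub>2 c"
  then have exit_in_arm: "c \<in> arm a\<^sub>2 a\<^sub>1"
    using exit unfolding arm_def by blast
  obtain c\<^sub>2 c\<^sub>3 where pendants: "E a\<^sub>2 c\<^sub>2" "E a\<^sub>3 c\<^sub>3" and net: "light_net a\<^sub>1 x a\<^sub>2 c\<^sub>2 a\<^sub>3 c\<^sub>3"
    using light_net_E_pendants[OF assms(1)] .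
  note net' = light_net_swap12[OF net]
  note adj = light_net_adj[OF net] and not_adj = light_net_not_adj[OF net]
    and distinct = light_net_distinct[OF net] and triangle = E_triangle[OF net]
  have exit_E: "E a\<^sub>2 c" "\<not> F c c\<^sub>3"
    using light_arms_exit_E[OF net light pendants(2) exit(1) exit_in_arm] .
  have not_adj_third: "\<not> F a\<^sub>3 c" "\<not> F c a\<^sub>3" "c \<noteq> a\<^sub>3"
    using armD[of c a\<^sub>2 a\<^sub>3] exit_in_arm light_net_arm_eq(2)[OF net] by auto
  have "c \<noteq> c\<^sub>2"
    using exit(1) E_imp_F not_adj by blast
  then have "E c\<^sub>2 c \<or> o_heavy_pair G c\<^sub>2 c"
    using claw_nonadjacent_leaf[of a\<^sub>2 a\<^sub>1 c\<^sub>2 c] triangle exit_E(1) exit(2,3) pendants not_adj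
      distinct
    by auto
  moreover have "\<not> o_heavy_pair G c\<^sub>2 c"
    using light_arm_no_o_heavy_pair[OF adj(4) light(2)
        light_net_pendant_in_arm(1)[OF net'] exit_in_arm]
      light_arm_pendant_deg[OF net' light(2)] by blast
  ultimately have "E c\<^sub>2 c" by blast
  then show False
    using triangle pendants exit exit_E not_adj_third not_adj E_sym F_sym E_imp_F
    by (intro no_wounded[of c a\<^sub>2 c\<^sub>2 x a\<^sub>3 c\<^sub>3]) blast+
qed

lemma arm_exit_exists:
  assumes net: "light_net a\<^sub>1 b\<^sub>1 a\<^sub>2 b\<^sub>2 a\<^sub>3 b\<^sub>3"
  shows "\<exists>x\<in>arm a\<^sub>1 a\<^sub>2. \<exists>w. F x w \<and> \<not> F a\<^sub>1 w \<and> w \<noteq> a\<^sub>1"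
proof (rule ccontr)
  assume no_exit: "\<not> ?thesis"
  note adj = light_net_adj[OF net]
  have "arm a\<^sub>1 a\<^sub>2 = pverts G - {a\<^sub>1}"
  proof (rule G.two_connected_closed_set[OF two_connected_G])
    show "a\<^sub>1 \<in> pverts G"
      using H.in_arcsD1[OF adj(1)] by (simp add: pverts_H)
    show "arm a\<^sub>1 a\<^sub>2 \<subseteq> pverts G - {a\<^sub>1}"
      using H.in_arcsD2 H.no_loops' by (fastforce simp: arm_def pverts_H[symmetric])
    show "arm a\<^sub>1 a\<^sub>2 \<noteq> {}"
      using light_net_pendant_in_arm(1)[OF net] by blast
    show "y \<in> arm a\<^sub>1 a\<^sub>2" if "x \<in> arm a\<^sub>1 a\<^sub>2" "E x y" "y \<noteq> a\<^sub>1" for x y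
      using arm_neighbour[OF adj(1) that(1)] that no_exit E_imp_F by blast
  qed
  moreover have "a\<^sub>2 \<in> pverts G - {a\<^sub>1}"
    using H.in_arcsD2[OF adj(1)] H.no_loops'[OF adj(1)] by (simp add: pverts_H)
  ultimately show False
    unfolding arm_def by blast
qed

lemma light_arms_pendant_simplicial:
  assumes net: "light_net a\<^sub>1 b\<^sub>1 a\<^sub>2 b\<^sub>2 a\<^sub>3 b\<^sub>3"
    and light: "\<not> heavy_arm a\<^sub>1 a\<^sub>2" "\<not> heavy_arm a\<^sub>2 a\<^sub>1" "\<not> heavy_arm a\<^sub>3 a\<^sub>1"
    and nbr: "F b\<^sub>1 w" "w \<noteq> a\<^sub>1"
  shows "F a\<^sub>1 w"
proof (rule ccontr)
  assume "\<not> F a\<^sub>1 w"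
  then obtain c where exit: "E b\<^sub>1 c" "\<not> F a\<^sub>1 c" "c \<noteq> a\<^sub>1"
    using arm_exit_first_step[OF light_net_pendant_in_arm(1)[OF net]] nbr by metis
  have "\<not> F a\<^sub>2 c"
    by (rule light_arms_no_exit[OF net light(1,2) exit])
  moreover have "\<not> F a\<^sub>3 c"
    by (rule light_arms_no_exit[OF light_net_swap23[OF net] _ light(3) exit])
      (use light(1) light_net_heavy_arm_iff[OF net] in simp)
  ultimately show False
    using light_arm_exit[OF net light(1) exit] by blast
qed

lemma some_heavy_arm:
  assumes net: "light_net a\<^sub>1 b\<^sub>1 a\<^sub>2 b\<^sub>2 a\<^sub>3 b\<^sub>3"
  shows "heavy_arm a\<^sub>1 a\<^sub>2 \<or> heavy_arm a\<^sub>2 a\<^sub>1 \<or> heavy_arm a\<^sub>3 a\<^sub>1"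
proof (rule ccontr)
  assume "\<not> ?thesis"
  then have light: "\<not> heavy_arm a\<^sub>1 a\<^sub>2" "\<not> heavy_arm a\<^sub>2 a\<^sub>1" "\<not> heavy_arm a\<^sub>3 a\<^sub>1" by auto
  note heavy_iff = light_net_heavy_arm_iff[OF net]
  obtain x w where exit: "x \<in> arm a\<^sub>1 a\<^sub>2" "F x w" "\<not> F a\<^sub>1 w" "w \<noteq> a\<^sub>1"
    using arm_exit_exists[OF net] by blast
  have not_adj: "\<not> F a\<^sub>2 x" "x \<noteq> a\<^sub>2" "\<not> F a\<^sub>3 x" "x \<noteq> a\<^sub>3"
    using armD[of x a\<^sub>1 a\<^sub>2] armD[of x a\<^sub>1 a\<^sub>3] exit(1) light_net_arm_eq(1)[OF net] by auto
  have "\<not> F x b\<^sub>2"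
    using light_arms_pendant_simplicial[OF light_net_swap12[OF net], of x] light heavy_iff not_adj
      F_sym
    by auto
  moreover have "\<not> F x b\<^sub>3"
    using light_arms_pendant_simplicial[OF light_net_rotate[OF light_net_rotate[OF net]], of x]
      light heavy_iff not_adj F_sym by auto
  ultimately have "light_net a\<^sub>1 x a\<^sub>2 b\<^sub>2 a\<^sub>3 b\<^sub>3"
    using light_net_replace_pendant[OF net] exit by blast
  then show False
    using light_arms_pendant_simplicial light exit by blast
qed

section \<open>Nets with a heavy arm\<close>

definition heavy_net :: "'a \<Rightarrow> 'a \<Rightarrow> 'a \<Rightarrow> 'a \<Rightarrow> 'a \<Rightarrow> 'a \<Rightarrow> bool" where
  "heavy_net a\<^sub>1 b\<^sub>1 a\<^sub>2 b\<^sub>2 a\<^sub>3 b\<^sub>3 \<longleftrightarrow> light_net a\<^sub>1 b\<^sub>1 a\<^sub>2 b\<^sub>2 a\<^sub>3 b\<^sub>3 \<and> heavy_arm a\<^sub>1 a\<^sub>2"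

lemma heavy_net_swap: "heavy_net a\<^sub>1 b\<^sub>1 a\<^sub>2 b\<^sub>2 a\<^sub>3 b\<^sub>3 \<Longrightarrow> heavy_net a\<^sub>1 b\<^sub>1 a\<^sub>3 b\<^sub>3 a\<^sub>2 b\<^sub>2"
  unfolding heavy_net_def using light_net_swap23 light_net_heavy_arm_iff(1) by blast

lemma heavy_net_light_net: "heavy_net a\<^sub>1 b\<^sub>1 a\<^sub>2 b\<^sub>2 a\<^sub>3 b\<^sub>3 \<Longrightarrow> light_net a\<^sub>1 b\<^sub>1 a\<^sub>2 b\<^sub>2 a\<^sub>3 b\<^sub>3"
  by (simp add: heavy_net_def)

lemma heavy_net_light_arms:
  assumes "heavy_net a\<^sub>1 b\<^sub>1 a\<^sub>2 b\<^sub>2 a\<^sub>3 b\<^sub>3"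
  shows "\<not> heavy_arm a\<^sub>2 a\<^sub>1" "\<not> heavy_arm a\<^sub>3 a\<^sub>1" "\<not> heavy_arm a\<^sub>2 a\<^sub>3" "\<not> heavy_arm a\<^sub>3 a\<^sub>2"
  using assms heavy_net_swap[OF assms] heavy_arm_unique
    light_net_heavy_arm_iff[OF heavy_net_light_net[OF assms]]
  unfolding heavy_net_def by blast+

lemma heavy_net_E_pendant:
  assumes "heavy_net a\<^sub>1 b\<^sub>1 a\<^sub>2 b\<^sub>2 a\<^sub>3 b\<^sub>3"
  shows "E a\<^sub>2 b\<^sub>2"
  using light_arm_E_pendant[OF light_net_swap12[OF heavy_net_light_net[OF assms]]]
    heavy_net_light_arms(1)[OF assms] .

lemma heavy_net_pendant_deg:
  assumes "heavy_net a\<^sub>1 b\<^sub>1 a\<^sub>2 b\<^sub>2 a\<^sub>3 b\<^sub>3"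
  shows "deg G b\<^sub>2 \<le> deg H a\<^sub>2"
  using light_arm_pendant_deg[OF light_net_swap12[OF heavy_net_light_net[OF assms]]]
    heavy_net_light_arms(1)[OF assms] .

lemma heavy_net_exit:
  assumes net: "heavy_net a\<^sub>1 b\<^sub>1 a\<^sub>2 b\<^sub>2 a\<^sub>3 b\<^sub>3" and exit: "F b\<^sub>2 w" "\<not> F a\<^sub>2 w" "w \<noteq> a\<^sub>2"
  shows "F a\<^sub>1 w" "E b\<^sub>2 w"
proof -
  note light = heavy_net_light_arms[OF net]
  note net' = light_net_swap12[OF heavy_net_light_net[OF net]]
  note in_arm = light_net_pendant_in_arm(1)[OF net']
  obtain c where first_step: "E b\<^sub>2 c" "\<not> F a\<^sub>2 c" "c \<noteq> a\<^sub>2" "c = w \<or> simplicial H c \<and> F b\<^sub>2 c \<and> F w c"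
    using arm_exit_first_step[OF in_arm exit] .
  have "\<not> F a\<^sub>3 c"
    using light_arms_no_exit[OF light_net_swap23[OF net'] light(3,4) first_step(1-3)] .
  then have a1_adj: "F a\<^sub>1 c"
    using light_arm_exit[OF net' light(1) first_step(1-3)] by blast
  have "c = w"
    using first_step(4) simplicialD[of H c a\<^sub>1 b\<^sub>2] a1_adj armD[OF in_arm] F_sym by blast
  then show "F a\<^sub>1 w" "E b\<^sub>2 w"
    using a1_adj first_step(1) by simp_all
qed

lemma heavy_net_replace_pendants:
  assumes net: "heavy_net a\<^sub>1 b\<^sub>1 a\<^sub>2 b\<^sub>2 a\<^sub>3 b\<^sub>3"
    and new_pendants: "x \<in> arm a\<^sub>2 a\<^sub>1" "y \<in> arm a\<^sub>3 a\<^sub>1" "\<not> F x y"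
  shows "\<exists>z. heavy_net a\<^sub>1 z a\<^sub>2 x a\<^sub>3 y"
proof -
  note light_net = heavy_net_light_net[OF net]
  note adj = light_net_adj[OF light_net] and arms = light_net_arm_eq[OF light_net]
  note x_adj = armD[OF new_pendants(1)] armD[OF new_pendants(1)[folded arms(2)]]
    and y_adj = armD[OF new_pendants(2)] armD[OF new_pendants(2)[folded arms(3)]]
  let ?X = "{z \<in> arm a\<^sub>1 a\<^sub>2. F x z}" and ?Y = "{z \<in> arm a\<^sub>1 a\<^sub>2. F y z}"
  have "card ?X \<le> 1" "card ?Y \<le> 1"
    using card_arm_neighbours_le_1[OF adj(1)] x_adj y_adj by auto
  then have "card (?X \<union> ?Y) < card (arm a\<^sub>1 a\<^sub>2)"
    using card_Un_le[of ?X ?Y] net unfolding heavy_net_def heavy_arm_def by linarith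
  then have "\<not> arm a\<^sub>1 a\<^sub>2 \<subseteq> ?X \<union> ?Y"
    using card_mono[of "?X \<union> ?Y" "arm a\<^sub>1 a\<^sub>2"] by auto
  then obtain z where free: "z \<in> arm a\<^sub>1 a\<^sub>2" "\<not> F x z" "\<not> F y z"
    by blast
  have "light_net a\<^sub>1 z a\<^sub>2 x a\<^sub>3 y"
    using free adj x_adj y_adj new_pendants(3) armD[OF free(1)] armD[OF free(1)[folded arms(1)]]
      light_net_deg_sum[OF light_net]
      F_sym
    unfolding light_net_def is_net_def by auto
  then show ?thesis
    using net unfolding heavy_net_def by blast
qed

lemma heavy_net_adjacent_light_arms:
  assumes net: "heavy_net a\<^sub>1 b\<^sub>1 a\<^sub>2 b\<^sub>2 a\<^sub>3 b\<^sub>3"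
    and in_arms: "x \<in> arm a\<^sub>2 a\<^sub>1" "y \<in> arm a\<^sub>3 a\<^sub>1" and edge: "F x y"
  shows "F x b\<^sub>3" "y = b\<^sub>3"
proof -
  note light_net = heavy_net_light_net[OF net]
  note adj = light_net_adj[OF light_net] and arms = light_net_arm_eq[OF light_net]
    and pendant_in_arm = light_net_pendant_in_arm(3)[OF light_net]
  note x_adj = armD[OF in_arms(1)] armD[OF in_arms(1)[folded arms(2)]]
    and y_adj = armD[OF in_arms(2)] armD[OF in_arms(2)[folded arms(3)]]
  show adjacent: "F x b\<^sub>3"
  proof (rule ccontr)
    assume "\<not> F x b\<^sub>3"
    then obtain z where "heavy_net a\<^sub>1 z a\<^sub>2 x a\<^sub>3 b\<^sub>3"
      using heavy_net_replace_pendants[OF net in_arms(1) pendant_in_arm] by blast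
    then have "F a\<^sub>1 y"
      using heavy_net_exit(1) edge y_adj by blast
    then show False
      using y_adj by blast
  qed
  show "y = b\<^sub>3"
    using arm_unique[OF adj(5) in_arms(2) pendant_in_arm edge adjacent] x_adj by blast
qed

lemma heavy_net_light_arms_nonadjacent:
  assumes net: "heavy_net a\<^sub>1 b\<^sub>1 a\<^sub>2 b\<^sub>2 a\<^sub>3 b\<^sub>3" and in_arms: "x \<in> arm a\<^sub>2 a\<^sub>1" "y \<in> arm a\<^sub>3 a\<^sub>1"
  shows "\<not> F x y"
proof
  assume "F x y"
  then have "F x b\<^sub>3" "x = b\<^sub>2"
    using heavy_net_adjacent_light_arms(1)[OF net in_arms]
      heavy_net_adjacent_light_arms(2)[OF heavy_net_swap[OF net] in_arms(2,1)] F_sym by blast+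
  then show False
    using light_net_not_adj[OF heavy_net_light_net[OF net]] by blast
qed

lemma heavy_net_replace_pendant:
  assumes net: "heavy_net a\<^sub>1 b\<^sub>1 a\<^sub>2 b\<^sub>2 a\<^sub>3 b\<^sub>3" and "x \<in> arm a\<^sub>2 a\<^sub>1"
  shows "\<exists>z. heavy_net a\<^sub>1 z a\<^sub>2 x a\<^sub>3 b\<^sub>3"
proof -
  have "b\<^sub>3 \<in> arm a\<^sub>3 a\<^sub>1"
    using light_net_pendant_in_arm(3)[OF heavy_net_light_net[OF net]] .
  then show ?thesis
    using heavy_net_replace_pendants[OF net assms(2)]
      heavy_net_light_arms_nonadjacent[OF net assms(2)]
    by blast
qed

lemma heavy_net_exit_unique_in_arm:
  assumes net: "heavy_net a\<^sub>1 b\<^sub>1 a\<^sub>2 b\<^sub>2 a\<^sub>3 b\<^sub>3" and exit: "F b\<^sub>2 w" "\<not> F a\<^sub>2 w" "w \<noteq> a\<^sub>2"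
    and in_arm: "u \<in> arm a\<^sub>2 a\<^sub>1"
  shows "u = b\<^sub>2"
proof (rule ccontr)
  assume "u \<noteq> b\<^sub>2"
  note light_net = heavy_net_light_net[OF net]
  note adj = light_net_adj[OF light_net] and not_adj = light_net_not_adj[OF light_net]
    and distinct = light_net_distinct[OF light_net] and triangle = E_triangle[OF light_net]
  have pendant_in_arm: "b\<^sub>2 \<in> arm a\<^sub>2 a\<^sub>1"
    using light_net_pendant_in_arm(2)[OF light_net] .
  obtain z where net_u: "heavy_net a\<^sub>1 z a\<^sub>2 u a\<^sub>3 b\<^sub>3"
    using heavy_net_replace_pendant[OF net in_arm] by blast
  note not_adj_u = light_net_not_adj[OF heavy_net_light_net[OF net_u]]
    and distinct_u = light_net_distinct[OF heavy_net_light_net[OF net_u]]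
  have pendants: "E a\<^sub>2 b\<^sub>2" "E a\<^sub>2 u" "E a\<^sub>3 b\<^sub>3"
    using heavy_net_E_pendant net net_u heavy_net_swap[OF net] by blast+
  have "\<not> o_heavy_pair G b\<^sub>2 u"
    using light_arm_no_o_heavy_pair[OF adj(4) heavy_net_light_arms(1)[OF net] pendant_in_arm in_arm
        heavy_net_pendant_deg[OF net]] .
  then have E_pendant: "E b\<^sub>2 u"
    using claw_nonadjacent_leaf[of a\<^sub>2 a\<^sub>3 b\<^sub>2 u] triangle pendants not_adj not_adj_u distinct
      distinct_u \<open>u \<noteq> b\<^sub>2\<close> by auto
  have exit_adj: "F a\<^sub>1 w" "E b\<^sub>2 w"
    using heavy_net_exit[OF net exit] .
  have "\<not> F a\<^sub>3 w"
    using F_trans[of a\<^sub>1 a\<^sub>2 a\<^sub>3 w] adj exit_adj exit(2,3) by blast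
  moreover have "\<not> F u w"
    using F_trans[of b\<^sub>2 a\<^sub>2 u w] adj exit armD(2)[OF in_arm] E_pendant E_imp_F F_sym by blast
  moreover have "\<not> F w b\<^sub>3"
    using F_claw[of w b\<^sub>2 a\<^sub>1 b\<^sub>3] F_sym[OF exit(1)] F_sym[OF exit_adj(1)] not_adj distinct by auto
  ultimately show False
    using E_pendant pendants E_sym[OF pendants(1)] exit_adj exit triangle not_adj not_adj_u F_sym
    by (intro no_wounded[of b\<^sub>2 a\<^sub>2 u w a\<^sub>3 b\<^sub>3]) blast+
qed

lemma heavy_net_light_arm_eq:
  assumes net: "heavy_net a\<^sub>1 b\<^sub>1 a\<^sub>2 b\<^sub>2 a\<^sub>3 b\<^sub>3"
  shows "arm a\<^sub>2 a\<^sub>1 = {b\<^sub>2}" "\<exists>w. F b\<^sub>2 w \<and> \<not> F a\<^sub>2 w \<and> w \<noteq> a\<^sub>2"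
proof -
  note net' = light_net_swap12[OF heavy_net_light_net[OF net]]
  obtain x w where in_arm: "x \<in> arm a\<^sub>2 a\<^sub>1" and exit: "F x w" "\<not> F a\<^sub>2 w" "w \<noteq> a\<^sub>2"
    using arm_exit_exists[OF net'] by blast
  obtain z where "heavy_net a\<^sub>1 z a\<^sub>2 x a\<^sub>3 b\<^sub>3"
    using heavy_net_replace_pendant[OF net in_arm] by blast
  then have "u = x" if "u \<in> arm a\<^sub>2 a\<^sub>1" for u
    using heavy_net_exit_unique_in_arm exit that by blast
  moreover have "b\<^sub>2 \<in> arm a\<^sub>2 a\<^sub>1"
    by (rule light_net_pendant_in_arm(1)[OF net'])
  ultimately show "arm a\<^sub>2 a\<^sub>1 = {b\<^sub>2}" "\<exists>w. F b\<^sub>2 w \<and> \<not> F a\<^sub>2 w \<and> w \<noteq> a\<^sub>2"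
    using exit by blast+
qed

lemma heavy_net_anchor:
  assumes net: "heavy_net a\<^sub>1 b\<^sub>1 a\<^sub>2 b\<^sub>2 a\<^sub>3 b\<^sub>3"
  shows "\<exists>c\<in>arm a\<^sub>1 a\<^sub>2. nbhd H b\<^sub>2 = {a\<^sub>2, c} \<and> E b\<^sub>2 c"
proof -
  note light_net = heavy_net_light_net[OF net]
  note adj = light_net_adj[OF light_net] and not_adj = light_net_not_adj[OF light_net]
    and distinct = light_net_distinct[OF light_net]
  obtain c where anchor: "F b\<^sub>2 c" "\<not> F a\<^sub>2 c" "c \<noteq> a\<^sub>2"
    using heavy_net_light_arm_eq(2)[OF net] by blast
  have exit_in_arm: "w \<in> arm a\<^sub>1 a\<^sub>2" if "F b\<^sub>2 w" "\<not> F a\<^sub>2 w" "w \<noteq> a\<^sub>2" for w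
    using heavy_net_exit(1)[OF net that] that(2,3) unfolding arm_def by blast
  have "w = c" if nbr: "F b\<^sub>2 w" "w \<noteq> a\<^sub>2" for w
  proof -
    have "\<not> F a\<^sub>2 w"
      using arm_neighbour[OF adj(4), of b\<^sub>2 w] heavy_net_light_arm_eq(1)[OF net] nbr H.not_adj_self
      by auto
    then show ?thesis
      using arm_unique[OF adj(1) exit_in_arm exit_in_arm] nbr anchor not_adj(1) distinct by auto
  qed
  then have "nbhd H b\<^sub>2 = {a\<^sub>2, c}"
    using anchor(1) adj(11) by (auto simp: in_nbhd_iff)
  then show ?thesis
    using exit_in_arm[OF anchor] heavy_net_exit(2)[OF net anchor] by blast
qed

end

locale anchored_heavy_net = wounded_heavy_closure +
  fixes a\<^sub>1 b\<^sub>1 a\<^sub>2 b\<^sub>2 c\<^sub>2 a\<^sub>3 b\<^sub>3 c\<^sub>3 :: 'a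
  assumes heavy_net: "heavy_net a\<^sub>1 b\<^sub>1 a\<^sub>2 b\<^sub>2 a\<^sub>3 b\<^sub>3"
    and anchor_in_arm: "c\<^sub>2 \<in> arm a\<^sub>1 a\<^sub>2" "c\<^sub>3 \<in> arm a\<^sub>1 a\<^sub>3"
    and nbhd_pendant: "nbhd H b\<^sub>2 = {a\<^sub>2, c\<^sub>2}" "nbhd H b\<^sub>3 = {a\<^sub>3, c\<^sub>3}"
    and E_anchor: "E b\<^sub>2 c\<^sub>2" "E b\<^sub>3 c\<^sub>3"
begin

lemma anchored_heavy_net_swap: "anchored_heavy_net G H a\<^sub>1 b\<^sub>1 a\<^sub>3 b\<^sub>3 c\<^sub>3 a\<^sub>2 b\<^sub>2 c\<^sub>2"
  using heavy_net_swap[OF heavy_net] anchor_in_arm nbhd_pendant E_anchor by unfold_locales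

lemmas light_net = heavy_net_light_net[OF heavy_net]
lemmas net_adj = light_net_adj[OF light_net]
lemmas net_not_adj = light_net_not_adj[OF light_net]
lemmas net_distinct = light_net_distinct[OF light_net]
lemmas net_arm_eq = light_net_arm_eq[OF light_net]
lemmas net_triangle = E_triangle[OF light_net]
lemmas anchor_adj = armD[OF anchor_in_arm(1)]

lemma E_light_pendants: "E a\<^sub>2 b\<^sub>2" "E a\<^sub>3 b\<^sub>3"
  using heavy_net_E_pendant heavy_net heavy_net_swap[OF heavy_net] by blast+

lemma anchor_not_adj: "\<not> F a\<^sub>3 c\<^sub>2" "\<not> F c\<^sub>2 a\<^sub>3" "c\<^sub>2 \<noteq> a\<^sub>3" "\<not> F b\<^sub>3 c\<^sub>2" "\<not> F c\<^sub>2 b\<^sub>3"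
proof -
  show "\<not> F a\<^sub>3 c\<^sub>2" "\<not> F c\<^sub>2 a\<^sub>3" "c\<^sub>2 \<noteq> a\<^sub>3"
    using armD[of c\<^sub>2 a\<^sub>1 a\<^sub>3] anchor_in_arm(1) net_arm_eq(1) by auto
  show "\<not> F b\<^sub>3 c\<^sub>2"
    using F_claw[of c\<^sub>2 a\<^sub>1 b\<^sub>2 b\<^sub>3] anchor_adj(2) E_imp_F[OF E_anchor(1)] net_not_adj net_distinct
      F_sym
    by auto
  then show "\<not> F c\<^sub>2 b\<^sub>3"
    using F_sym by blast
qed

lemma arm_not_adj_triangle_clique:
  assumes "F a\<^sub>1 y" "F a\<^sub>2 y" "z \<in> arm a\<^sub>1 a\<^sub>2"
  shows "\<not> F z y" "z \<noteq> y"
  using arm_neighbour[OF net_adj(1) assms(3,1)] armD[OF assms(3)] assms(2) unfolding arm_def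
    by blast+

lemma triangle_clique_deg_sum:
  assumes "F a\<^sub>1 y" "F a\<^sub>2 y"
  shows "deg H y + deg H a\<^sub>2 < n" "deg H y + deg H a\<^sub>3 < n"
proof -
  obtain c where heavy_vertex: "c \<in> arm a\<^sub>1 a\<^sub>2" "n \<le> deg H a\<^sub>1 + deg H c"
    using heavy_net unfolding heavy_net_def heavy_arm_def by blast
  have "deg H c + deg H y < n"
    using deg_sum_less_if_not_adj arm_not_adj_triangle_clique[OF assms heavy_vertex(1)]
      armD(1)[OF heavy_vertex(1)] assms(1)
      H.in_arcsD2 by blast
  then show "deg H y + deg H a\<^sub>2 < n" "deg H y + deg H a\<^sub>3 < n"
    using heavy_vertex(2) light_net_deg_sum[OF light_net] by linarith+
qed

lemma triangle_clique_not_E_adj: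
  assumes in_clique: "F a\<^sub>1 y" "F a\<^sub>2 y" "y \<noteq> a\<^sub>3"
  shows "\<not> E a\<^sub>2 y"
proof
  assume E_adj: "E a\<^sub>2 y"
  have third_adj: "F a\<^sub>3 y"
    using F_trans[of a\<^sub>1 a\<^sub>3 a\<^sub>2 y] net_adj in_clique by blast
  note in_arms = light_net_pendant_in_arm[OF light_net]
  have pendants: "\<not> F b\<^sub>2 y" "b\<^sub>2 \<noteq> y" "\<not> F b\<^sub>3 y"
    using arm_neighbour[OF net_adj(4) in_arms(2) in_clique(2)]
      arm_neighbour[OF net_adj(5) in_arms(3) third_adj] in_clique(1) net_not_adj
    unfolding arm_def by blast+
  then have "E y a\<^sub>3 \<or> o_heavy_pair G y a\<^sub>3"
    using claw_nonadjacent_leaf[of a\<^sub>2 b\<^sub>2 y a\<^sub>3] E_light_pendants E_adj net_triangle net_not_adj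
      net_distinct in_clique(3) by auto
  then have "E a\<^sub>3 y"
    using o_heavy_pair_deg_sum[of y a\<^sub>3] triangle_clique_deg_sum(2)[OF in_clique(1,2)] E_sym
    by fastforce
  moreover have "\<not> F y c\<^sub>2"
    using arm_not_adj_triangle_clique[OF in_clique(1,2) anchor_in_arm(1)] F_sym by blast
  ultimately show False
    using net_triangle E_adj E_light_pendants E_anchor net_not_adj anchor_adj anchor_not_adj
      pendants F_sym
    by (intro no_wounded[of a\<^sub>3 a\<^sub>2 y b\<^sub>3 b\<^sub>2 c\<^sub>2]) blast+
qed

lemma triangle_clique:
  assumes in_clique: "F a\<^sub>1 x" "F a\<^sub>2 x"
  shows "x = a\<^sub>3"
proof (rule ccontr)
  assume "x \<noteq> a\<^sub>3"
  obtain y where first_step: "E a\<^sub>1 y" "y = x \<or> simplicial H y \<and> F a\<^sub>1 y \<and> F x y"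
    using link_path_first_step[OF in_clique(1)] .
  have "y = x \<or> y \<noteq> a\<^sub>2 \<and> y \<noteq> a\<^sub>3"
    using first_step(2) simplicialD[of H a\<^sub>2 a\<^sub>1 b\<^sub>2] simplicialD[of H a\<^sub>3 a\<^sub>1 b\<^sub>3] net_adj net_not_adj
      net_distinct
    by auto
  then have step_in_clique: "F a\<^sub>1 y" "F a\<^sub>2 y" "y \<noteq> a\<^sub>3"
    using F_trans[of a\<^sub>1 a\<^sub>2 x y] first_step in_clique net_adj \<open>x \<noteq> a\<^sub>3\<close> F_sym E_imp_F by blast+
  obtain z where pendant: "E a\<^sub>1 z" "light_net a\<^sub>1 z a\<^sub>2 b\<^sub>2 a\<^sub>3 b\<^sub>3"
    using light_net_E_pendant[OF light_net] .
  have "\<not> F z y" "z \<noteq> y"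
    using arm_not_adj_triangle_clique[OF step_in_clique(1,2)
        light_net_pendant_in_arm(1)[OF pendant(2)]] .
  then have "E a\<^sub>2 y \<or> o_heavy_pair G a\<^sub>2 y"
    using claw_nonadjacent_leaf[of a\<^sub>1 z a\<^sub>2 y] pendant(1) net_triangle first_step(1)
      light_net_not_adj[OF pendant(2)]
      light_net_distinct[OF pendant(2)] H.no_loops'[OF step_in_clique(2)] by auto
  then show False
    using triangle_clique_not_E_adj[OF step_in_clique] o_heavy_pair_deg_sum[of a\<^sub>2 y]
      triangle_clique_deg_sum(1)[OF step_in_clique(1,2)] by linarith
qed

lemma light_arm_degs: "deg H a\<^sub>2 = 3" "deg H b\<^sub>2 = 2"
proof -
  have "nbhd H a\<^sub>2 \<subseteq> {a\<^sub>1, a\<^sub>3, b\<^sub>2}"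
    using triangle_clique heavy_net_light_arm_eq(1)[OF heavy_net] unfolding arm_def nbhd_def
    by blast
  then have "nbhd H a\<^sub>2 = {a\<^sub>1, a\<^sub>3, b\<^sub>2}"
    using net_adj by (auto simp: in_nbhd_iff)
  then show "deg H a\<^sub>2 = 3"
    using net_distinct by (auto simp: deg_def)
  show "deg H b\<^sub>2 = 2"
    using anchor_adj(5) by (simp add: deg_def nbhd_pendant)
qed

abbreviation m :: nat where "m \<equiv> card (arm a\<^sub>1 a\<^sub>2)"

lemma deg_heavy_vertex: "deg H a\<^sub>1 \<le> m + 2"
proof -
  have "nbhd H a\<^sub>1 \<subseteq> arm a\<^sub>1 a\<^sub>2 \<union> {a\<^sub>2, a\<^sub>3}"
    using triangle_clique unfolding arm_def nbhd_def by blast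
  then have "deg H a\<^sub>1 \<le> card (arm a\<^sub>1 a\<^sub>2 \<union> {a\<^sub>2, a\<^sub>3})"
    unfolding deg_def by (rule card_mono[rotated]) simp
  also have "\<dots> \<le> m + 2"
    using card_Un_le[of "arm a\<^sub>1 a\<^sub>2" "{a\<^sub>2, a\<^sub>3}"] net_distinct by simp
  finally show ?thesis .
qed

lemma deg_anchor: "deg H c\<^sub>2 \<le> m + 1"
proof -
  have "nbhd H c\<^sub>2 \<subseteq> insert b\<^sub>2 (insert a\<^sub>1 (arm a\<^sub>1 a\<^sub>2 - {c\<^sub>2}))"
  proof
    fix u
    assume "u \<in> nbhd H c\<^sub>2"
    then have nbr: "F c\<^sub>2 u" "u \<noteq> c\<^sub>2"
      using H.no_loops' by (auto simp: in_nbhd_iff)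
    have "F a\<^sub>1 u \<or> F b\<^sub>2 u \<or> u = a\<^sub>1 \<or> u = b\<^sub>2"
      using F_claw[of c\<^sub>2 a\<^sub>1 b\<^sub>2 u] nbr(1) anchor_adj E_imp_F[OF E_anchor(1)] F_sym net_not_adj
        net_distinct
      by auto
    moreover have "u = a\<^sub>2 \<or> u = c\<^sub>2" if "F b\<^sub>2 u"
      using nbhd_pendant(1) that in_nbhd_iff[of u H b\<^sub>2] by blast
    ultimately show "u \<in> insert b\<^sub>2 (insert a\<^sub>1 (arm a\<^sub>1 a\<^sub>2 - {c\<^sub>2}))"
      using arm_neighbour[OF net_adj(1) anchor_in_arm(1) _ nbr(1)] nbr anchor_adj by blast
  qed
  then have "deg H c\<^sub>2 \<le> card (insert b\<^sub>2 (insert a\<^sub>1 (arm a\<^sub>1 a\<^sub>2 - {c\<^sub>2})))"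
    unfolding deg_def by (rule card_mono[rotated]) simp
  also have "\<dots> \<le> m + 1"
    using card_insert_le_m1[of "m + 1" "insert a\<^sub>1 (arm a\<^sub>1 a\<^sub>2 - {c\<^sub>2})"]
      card_insert_arm_Diff[OF anchor_in_arm(1)] by simp
  finally show ?thesis .
qed

lemma deg_simplicial_arm:
  assumes simplicial: "t \<in> arm a\<^sub>1 a\<^sub>2" "simplicial H t"
  shows "deg H t \<le> m"
proof -
  have "nbhd H t \<subseteq> insert a\<^sub>1 (arm a\<^sub>1 a\<^sub>2 - {t})"
  proof
    fix u
    assume "u \<in> nbhd H t"
    then have nbr: "F t u" "u \<noteq> t"
      using H.no_loops' by (auto simp: in_nbhd_iff)
    then have "u = a\<^sub>1 \<or> F a\<^sub>1 u"
      using simplicialD[OF simplicial(2) armD(2)[OF simplicial(1)]] by blast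
    then show "u \<in> insert a\<^sub>1 (arm a\<^sub>1 a\<^sub>2 - {t})"
      using arm_neighbour[OF net_adj(1) simplicial(1) _ nbr(1)] nbr(2) by blast
  qed
  then have "deg H t \<le> card (insert a\<^sub>1 (arm a\<^sub>1 a\<^sub>2 - {t}))"
    unfolding deg_def by (rule card_mono[rotated]) simp
  then show ?thesis
    using card_insert_arm_Diff[OF simplicial(1)] by simp
qed

lemma small_arm_simplicial_light:
  assumes "2 * m < n" "t \<in> arm a\<^sub>1 a\<^sub>2" "simplicial H t"
  shows "\<not> o_heavy_pair G a\<^sub>1 t" "\<not> o_heavy_pair G c\<^sub>2 t"
  using o_heavy_pair_deg_sum[of a\<^sub>1 t] o_heavy_pair_deg_sum[of c\<^sub>2 t] deg_heavy_vertex deg_anchor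
    deg_simplicial_arm[OF assms(2,3)] assms(1) by linarith+

lemma no_E_triangle_on_anchor:
  assumes "E a\<^sub>1 c\<^sub>2" and pendant: "light_net a\<^sub>1 z a\<^sub>2 b\<^sub>2 a\<^sub>3 b\<^sub>3" "E a\<^sub>1 z"
  shows "\<not> E c\<^sub>2 z"
proof
  assume "E c\<^sub>2 z"
  then show False
    using assms(2,3) E_sym[OF assms(1)] net_triangle E_light_pendants E_sym[OF E_anchor(1)]
      light_net_not_adj[OF pendant(1)] anchor_not_adj
    by (intro no_wounded[of c\<^sub>2 a\<^sub>1 z b\<^sub>2 a\<^sub>3 b\<^sub>3]) blast+
qed

lemma small_arm_anchor_not_E_adj:
  assumes small: "2 * m < n"
  shows "\<not> E a\<^sub>1 c\<^sub>2"
proof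
  assume E_adj: "E a\<^sub>1 c\<^sub>2"
  obtain z where pendant: "E a\<^sub>1 z" "light_net a\<^sub>1 z a\<^sub>2 b\<^sub>2 a\<^sub>3 b\<^sub>3" "z = b\<^sub>1 \<or> simplicial H z"
    using light_net_E_pendant[OF light_net] .
  note pendant_in_arm = light_net_pendant_in_arm(1)[OF pendant(2)]
  have "c\<^sub>2 \<noteq> z"
    using E_anchor(1) E_imp_F light_net_not_adj[OF pendant(2)] by blast
  then have "o_heavy_pair G c\<^sub>2 z"
    using claw_nonadjacent_leaf[of a\<^sub>1 a\<^sub>3 c\<^sub>2 z] net_triangle E_adj pendant(1) anchor_not_adj
      light_net_not_adj[OF pendant(2)] light_net_distinct[OF pendant(2)]
        no_E_triangle_on_anchor[OF E_adj pendant(2,1)]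
    by auto
  then have heavy_pendant: "z = b\<^sub>1" "F c\<^sub>2 b\<^sub>1" "\<not> E c\<^sub>2 b\<^sub>1"
    using pendant(3) small_arm_simplicial_light(2)[OF small pendant_in_arm] o_heavy_pair_adj
      G.o_heavy_pair_not_adj
    by blast+
  obtain t where "E c\<^sub>2 t" "t = b\<^sub>1 \<or> simplicial H t \<and> F c\<^sub>2 t \<and> F b\<^sub>1 t"
    using link_path_first_step[OF heavy_pendant(2)] .
  then have simplicial: "E c\<^sub>2 t" "simplicial H t" "F c\<^sub>2 t" "F b\<^sub>1 t"
    using heavy_pendant(3) by blast+
  have "t \<noteq> a\<^sub>1"
    using simplicialD[of H a\<^sub>1 a\<^sub>2 b\<^sub>1] simplicial(2) net_adj net_not_adj net_distinct by auto
  then have in_arm: "t \<in> arm a\<^sub>1 a\<^sub>2"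
    using arm_common_neighbour[OF net_adj(1) _ _ \<open>c\<^sub>2 \<noteq> z\<close> simplicial(3)] anchor_in_arm(1)
      pendant_in_arm simplicial(4) heavy_pendant(1)
    by blast
  have net': "light_net a\<^sub>1 t a\<^sub>2 b\<^sub>2 a\<^sub>3 b\<^sub>3"
    using light_net_replace_simplicial[OF light_net simplicial(2) _ simplicial(4)]
      armD(1)[OF in_arm] by blast
  have "E a\<^sub>1 t \<or> o_heavy_pair G a\<^sub>1 t"
    using claw_nonadjacent_leaf[of c\<^sub>2 b\<^sub>2 a\<^sub>1 t] E_sym[OF E_anchor(1)] E_sym[OF E_adj] simplicial(1)
      light_net_not_adj[OF net'] light_net_distinct[OF net'] by auto
  then show False
    using small_arm_simplicial_light(1)[OF small in_arm simplicial(2)]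
      no_E_triangle_on_anchor[OF E_adj net'] simplicial(1)
    by blast
qed

text \<open>
  If the arm were small, the only o-heavy pairs of \<open>G\<close> among \<open>a\<^sub>1, c\<^sub>2, c\<^sub>3\<close> and the simplicial
    vertices
  of the arm could be \<open>{a\<^sub>1, c\<^sub>2}\<close> and \<open>{a\<^sub>1, c\<^sub>3}\<close>. The edge \<open>a\<^sub>1 c\<^sub>i\<close> would then yield a wounded graph,
  and without both edges \<open>a\<^sub>1\<close> has too small a degree in \<open>G\<close>.
\<close>

lemma arm_large: "n \<le> 2 * m"
proof (rule ccontr)
  assume "\<not> ?thesis"
  then have small: "2 * m < n" by simp
  interpret swapped: anchored_heavy_net G H a\<^sub>1 b\<^sub>1 a\<^sub>3 b\<^sub>3 c\<^sub>3 a\<^sub>2 b\<^sub>2 c\<^sub>2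
    by (rule anchored_heavy_net_swap)
  have not_E: "\<not> E a\<^sub>1 c\<^sub>2" "\<not> E a\<^sub>1 c\<^sub>3"
    using small_arm_anchor_not_E_adj swapped.small_arm_anchor_not_E_adj small net_arm_eq(1)
    by simp_all
  have "o_heavy_pair G a\<^sub>2 c\<^sub>2 \<or> o_heavy_pair G a\<^sub>1 c\<^sub>2"
    using net_triangle E_light_pendants E_anchor(1) net_not_adj anchor_adj anchor_not_adj E_imp_F
      not_E
    by (intro wounded_o_heavy_pair[of a\<^sub>3 a\<^sub>2 a\<^sub>1 b\<^sub>3 b\<^sub>2 c\<^sub>2]) blast+
  then have "n \<le> deg G a\<^sub>1 + deg G c\<^sub>2"
    using o_heavy_pair_adj anchor_adj by (auto simp: o_heavy_pair_def pverts_H)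
  moreover have "deg G c\<^sub>2 < deg H c\<^sub>2"
    using deg_G_less_deg_H anchor_adj(2) not_E(1) E_sym by blast
  moreover have "deg G a\<^sub>1 \<le> m"
  proof -
    have anchors: "c\<^sub>3 \<in> arm a\<^sub>1 a\<^sub>2" "c\<^sub>2 \<noteq> c\<^sub>3"
      using anchor_in_arm(2) net_arm_eq(1) anchor_not_adj(4) E_anchor(2) E_imp_F by auto
    have "nbhd G a\<^sub>1 \<subseteq> (arm a\<^sub>1 a\<^sub>2 - {c\<^sub>2, c\<^sub>3}) \<union> {a\<^sub>2, a\<^sub>3}"
      using triangle_clique not_E E_imp_F unfolding arm_def nbhd_def by blast
    then have "deg G a\<^sub>1 \<le> card ((arm a\<^sub>1 a\<^sub>2 - {c\<^sub>2, c\<^sub>3}) \<union> {a\<^sub>2, a\<^sub>3})"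
      unfolding deg_def by (rule card_mono[rotated]) simp
    also have "\<dots> \<le> card (arm a\<^sub>1 a\<^sub>2 - {c\<^sub>2, c\<^sub>3}) + 2"
      using card_Un_le[of "arm a\<^sub>1 a\<^sub>2 - {c\<^sub>2, c\<^sub>3}" "{a\<^sub>2, a\<^sub>3}"] net_distinct by simp
    also have "\<dots> = m"
      using card_mono[of "arm a\<^sub>1 a\<^sub>2" "{c\<^sub>2, c\<^sub>3}"] anchor_in_arm(1) anchors
      by (simp add: card_Diff_subset)
    finally show ?thesis .
  qed
  ultimately show False
    using deg_anchor small by linarith
qed

lemma heavy_if_in_arm:
  assumes "v \<in> insert a\<^sub>1 (arm a\<^sub>1 a\<^sub>2)"
  shows "heavy H v"
proof -
  have "m \<le> deg H a\<^sub>1"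
    unfolding deg_def by (rule card_mono) (auto simp: arm_def in_nbhd_iff)
  then have "m \<le> deg H v"
    using assms card_arm_le_deg[OF net_adj(1)] by blast
  moreover have "v \<in> pverts H"
    using assms armD(2) H.in_arcsD1 net_adj(1) by blast
  ultimately show ?thesis
    using arm_large unfolding heavy_def by linarith
qed

end

lemma (in wounded_heavy_closure) heavy_net_degs:
  assumes "heavy_net a\<^sub>1 b\<^sub>1 a\<^sub>2 b\<^sub>2 a\<^sub>3 b\<^sub>3"
  shows "heavy H a\<^sub>1" "heavy H b\<^sub>1" "deg H a\<^sub>2 = 3" "deg H b\<^sub>2 = 2" "\<forall>w\<in>nbhd H b\<^sub>2 - {a\<^sub>2}. heavy H w"
proof -
  obtain c\<^sub>2 where second: "c\<^sub>2 \<in> arm a\<^sub>1 a\<^sub>2" "nbhd H b\<^sub>2 = {a\<^sub>2, c\<^sub>2}" "E b\<^sub>2 c\<^sub>2"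
    using heavy_net_anchor[OF assms] by blast
  obtain c\<^sub>3 where third: "c\<^sub>3 \<in> arm a\<^sub>1 a\<^sub>3" "nbhd H b\<^sub>3 = {a\<^sub>3, c\<^sub>3}" "E b\<^sub>3 c\<^sub>3"
    using heavy_net_anchor[OF heavy_net_swap[OF assms]] by blast
  interpret anchored_heavy_net G H a\<^sub>1 b\<^sub>1 a\<^sub>2 b\<^sub>2 c\<^sub>2 a\<^sub>3 b\<^sub>3 c\<^sub>3
    by unfold_locales (fact assms second third)+
  show "heavy H a\<^sub>1" "heavy H b\<^sub>1" "\<forall>w\<in>nbhd H b\<^sub>2 - {a\<^sub>2}. heavy H w"
    using heavy_if_in_arm light_net_pendant_in_arm(1)[OF light_net] second by auto
  show "deg H a\<^sub>2 = 3" "deg H b\<^sub>2 = 2"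
    by (rule light_arm_degs)+
qed

lemma (in wounded_heavy_closure) q_heavy_net_if_heavy_net:
  assumes net: "heavy_net (f i) (f (i + 3)) (f j) (f (j + 3)) (f k) (f (k + 3))"
    and "{i, j, k} = {..<3}"
  shows "q_heavy_net H f"
proof -
  have "l = j \<or> l = k" if "l < 3" "l \<noteq> i" for l
    using assms(2) that by auto
  then have "\<forall>l<3. l \<noteq> i \<longrightarrow> deg H (f l) = 3 \<and> deg H (f (l + 3)) = 2 \<and>
      (\<forall>w\<in>nbhd H (f (l + 3)) - {f l}. heavy H w)"
    using heavy_net_degs(3-5)[OF net] heavy_net_degs(3-5)[OF heavy_net_swap[OF net]] by metis
  moreover have "i < 3"
    using assms(2) by auto
  ultimately show ?thesis
    using heavy_net_degs(1,2)[OF net] unfolding q_heavy_net_def by blast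
qed

lemma (in wounded_heavy_closure) q_heavy_net_if_light_net:
  assumes net: "light_net (f 0) (f 3) (f 1) (f 4) (f 2) (f 5)"
  shows "q_heavy_net H f"
proof -
  note nets = net light_net_swap12[OF net] light_net_rotate[OF light_net_rotate[OF net]]
  have q_heavy: "q_heavy_net H f" if "heavy_net (f i) b (f j) b' (f k) b''" "{i, j, k} = {..<3}"
    "b = f (i + 3)" "b' = f (j + 3)" "b'' = f (k + 3)" for i j k b b' b''
    using q_heavy_net_if_heavy_net that by blast
  have indices: "{..<3::nat} = {0, 1, 2}"
    by auto
  consider "heavy_net (f 0) (f 3) (f 1) (f 4) (f 2) (f 5)"
    | "heavy_net (f 1) (f 4) (f 0) (f 3) (f 2) (f 5)"
    | "heavy_net (f 2) (f 5) (f 0) (f 3) (f 1) (f 4)"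
    using some_heavy_arm[OF net] nets unfolding heavy_net_def by blast
  then show ?thesis
    by cases (erule q_heavy; auto simp: indices)+
qed

lemma (in claw_heavy_closure) light_net_if_not_p_heavy:
  assumes "induced_embedding net_graph H f" "\<not> p_heavy_net H f"
  shows "light_net (f 0) (f 3) (f 1) (f 4) (f 2) (f 5)"
proof -
  have net: "is_net (parcs H) (f 0) (f 3) (f 1) (f 4) (f 2) (f 5)"
    using assms(1) H.induced_embedding_net_iff by blast
  have "deg H (f i) + deg H (f j) < n" if "F (f i) (f j)" "i < 3" "j < 3" for i j
    using assms(2) that unfolding p_heavy_net_def a_heavy_pair_def by (meson linorder_not_le)
  then show ?thesis
    using net unfolding light_net_def is_net_def by simp
qed

section \<open>The forbidden graphs\<close>

lemma o_heavy_if_induced_subgraph: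
  assumes "induced_embedding S T g" "o_heavy S G"
  shows "o_heavy T G"
  unfolding o_heavy_def
proof (intro allI impI)
  fix f
  assume embedding: "induced_embedding T G f"
  have "induced_embedding S G (f \<circ> g)"
    using embedding assms(1) unfolding induced_embedding_def
    by (auto simp: image_subset_iff inj_on_def)
  then obtain u v where "u \<in> (f \<circ> g) ` pverts S" "v \<in> (f \<circ> g) ` pverts S" "o_heavy_pair G u v"
    using assms(2) unfolding o_heavy_def by meson
  moreover have "(f \<circ> g) ` pverts S \<subseteq> f ` pverts T"
    using assms(1) unfolding induced_embedding_def by auto
  ultimately show "\<exists>u\<in>f ` pverts T. \<exists>v\<in>f ` pverts T. o_heavy_pair G u v"
    by (meson subsetD)
qed

lemma pair_graph_graph_on:
  assumes "E \<subseteq> {..<k} \<times> {..<k}" "irrefl E"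
  shows "pair_graph (graph_on k E)"
proof -
  have "finite E"
    using assms(1) finite_subset by blast
  then show ?thesis
    using assms by unfold_locales (auto simp: graph_on_def irrefl_def symmetric_def sym_def)
qed

lemma path_graph_numeral:
  "path_graph 4 = graph_on 4 {(0, 1), (1, 2), (2, 3)}"
  "path_graph 5 = graph_on 5 {(0, 1), (1, 2), (2, 3), (3, 4)}"
  unfolding path_graph_def
  by (rule arg_cong[of _ _ "graph_on _"]; auto simp: less_Suc_eq numeral_eq_Suc)+

lemma cycle_graph_3: "cycle_graph 3 = graph_on 3 {(0, 1), (0, 2), (1, 2)}"
  unfolding cycle_graph_def graph_on_def by (auto simp: less_Suc_eq numeral_eq_Suc)

lemma Z_graph_numeral:
  "Z_graph 1 = graph_on 4 {(0, 1), (1, 2), (0, 2), (2, 3)}"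
  "Z_graph 2 = graph_on 5 {(0, 1), (1, 2), (0, 2), (2, 3), (3, 4)}"
  unfolding Z_graph_def graph_on_def by (auto simp: less_Suc_eq numeral_eq_Suc)

lemma induced_embedding_net_graph:
  "induced_embedding (path_graph 4) net_graph ((!) [3, 0, 1, 4])"
  "induced_embedding (cycle_graph 3) net_graph ((!) [0, 1, 2])"
  "induced_embedding (Z_graph 1) net_graph ((!) [0, 1, 2, 5])"
  "induced_embedding bull_graph net_graph ((!) [0, 1, 2, 3, 4])"
proof -
  interpret net: pair_graph net_graph
    unfolding net_graph_def by (rule pair_graph_graph_on) (auto simp: irrefl_def)
  show "induced_embedding (path_graph 4) net_graph ((!) [3, 0, 1, 4])"
    "induced_embedding (cycle_graph 3) net_graph ((!) [0, 1, 2])"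
    "induced_embedding (Z_graph 1) net_graph ((!) [0, 1, 2, 5])"
    "induced_embedding bull_graph net_graph ((!) [0, 1, 2, 3, 4])"
    unfolding path_graph_numeral cycle_graph_3 Z_graph_numeral bull_graph_def
    by (subst net.induced_embedding_graph_on_iff;
        force simp: net_graph_def graph_on_def lessThan_Suc numeral_eq_Suc All_less_Suc)+
qed

lemma induced_embedding_wounded_graph:
  "induced_embedding (path_graph 5) wounded_graph ((!) [3, 0, 1, 4, 5])"
  "induced_embedding (Z_graph 2) wounded_graph ((!) [0, 2, 1, 4, 5])"
proof -
  interpret wounded: pair_graph wounded_graph
    unfolding wounded_graph_def by (rule pair_graph_graph_on) (auto simp: irrefl_def)
  show "induced_embedding (path_graph 5) wounded_graph ((!) [3, 0, 1, 4, 5])"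
    "induced_embedding (Z_graph 2) wounded_graph ((!) [0, 2, 1, 4, 5])"
    unfolding path_graph_numeral Z_graph_numeral
    by (subst wounded.induced_embedding_graph_on_iff;
        force simp: wounded_graph_def graph_on_def lessThan_Suc numeral_eq_Suc All_less_Suc)+
qed

lemma o_heavy_net_or_wounded:
  assumes "S \<in> {path_graph 4, path_graph 5, cycle_graph 3, Z_graph 1, Z_graph 2,
              bull_graph, net_graph, wounded_graph}" and "o_heavy S G"
  shows "o_heavy net_graph G \<or> o_heavy wounded_graph G"
  using assms
  by (auto simp del: One_nat_def dest: induced_embedding_net_graph[THEN o_heavy_if_induced_subgraph]
      induced_embedding_wounded_graph[THEN o_heavy_if_induced_subgraph])

theorem theorem13:
  fixes G H :: "'a pair_pre_digraph" and S :: "nat pair_pre_digraph"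
  assumes "pair_graph G"
    and "two_connected G"
    and "S \<in> {path_graph 4, path_graph 5, cycle_graph 3, Z_graph 1, Z_graph 2,
              bull_graph, net_graph, wounded_graph}"
    and "family_o_heavy {claw_graph, S} G"
    and "is_c_closure G H"
  shows "induced_free claw_graph H \<and> N_pq_heavy H"
proof
  have heavy: "o_heavy claw_graph G" "o_heavy S G"
    using assms(4) by (simp_all add: family_o_heavy_def)
  interpret claw_heavy_closure G H
    using assms(1,5) heavy(1) by (intro claw_heavy_closure.intro)
  show "induced_free claw_graph H"
    using H.claw_free_parcs by (simp add: H.induced_free_claw_iff)
  show "N_pq_heavy H"
    unfolding N_pq_heavy_def disj_imp
  proof (intro allI impI)
    fix f
    assume "induced_embedding net_graph H f" "\<not> p_heavy_net H f"
    then have net: "light_net (f 0) (f 3) (f 1) (f 4) (f 2) (f 5)"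
      by (rule light_net_if_not_p_heavy)
    then have "o_heavy wounded_graph G"
      using o_heavy_net_or_wounded[OF assms(3) heavy(2)] light_net_not_o_heavy_net by blast
    then interpret wounded_heavy_closure G H
      using assms(2) by unfold_locales
    show "q_heavy_net H f"
      using net by (rule q_heavy_net_if_light_net)
  qed
qed

end
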